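(* Let $l\ge1$, $d\ge1$, and let $Q_1,\dots,Q_l$ be nondegenerate symmetric bilinear forms on $\mathbb R^d$. Suppose $E_1,\dots,E_{2l}\subset\mathbb R^d$ are compact sets with $\dim_{\mathcal H}(E_i)>\frac d2+\frac1{2l}$ for all $1\le i\le 2l$. Then the set $$\Sigma_{\vec Q}(E_1,\dots,E_{2l}):=\left\{\sum_{j=1}^l Q_j\left(x^{2j-1},x^{2j}\right) : x^i\in E_i,\ 1\le i\le 2l\right\}\subset\mathbb R$$ has nonempty interior. In particular, under the same conditions on the $\dim_{\mathcal H}(E_i)$, the set $$\left\{(x^1\cdot x^2)+(x^3\cdot x^4)+\cdots+(x^{2l-1}\cdot x^{2l}) : x^i\in E_i,\ 1\le i\le 2l\right\}$$ has nonempty interior.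
   Context: $\dim_{\mathcal H}$ denotes Hausdorff dimension and $x\cdot y$ the Euclidean inner product on $\mathbb R^d$. *)

theory Defs
  imports "HOL-Analysis.Analysis"
begin

definition hausdorff_content_delta :: "real \<Rightarrow> real \<Rightarrow> 'a::metric_space set \<Rightarrow> ennreal" where
  "hausdorff_content_delta s \<delta> E =
     (INF C \<in> {C :: nat \<Rightarrow> 'a set. E \<subseteq> (\<Union>n. C n) \<and> (\<forall>n. bounded (C n) \<and> diameter (C n) \<le> \<delta>)}.
        (\<Sum>n. ennreal (diameter (C n) powr s)))"

definition hausdorff_measure :: "real \<Rightarrow> 'a::metric_space set \<Rightarrow> ennreal" where
  "hausdorff_measure s E = (SUP \<delta> \<in> {0<..}. hausdorff_content_delta s \<delta> E)"

definition hausdorff_dim :: "'a::metric_space set \<Rightarrow> real" where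
  "hausdorff_dim E = Inf {s. 0 < s \<and> hausdorff_measure s E = 0}"

end

(*
Writing Q_j(x,y) = x . A_j y and passing to product sets in dimension D = l d, the sum becomes a single
inner product x . y of points carrying Frostman weights of exponent l s > (D + 1) / 2. Let F(t;N) be the
density of x . y at t, low-pass filtered at frequency N. In the chart u = 1/x_0, w = x'/x_0 the equation
x . y = t reads t u = w . y' + y_0. Therefore the part of F of frequency about N is controlled, by
Cauchy-Schwarz between the (u, w)-side and the y-side with Gaussian cut-offs, by the energies of both
weights at scale 1/N; this gives |dF/dN| <= C N^(-1-eta), provided t stays away from 0. A point with
nonzero t exists because otherwise the supports would lie in orthogonal affine subspaces, one of which is
too small to carry dimension > d/2.

No limit measure is needed: at each scale 2^(-n) one takes finitely many weighted points of the sets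
themselves, with constants independent of n. If the sumset had empty interior, F would tend to 0 on a dense
set of t, so |F(t;M)| <= C M^(-eta) on a whole interval, contradicting that the integral of F over t stays
bounded away from 0.
*)
theory Submission
  imports Defs "HOL-Probability.Probability"
begin

section \<open>Gaussian integrals and Hermite functions\<close>

text \<open>The threshold: in the chart the phase pairs only the D - 1 coordinates w and y', while u
  and y_0 each belong to one side. The Gaussian cut-off therefore costs a factor N^(D-1) on the
  x-side only, and Cauchy-Schwarz with weight \<sigma> bounds dF/dN by \<sigma> N^(D-1) N^(-ls) +
  \<sigma>^(-1) N^(-ls). Taking \<sigma> = N^(-(D-1)/2) leaves N^((D-1)/2 - ls), which is integrable
  at infinity exactly when ls > (D+1)/2, that is, s > d/2 + 1/(2l). Since u enters the phase only
  through tu, distances in u are visible only for t away from 0. Differentiating in N replaces a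
  dyadic decomposition. The low-pass kernel is built so that dF/dN has an even derivative of a
  Gaussian as its kernel. Its Fourier multiplier is a power of \<tau> times exp(-\<tau>^2) up to a
  constant; the power of \<tau> becomes polynomial decay in the distance on the y-side. Every
  integral is then a Gaussian one in closed form, and only finite sums over explicit kernels have to
  be estimated.\<close>

lemma has_bochner_integral_gaussian_char:
  fixes w :: real
  assumes "\<alpha> > 0"
  shows "has_bochner_integral lborel (\<lambda>x. complex_of_real (exp (- \<alpha> * x\<^sup>2)) * exp (\<i> * (x * w)))
           (complex_of_real (sqrt (pi / \<alpha>) * exp (- (w\<^sup>2 / (4 * \<alpha>)))))"
proof -
  define c where "c = sqrt (2 * \<alpha>)"
  define t where "t = w / c"
  have c: "c > 0" "c\<^sup>2 = 2 * \<alpha>" using assms by (auto simp: c_def)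
  have int: "integrable lborel (\<lambda>x. complex_of_real (std_normal_density x) * exp (\<i> * (t * x)))"
    by (rule Bochner_Integration.integrable_bound[OF integrable_normal_density[of 1 0]])
       (auto simp: norm_mult normal_density_nonneg)
  have "(CLINT x|std_normal_distribution. iexp (t * x))
      = (CLINT x|lborel. complex_of_real (std_normal_density x) * exp (\<i> * (t * x)))"
    by (subst integral_density) (auto simp: normal_density_nonneg scaleR_conv_of_real)
  then have "(CLINT x|lborel. complex_of_real (std_normal_density x) * exp (\<i> * (t * x)))
      = complex_of_real (exp (- (t\<^sup>2) / 2))"
    using char_std_normal_distribution by (simp add: char_def fun_eq_iff)
  then have "has_bochner_integral lborel (\<lambda>x. complex_of_real (std_normal_density x) * exp (\<i> * (t * x)))
      (complex_of_real (exp (- (t\<^sup>2) / 2)))"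
    using int has_bochner_integral_iff by blast
  then have "has_bochner_integral lborel (\<lambda>x. complex_of_real (std_normal_density (0 + c * x)) * exp (\<i> * (t * (0 + c * x))))
      (complex_of_real (exp (- (t\<^sup>2) / 2)) /\<^sub>R \<bar>c\<bar>)"
    using c(1) by (subst (asm) lborel_has_bochner_integral_real_affine_iff[of c _ _ 0]) auto
  from has_bochner_integral_mult_right[OF this, of "complex_of_real (sqrt (2 * pi))"]
  have "has_bochner_integral lborel (\<lambda>x. complex_of_real (sqrt (2 * pi)) * 
      (complex_of_real (std_normal_density (0 + c * x)) * exp (\<i> * (t * (0 + c * x)))))
      (complex_of_real (sqrt (2 * pi)) * (complex_of_real (exp (- (t\<^sup>2) / 2)) /\<^sub>R \<bar>c\<bar>))" .
  moreover have "(\<lambda>x. complex_of_real (sqrt (2 * pi)) * 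
      (complex_of_real (std_normal_density (0 + c * x)) * exp (\<i> * (t * (0 + c * x)))))
      = (\<lambda>x. complex_of_real (exp (- \<alpha> * x\<^sup>2)) * exp (\<i> * (x * w)))"
  proof
    fix x
    have *: "(0 + c * x)\<^sup>2 / 2 = \<alpha> * x\<^sup>2" using c by (simp add: power_mult_distrib)
    have **: "t * (0 + c * x) = x * w" using c by (simp add: t_def)
    have "sqrt (2 * pi) * std_normal_density (0 + c * x) = exp (- \<alpha> * x\<^sup>2)"
      unfolding std_normal_density_def minus_divide_left[symmetric] * by simp
    then have "complex_of_real (sqrt (2 * pi)) * complex_of_real (std_normal_density (0 + c * x)) = complex_of_real (exp (- \<alpha> * x\<^sup>2))"
      by (simp only: flip: of_real_mult)
    then show "complex_of_real (sqrt (2 * pi)) * 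
      (complex_of_real (std_normal_density (0 + c * x)) * exp (\<i> * (t * (0 + c * x))))
      = complex_of_real (exp (- \<alpha> * x\<^sup>2)) * exp (\<i> * (x * w))"
      by (simp only: ** mult.assoc[symmetric])
  qed
  moreover have "complex_of_real (sqrt (2 * pi)) * (complex_of_real (exp (- (t\<^sup>2) / 2)) /\<^sub>R \<bar>c\<bar>)
      = complex_of_real (sqrt (pi / \<alpha>) * exp (- (w\<^sup>2 / (4 * \<alpha>))))"
  proof -
    have "t\<^sup>2 / 2 = w\<^sup>2 / (4 * \<alpha>)" using c by (simp add: t_def power_divide)
    moreover have "sqrt (2 * pi) / c = sqrt (pi / \<alpha>)"
      unfolding c_def using assms by (simp add: real_sqrt_divide[symmetric] real_sqrt_mult)
    ultimately show ?thesis using c(1)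
      by (simp add: scaleR_conv_of_real field_simps flip: of_real_mult of_real_divide of_real_inverse)
  qed
  ultimately show ?thesis by simp
qed

text \<open>Completing the square recentres the previous integral at
  \<open>c / (2 * \<alpha>)\<close>; the shift produces both the growth in \<open>c\<close> and the
  extra phase.\<close>

lemma has_bochner_integral_gaussian_exp:
  fixes c w :: real
  assumes "\<alpha> > 0"
  shows "has_bochner_integral lborel
           (\<lambda>x. complex_of_real (exp (- \<alpha> * x\<^sup>2 + c * x)) * exp (\<i> * (x * w)))
           (complex_of_real (sqrt (pi / \<alpha>) * exp ((c\<^sup>2 - w\<^sup>2) / (4 * \<alpha>))) * exp (\<i> * (c * w / (2 * \<alpha>))))"
proof -
  define b where "b = c / (2 * \<alpha>)"
  have b: "c = 2 * \<alpha> * b" using assms by (simp add: b_def)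
  have 1: "has_bochner_integral lborel (\<lambda>x. complex_of_real (exp (- \<alpha> * (-b + 1 * x)\<^sup>2)) * exp (\<i> * ((-b + 1 * x) * w)))
           (complex_of_real (sqrt (pi / \<alpha>) * exp (- (w\<^sup>2 / (4 * \<alpha>)))) /\<^sub>R \<bar>1\<bar>)"
    using has_bochner_integral_gaussian_char[OF assms, of w]
    by (subst (asm) lborel_has_bochner_integral_real_affine_iff[of 1 _ _ "-b"]) auto
  have 2: "complex_of_real (exp (- \<alpha> * x\<^sup>2 + c * x)) * exp (\<i> * (x * w)) = 
      (complex_of_real (exp (\<alpha> * b\<^sup>2)) * exp (\<i> * (b * w))) *
      (complex_of_real (exp (- \<alpha> * (-b + 1 * x)\<^sup>2)) * exp (\<i> * ((-b + 1 * x) * w)))" for x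
  proof -
    have "- \<alpha> * x\<^sup>2 + c * x = \<alpha> * b\<^sup>2 + - \<alpha> * (-b + 1 * x)\<^sup>2"
      by (simp add: b power2_eq_square algebra_simps)
    moreover have "\<i> * (x * w) = \<i> * (b * w) + \<i> * ((-b + 1 * x) * w)"
      by (simp add: algebra_simps)
    ultimately show ?thesis by (simp only: exp_add of_real_mult) (simp add: mult_ac)
  qed
  have 3: "(complex_of_real (exp (\<alpha> * b\<^sup>2)) * exp (\<i> * (b * w))) *
      (complex_of_real (sqrt (pi / \<alpha>) * exp (- (w\<^sup>2 / (4 * \<alpha>)))) /\<^sub>R \<bar>1\<bar>)
     = complex_of_real (sqrt (pi / \<alpha>) * exp ((c\<^sup>2 - w\<^sup>2) / (4 * \<alpha>))) * exp (\<i> * (c * w / (2 * \<alpha>)))"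
  proof -
    have "(c\<^sup>2 - w\<^sup>2) / (4 * \<alpha>) = \<alpha> * b\<^sup>2 + - (w\<^sup>2 / (4 * \<alpha>))"
      using assms by (simp add: b diff_divide_distrib) (simp add: power2_eq_square field_simps)
    moreover have "b * w = c * w / (2 * \<alpha>)" using assms by (simp add: b_def)
    ultimately show ?thesis by (simp only: exp_add) (simp add: mult_ac)
  qed
  from has_bochner_integral_mult_right[OF 1, of "complex_of_real (exp (\<alpha> * b\<^sup>2)) * exp (\<i> * (b * w))"]
  show ?thesis unfolding 2 3 .
qed

text \<open>The fundamental theorem of calculus on the whole line. It serves as integration by parts
  for the Gaussian moments.\<close>

lemma integral_deriv_eq_0:
  fixes F f :: "real \<Rightarrow> 'a::euclidean_space"
  assumes "\<And>x. (F has_vector_derivative f x) (at x)" "continuous_on UNIV f" "integrable lborel f"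
    and "(F \<longlongrightarrow> 0) at_top" "(F \<longlongrightarrow> 0) at_bot"
  shows "integral\<^sup>L lborel f = 0"
proof -
  have "interval_lebesgue_integral lborel (-\<infinity>) \<infinity> f = 0 - 0"
  proof (rule interval_integral_FTC_integrable[where F = F])
    show "isCont f x" for x using assms(2) by (simp add: continuous_on_eq_continuous_at)
    show "set_integrable lborel (einterval (-\<infinity>) \<infinity>) f"
      using assms(3) by (simp add: set_integrable_def)
    show "((F \<circ> real_of_ereal) \<longlongrightarrow> 0) (at_right (-\<infinity>))"
      using assms(5) by (simp add: ereal_tendsto_simps)
    show "((F \<circ> real_of_ereal) \<longlongrightarrow> 0) (at_left \<infinity>)"
      using assms(4) by (simp add: ereal_tendsto_simps)
  qed (use assms in auto)
  then show ?thesis by (simp add: interval_lebesgue_integral_def set_lebesgue_integral_def)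
qed

text \<open>\<open>1 + \<bar>x\<bar> \<le> exp \<bar>x\<bar>\<close> turns the power into
  \<open>exp (j * \<bar>x\<bar>)\<close>, and completing the square in \<open>\<bar>x\<bar>\<close>
  absorbs this into the Gaussian at the price of an explicit constant.\<close>

lemma power_exp_bound:
  fixes x :: real
  assumes "\<alpha> > 0"
  shows "(1 + \<bar>x\<bar>) ^ j * exp (- \<alpha> * x\<^sup>2) \<le> exp (real j ^ 2 / (4 * \<alpha>))"
proof -
  have "(1 + \<bar>x\<bar>) ^ j \<le> exp \<bar>x\<bar> ^ j"
    by (rule power_mono) auto
  also have "\<dots> = exp (real j * \<bar>x\<bar>)" by (simp add: exp_of_nat_mult)
  also have "\<dots> \<le> exp (\<alpha> * x\<^sup>2 + real j ^ 2 / (4 * \<alpha>))"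
  proof -
    have "\<alpha> * (\<bar>x\<bar> - real j / (2 * \<alpha>))\<^sup>2 = \<alpha> * x\<^sup>2 - real j * \<bar>x\<bar> + real j ^ 2 / (4 * \<alpha>)"
      using assms by (simp add: power2_eq_square field_simps)
    moreover have "\<alpha> * (\<bar>x\<bar> - real j / (2 * \<alpha>))\<^sup>2 \<ge> 0" using assms by simp
    ultimately show ?thesis by simp
  qed
  finally have "(1 + \<bar>x\<bar>) ^ j * exp (- \<alpha> * x\<^sup>2) \<le> exp (\<alpha> * x\<^sup>2 + real j ^ 2 / (4 * \<alpha>)) * exp (- \<alpha> * x\<^sup>2)"
    by (intro mult_right_mono) auto
  then show ?thesis by (simp flip: exp_add)
qed

lemma integrable_gaussian:
  assumes "\<alpha> > 0"
  shows "integrable lborel (\<lambda>x::real. exp (- \<alpha> * x\<^sup>2))"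
proof -
  have "integrable lborel (\<lambda>x. norm (complex_of_real (exp (- \<alpha> * x\<^sup>2)) * exp (\<i> * (x * 0))))"
    using has_bochner_integral_gaussian_char[OF assms, of 0] has_bochner_integral_iff
    by (intro integrable_norm) blast
  then show ?thesis by (simp add: norm_mult)
qed

lemma integral_gaussian:
  assumes "\<alpha> > 0"
  shows "(LINT x::real|lborel. exp (- \<alpha> * x\<^sup>2)) = sqrt (pi / \<alpha>)"
proof -
  have "has_bochner_integral lborel (\<lambda>x. complex_of_real (exp (- \<alpha> * x\<^sup>2))) (complex_of_real (sqrt (pi / \<alpha>)))"
    using has_bochner_integral_gaussian_char[OF assms, of 0] by simp
  then have "complex_of_real (LINT x::real|lborel. exp (- \<alpha> * x\<^sup>2)) = complex_of_real (sqrt (pi / \<alpha>))"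
    by (simp only: has_bochner_integral_iff integral_complex_of_real)
  then show ?thesis by (simp only: of_real_eq_iff)
qed

text \<open>Half of the Gaussian pays for the polynomial factor, the other half is
  integrable.\<close>

lemma integrable_gaussian_bounded:
  fixes f :: "real \<Rightarrow> 'a::{banach, second_countable_topology}"
  assumes "\<alpha> > 0" "f \<in> borel_measurable borel"
    and "\<And>x. norm (f x) \<le> C * ((1 + \<bar>x\<bar>) ^ j * exp (- \<alpha> * x\<^sup>2))"
  shows "integrable lborel f"
proof (rule Bochner_Integration.integrable_bound)
  define D where "D = \<bar>C\<bar> * exp (real j ^ 2 / (4 * (\<alpha> / 2)))"
  show "integrable lborel (\<lambda>x. D * exp (- (\<alpha> / 2) * x\<^sup>2))"
    using assms(1) by (intro integrable_mult_right integrable_gaussian) auto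
  have "norm (f x) \<le> norm (D * exp (- (\<alpha> / 2) * x\<^sup>2))" for x
  proof -
    have "norm (f x) \<le> \<bar>C\<bar> * ((1 + \<bar>x\<bar>) ^ j * exp (- \<alpha> * x\<^sup>2))"
      by (rule order.trans[OF assms(3)]) (intro mult_right_mono, auto)
    also have "\<dots> = \<bar>C\<bar> * ((1 + \<bar>x\<bar>) ^ j * exp (- (\<alpha> / 2) * x\<^sup>2)) * exp (- (\<alpha> / 2) * x\<^sup>2)"
      by (simp add: mult.assoc flip: exp_add) 
    also have "\<dots> \<le> D * exp (- (\<alpha> / 2) * x\<^sup>2)"
      unfolding D_def using assms(1)
      by (intro mult_right_mono mult_left_mono power_exp_bound) auto
    finally show ?thesis by (simp add: D_def)
  qed
  then show "AE x in lborel. norm (f x) \<le> norm (D * exp (- (\<alpha> / 2) * x\<^sup>2))" by simp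
qed (use assms in auto)

section \<open>Derivatives of the Gaussian and their decay\<close>

text \<open>The j-th derivative of the Fourier transform of exp(-\<tau>^2), hence a Hermite function
  up to scaling. The recursion is g' = -(x/2) g differentiated by Leibniz' rule; it avoids
  introducing the Hermite polynomials.\<close>

fun gauss_deriv :: "nat \<Rightarrow> real \<Rightarrow> real" where
  "gauss_deriv 0 x = sqrt pi * exp (- (x\<^sup>2 / 4))"
| "gauss_deriv (Suc 0) x = - (x / 2) * gauss_deriv 0 x"
| "gauss_deriv (Suc (Suc j)) x = - (x / 2) * gauss_deriv (Suc j) x - real (Suc j) / 2 * gauss_deriv j x"

lemma DERIV_gauss_deriv: "(gauss_deriv j has_real_derivative gauss_deriv (Suc j) x) (at x)"
proof (induction j arbitrary: x rule: less_induct)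
  case (less j)
  consider "j = 0" | "j = 1" | i where "j = Suc (Suc i)" by (metis One_nat_def not0_implies_Suc)
  then show ?case
  proof cases
    case 1
    have "((\<lambda>x. sqrt pi * exp (- (x\<^sup>2 / 4))) has_real_derivative gauss_deriv (Suc 0) x) (at x)"
      by (auto intro!: derivative_eq_intros)
    moreover have "gauss_deriv 0 = (\<lambda>x. sqrt pi * exp (- (x\<^sup>2 / 4)))" by (auto simp: fun_eq_iff)
    ultimately show ?thesis using 1 by metis
  next
    case 2
    have d: "(gauss_deriv 0 has_real_derivative gauss_deriv (Suc 0) x) (at x)"
      using less[of 0 x] unfolding 2 by (simp only: zero_less_one)
    have "((\<lambda>x. - (x / 2) * gauss_deriv 0 x) has_real_derivative gauss_deriv (Suc (Suc 0)) x) (at x)"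
      by (auto intro!: derivative_eq_intros d simp del: gauss_deriv.simps(1,2)) (simp add: field_simps)
    moreover have "gauss_deriv (Suc 0) = (\<lambda>x. - (x / 2) * gauss_deriv 0 x)" by (auto simp: fun_eq_iff)
    ultimately show ?thesis using 2 by (metis One_nat_def)
  next
    case 3
    have d: "(gauss_deriv i has_real_derivative gauss_deriv (Suc i) x) (at x)"
      "(gauss_deriv (Suc i) has_real_derivative gauss_deriv (Suc (Suc i)) x) (at x)"
      using less[of i x] less[of "Suc i" x] 3 by (simp_all only: less_Suc_eq simp_thms)
    have "((\<lambda>x. - (x / 2) * gauss_deriv (Suc i) x - real (Suc i) / 2 * gauss_deriv i x)
        has_real_derivative gauss_deriv (Suc (Suc (Suc i))) x) (at x)"
      by (auto intro!: derivative_eq_intros d simp del: gauss_deriv.simps) (simp add: field_simps)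
    moreover have "gauss_deriv (Suc (Suc i)) = (\<lambda>x. - (x / 2) * gauss_deriv (Suc i) x - real (Suc i) / 2 * gauss_deriv i x)"
      by (auto simp: fun_eq_iff)
    ultimately show ?thesis unfolding 3 by metis
  qed
qed

lemma continuous_on_gauss_deriv: "continuous_on A (gauss_deriv j)"
  by (meson DERIV_gauss_deriv DERIV_isCont continuous_at_imp_continuous_on)

lemma gauss_deriv_poly_bound: "\<exists>C>0. \<forall>x. \<bar>gauss_deriv j x\<bar> \<le> C * ((1 + \<bar>x\<bar>) ^ j * exp (- (1/4) * x\<^sup>2))"
proof (induction j rule: induct_nat_012)
  case 0
  show ?case by (intro exI[of _ "sqrt pi"]) (simp add: abs_mult)
next
  case 1
  have "\<bar>x\<bar> / 2 * (sqrt pi * exp (- (x\<^sup>2 / 4))) \<le> sqrt pi * ((1 + \<bar>x\<bar>) * exp (- (x\<^sup>2/4)))" for x :: real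
  proof -
    have "\<bar>x\<bar> / 2 * (sqrt pi * exp (- (x\<^sup>2 / 4))) \<le> (1 + \<bar>x\<bar>) * (sqrt pi * exp (- (x\<^sup>2 / 4)))"
      by (intro mult_right_mono) auto
    then show ?thesis by (simp add: mult_ac)
  qed
  then show ?case by (intro exI[of _ "sqrt pi"]) (simp add: abs_mult)
next
  case (ge2 i)
  define e where "e x = exp (- (1/4) * x\<^sup>2)" for x :: real
  have e: "e x > 0" for x by (simp add: e_def)
  from ge2(2) obtain C1 where C1: "C1 > 0" "\<forall>x. \<bar>gauss_deriv (Suc i) x\<bar> \<le> C1 * ((1 + \<bar>x\<bar>) ^ Suc i * e x)"
    unfolding e_def[symmetric] by (elim exE conjE) (rule that)
  from ge2(1) obtain C0 where C0: "C0 > 0" "\<forall>x. \<bar>gauss_deriv i x\<bar> \<le> C0 * ((1 + \<bar>x\<bar>) ^ i * e x)"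
    unfolding e_def[symmetric] by (elim exE conjE) (rule that)
  have bound: "\<bar>gauss_deriv (Suc (Suc i)) x\<bar> \<le> (C1 + real (Suc i) * C0) * ((1 + \<bar>x\<bar>) ^ Suc (Suc i) * e x)" for x
  proof -
    have 1: "\<bar>gauss_deriv (Suc (Suc i)) x\<bar> \<le> \<bar>x\<bar> / 2 * \<bar>gauss_deriv (Suc i) x\<bar> + real (Suc i) / 2 * \<bar>gauss_deriv i x\<bar>"
      unfolding gauss_deriv.simps(3) by (rule order.trans[OF abs_triangle_ineq4]) (simp add: abs_mult)
    have 2: "\<bar>x\<bar> / 2 * \<bar>gauss_deriv (Suc i) x\<bar> \<le> (1 + \<bar>x\<bar>) * (C1 * ((1 + \<bar>x\<bar>) ^ Suc i * e x))"
      by (rule mult_mono[OF _ C1(2)[rule_format]]) auto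
    have "C0 * ((1 + \<bar>x\<bar>) ^ i * e x) \<le> C0 * ((1 + \<bar>x\<bar>) ^ Suc (Suc i) * e x)"
      using C0(1) e[of x] by (intro mult_left_mono mult_right_mono power_increasing) auto
    then have "\<bar>gauss_deriv i x\<bar> \<le> C0 * ((1 + \<bar>x\<bar>) ^ Suc (Suc i) * e x)"
      using C0(2)[rule_format, of x] by linarith
    then have 3: "real (Suc i) / 2 * \<bar>gauss_deriv i x\<bar> \<le> real (Suc i) * (C0 * ((1 + \<bar>x\<bar>) ^ Suc (Suc i) * e x))"
      by (rule mult_mono[rotated]) auto
    have "(1 + \<bar>x\<bar>) * (C1 * ((1 + \<bar>x\<bar>) ^ Suc i * e x)) + real (Suc i) * (C0 * ((1 + \<bar>x\<bar>) ^ Suc (Suc i) * e x))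
        = (C1 + real (Suc i) * C0) * ((1 + \<bar>x\<bar>) ^ Suc (Suc i) * e x)"
      by (simp add: algebra_simps)
    with 1 2 3 show ?thesis by linarith
  qed
  have "C1 + real (Suc i) * C0 > 0" using C0(1) C1(1) by (simp add: add_pos_nonneg)
  then show ?case unfolding e_def[symmetric] by (intro exI[of _ "C1 + real (Suc i) * C0"] conjI allI bound)
qed

lemma gauss_deriv_bound:
  "\<exists>C>0. \<forall>x. (1 + \<bar>x\<bar>) ^ k * \<bar>gauss_deriv j x\<bar> \<le> C * exp (- (1/8) * x\<^sup>2)"
proof -
  obtain C where C: "C > 0" "\<And>x. \<bar>gauss_deriv j x\<bar> \<le> C * ((1 + \<bar>x\<bar>) ^ j * exp (- (1/4) * x\<^sup>2))"
    using gauss_deriv_poly_bound by blast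
  let ?D = "C * exp (real (k + j) ^ 2 / (4 * (1 / 8)))"
  have "(1 + \<bar>x\<bar>) ^ k * \<bar>gauss_deriv j x\<bar> \<le> ?D * exp (- (1/8) * x\<^sup>2)" for x
  proof -
    have "(1 + \<bar>x\<bar>) ^ k * \<bar>gauss_deriv j x\<bar> \<le> (1 + \<bar>x\<bar>) ^ k * (C * ((1 + \<bar>x\<bar>) ^ j * exp (- (1/4) * x\<^sup>2)))"
      by (intro mult_left_mono C) auto
    also have "\<dots> = C * ((1 + \<bar>x\<bar>) ^ (k + j) * exp (- (1/8) * x\<^sup>2)) * exp (- (1/8) * x\<^sup>2)"
      by (simp add: power_add mult_ac flip: exp_add)
    also have "\<dots> \<le> ?D * exp (- (1/8) * x\<^sup>2)"
      using C by (intro mult_right_mono mult_left_mono power_exp_bound) auto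
    finally show ?thesis .
  qed
  then show ?thesis using C(1) by (intro exI[of _ ?D]) auto
qed

lemma gauss_deriv_le_gaussian: "\<exists>C>0. \<forall>x. \<bar>gauss_deriv j x\<bar> \<le> C * exp (- (1/8) * x\<^sup>2)"
  using gauss_deriv_bound[of 0 j] by simp

lemma integrable_gauss_deriv: "integrable lborel (gauss_deriv j)"
proof -
  obtain C where "\<And>x. \<bar>gauss_deriv j x\<bar> \<le> C * exp (- (1/8) * x\<^sup>2)"
    using gauss_deriv_le_gaussian by blast
  then show ?thesis
    by (intro integrable_gaussian_bounded[of "1/8" _ C 0])
       (auto intro!: borel_measurable_continuous_onI continuous_on_gauss_deriv)
qed

lemma gaussian_tendsto_0:
  fixes f :: "real \<Rightarrow> 'a::real_normed_vector"
  assumes "\<alpha> > 0" "\<And>x. norm (f x) \<le> C * exp (- \<alpha> * x\<^sup>2)"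
  shows "(f \<longlongrightarrow> 0) at_top" "(f \<longlongrightarrow> 0) at_bot"
proof -
  define K where "K = \<bar>C\<bar> * exp (1 / (4 * \<alpha>))"
  have bound: "norm (f x) \<le> K * (1 / (1 + \<bar>x\<bar>))" for x
  proof -
    have "(1 + \<bar>x\<bar>) * norm (f x) \<le> \<bar>C\<bar> * ((1 + \<bar>x\<bar>) ^ 1 * exp (- \<alpha> * x\<^sup>2))"
    proof -
      have "norm (f x) \<le> \<bar>C\<bar> * exp (- \<alpha> * x\<^sup>2)"
        by (rule order.trans[OF assms(2)]) (rule mult_right_mono, auto)
      then have "(1 + \<bar>x\<bar>) * norm (f x) \<le> (1 + \<bar>x\<bar>) * (\<bar>C\<bar> * exp (- \<alpha> * x\<^sup>2))"
        by (rule mult_left_mono) auto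
      then show ?thesis by (simp add: mult_ac)
    qed
    also have "\<dots> \<le> K"
      using power_exp_bound[OF assms(1), of x 1] unfolding K_def by (intro mult_left_mono) auto
    finally show ?thesis by (simp add: field_simps)
  qed
  have top: "((\<lambda>x::real. 1 / (1 + \<bar>x\<bar>)) \<longlongrightarrow> 0) at_top"
    by (rule tendsto_divide_0[OF tendsto_const filterlim_at_top_imp_at_infinity[OF
        filterlim_tendsto_add_at_top[OF tendsto_const filterlim_abs_real]]])
  then have bot: "((\<lambda>x::real. 1 / (1 + \<bar>x\<bar>)) \<longlongrightarrow> 0) at_bot"
    by (simp add: filterlim_at_bot_mirror)
  show "(f \<longlongrightarrow> 0) at_top" "(f \<longlongrightarrow> 0) at_bot"
    using tendsto_mult_left[OF top, of K] tendsto_mult_left[OF bot, of K]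
    by (auto intro: Lim_null_comparison[OF always_eventually[OF allI[OF bound]]])
qed

lemma integral_gauss_deriv_Suc: "integral\<^sup>L lborel (gauss_deriv (Suc j)) = 0"
proof -
  obtain C where C: "\<And>x. \<bar>gauss_deriv j x\<bar> \<le> C * exp (- (1/8) * x\<^sup>2)"
    using gauss_deriv_le_gaussian by blast
  show ?thesis
  proof (rule integral_deriv_eq_0[where F = "gauss_deriv j"])
    show "(gauss_deriv j has_vector_derivative gauss_deriv (Suc j) x) (at x)" for x
      by (simp only: DERIV_gauss_deriv flip: has_real_derivative_iff_has_vector_derivative)
    show "(gauss_deriv j \<longlongrightarrow> 0) at_top" "(gauss_deriv j \<longlongrightarrow> 0) at_bot"
      using C by (intro gaussian_tendsto_0[of "1/8" _ C]; simp only: real_norm_def; simp)+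
  qed (rule continuous_on_gauss_deriv integrable_gauss_deriv)+
qed

lemma integral_gauss_deriv_0: "integral\<^sup>L lborel (gauss_deriv 0) > 0"
proof -
  have "gauss_deriv 0 = (\<lambda>x. sqrt pi * exp (- (1 / 4) * x\<^sup>2))" by (simp add: fun_eq_iff)
  then show ?thesis using integral_gaussian[of "1/4"] by simp
qed

declare gauss_deriv.simps [simp del]

section \<open>Fourier moments of the Gaussian and the low-pass kernel\<close>

lemma integrable_gauss_moment:
  "integrable lborel (\<lambda>\<tau>. complex_of_real (\<tau> ^ j * exp (- \<tau>\<^sup>2)) * iexp (\<tau> * x))"
proof (rule integrable_gaussian_bounded[of 1 _ 1 j])
  show "norm (complex_of_real (\<tau> ^ j * exp (- \<tau>\<^sup>2)) * iexp (\<tau> * x))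
      \<le> 1 * ((1 + \<bar>\<tau>\<bar>) ^ j * exp (- 1 * \<tau>\<^sup>2))" for \<tau> :: real
    by (simp add: norm_mult norm_power power_mono)
qed (auto intro!: borel_measurable_continuous_onI continuous_intros)

lemma gauss_moment_tendsto_0:
  "((\<lambda>\<tau>. complex_of_real (\<tau> ^ j * exp (- \<tau>\<^sup>2)) * iexp (\<tau> * x)) \<longlongrightarrow> 0) at_top"
  "((\<lambda>\<tau>. complex_of_real (\<tau> ^ j * exp (- \<tau>\<^sup>2)) * iexp (\<tau> * x)) \<longlongrightarrow> 0) at_bot"
proof -
  have "norm (complex_of_real (\<tau> ^ j * exp (- \<tau>\<^sup>2)) * iexp (\<tau> * x)) \<le> exp (real j ^ 2 / (4 * (1/2))) * exp (- (1/2) * \<tau>\<^sup>2)" for \<tau> :: real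
  proof -
    have "norm (complex_of_real (\<tau> ^ j * exp (- \<tau>\<^sup>2)) * iexp (\<tau> * x)) = \<bar>\<tau>\<bar> ^ j * exp (- (1/2) * \<tau>\<^sup>2) * exp (- (1/2) * \<tau>\<^sup>2)"
      by (simp add: norm_mult norm_power mult.assoc flip: exp_add)
    also have "\<dots> \<le> (1 + \<bar>\<tau>\<bar>) ^ j * exp (- (1/2) * \<tau>\<^sup>2) * exp (- (1/2) * \<tau>\<^sup>2)"
      by (intro mult_right_mono power_mono) auto
    also have "\<dots> \<le> exp (real j ^ 2 / (4 * (1/2))) * exp (- (1/2) * \<tau>\<^sup>2)"
      by (intro mult_right_mono power_exp_bound) auto
    finally show ?thesis .
  qed
  from gaussian_tendsto_0[OF _ this] show
    "((\<lambda>\<tau>. complex_of_real (\<tau> ^ j * exp (- \<tau>\<^sup>2)) * iexp (\<tau> * x)) \<longlongrightarrow> 0) at_top"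
    "((\<lambda>\<tau>. complex_of_real (\<tau> ^ j * exp (- \<tau>\<^sup>2)) * iexp (\<tau> * x)) \<longlongrightarrow> 0) at_bot"
    by simp_all
qed

text \<open>Integration by parts: the derivative of \<tau>^j exp(-\<tau>^2) exp(i \<tau> x)
  integrates to 0. Up to powers of -i this is the recursion of \<open>gauss_deriv\<close>. For
  \<open>j = 0\<close> the truncated index \<open>j - 1\<close> is harmless because its coefficient
  vanishes.\<close>

lemma gauss_moment_rec:
  fixes x :: real
  defines "I j \<equiv> integral\<^sup>L lborel (\<lambda>\<tau>. complex_of_real (\<tau> ^ j * exp (- \<tau>\<^sup>2)) * iexp (\<tau> * x))"
  shows "2 * I (Suc j) = \<i> * x * I j + of_nat j * I (j - 1)"
proof -
  let ?f = "\<lambda>j \<tau>. complex_of_real (\<tau> ^ j * exp (- \<tau>\<^sup>2)) * iexp (\<tau> * x)"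
  let ?g = "\<lambda>\<tau>. of_nat j * ?f (j - 1) \<tau> - 2 * ?f (Suc j) \<tau> + \<i> * x * ?f j \<tau>"
  have int: "integrable lborel (?f j)" for j by (rule integrable_gauss_moment)
  have "integral\<^sup>L lborel ?g = 0"
  proof (rule integral_deriv_eq_0[where F = "?f j"])
    fix \<tau> :: real
    have 1: "((\<lambda>\<tau>. \<tau> ^ j * exp (- \<tau>\<^sup>2)) has_real_derivative
        (real j * \<tau> ^ (j - 1) * exp (- \<tau>\<^sup>2) - 2 * \<tau> ^ Suc j * exp (- \<tau>\<^sup>2))) (at \<tau>)"
      by (auto intro!: derivative_eq_intros)
    have 2: "((\<lambda>\<tau>. complex_of_real (\<tau> ^ j * exp (- \<tau>\<^sup>2))) has_vector_derivative
        complex_of_real (real j * \<tau> ^ (j - 1) * exp (- \<tau>\<^sup>2) - 2 * \<tau> ^ Suc j * exp (- \<tau>\<^sup>2))) (at \<tau>)"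
      by (rule has_vector_derivative_of_real) (use 1 in \<open>simp only: has_real_derivative_iff_has_vector_derivative\<close>)
    have 3: "((\<lambda>\<tau>. iexp (\<tau> * x)) has_vector_derivative
        \<i> * x * iexp (\<tau> * x)) (at \<tau>)"
    proof -
      have "((\<lambda>z. exp (\<i> * (z * x))) has_field_derivative \<i> * x * exp (\<i> * (complex_of_real \<tau> * x))) (at (complex_of_real \<tau>))"
        by (auto intro!: derivative_eq_intros)
      from has_vector_derivative_real_field[OF this] show ?thesis by simp
    qed
    from has_vector_derivative_mult[OF 2 3]
    show "(?f j has_vector_derivative ?g \<tau>) (at \<tau>)"
      by (rule has_vector_derivative_eq_rhs) (simp add: algebra_simps)
  next
    show "continuous_on UNIV ?g" by (intro continuous_intros)
    show "integrable lborel ?g"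
      by (intro Bochner_Integration.integrable_add Bochner_Integration.integrable_diff integrable_mult_right int)
  qed (rule gauss_moment_tendsto_0)+
  also have "integral\<^sup>L lborel ?g = of_nat j * I (j - 1) - 2 * I (Suc j) + \<i> * x * I j"
    unfolding I_def
    by (subst Bochner_Integration.integral_add Bochner_Integration.integral_diff,
        intro Bochner_Integration.integrable_diff integrable_mult_right int, intro integrable_mult_right int)+
       (simp only: integral_mult_right_zero)
  finally show ?thesis by (simp add: algebra_simps)
qed

lemma integral_gauss_moment:
  "integral\<^sup>L lborel (\<lambda>\<tau>. complex_of_real (\<tau> ^ j * exp (- \<tau>\<^sup>2)) * iexp (\<tau> * x))
     = (- \<i>) ^ j * complex_of_real (gauss_deriv j x)"
proof -
  have cancel: "a = b" if "2 * a = 2 * b" for a b :: complex using that by simp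
  show ?thesis
proof (induction j rule: induct_nat_012)
  case 0
  have "integral\<^sup>L lborel (\<lambda>\<tau>. complex_of_real (exp (- 1 * \<tau>\<^sup>2)) * iexp (\<tau> * x))
      = complex_of_real (sqrt (pi / 1) * exp (- (x\<^sup>2 / (4 * 1))))"
    by (rule has_bochner_integral_integral_eq has_bochner_integral_gaussian_char)+ simp
  then show ?case by (simp add: gauss_deriv.simps)
next
  case 1
  have "integral\<^sup>L lborel (\<lambda>\<tau>. complex_of_real (exp (- 1 * \<tau>\<^sup>2)) * iexp (\<tau> * x))
      = complex_of_real (sqrt (pi / 1) * exp (- (x\<^sup>2 / (4 * 1))))"
    by (rule has_bochner_integral_integral_eq has_bochner_integral_gaussian_char)+ simp
  then have "2 * integral\<^sup>L lborel (\<lambda>\<tau>. complex_of_real (\<tau> ^ Suc 0 * exp (- \<tau>\<^sup>2)) * iexp (\<tau> * x))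
      = 2 * ((- \<i>) ^ Suc 0 * complex_of_real (gauss_deriv (Suc 0) x))"
    using gauss_moment_rec[of 0 x] by (simp add: gauss_deriv.simps)
  then show ?case by (rule cancel)
next
  case (ge2 j)
  have "2 * integral\<^sup>L lborel (\<lambda>\<tau>. complex_of_real (\<tau> ^ Suc (Suc j) * exp (- \<tau>\<^sup>2)) * iexp (\<tau> * x))
      = \<i> * x * ((- \<i>) ^ Suc j * complex_of_real (gauss_deriv (Suc j) x)) + of_nat (Suc j) * ((- \<i>) ^ j * complex_of_real (gauss_deriv j x))"
    using gauss_moment_rec[of "Suc j" x] unfolding ge2 diff_Suc_1 by simp
  also have "\<dots> = 2 * ((- \<i>) ^ Suc (Suc j) * complex_of_real (gauss_deriv (Suc (Suc j)) x))"
    by (simp add: gauss_deriv.simps(3) algebra_simps) (simp add: field_simps)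
  finally show ?case by (rule cancel)
qed
qed

lemma has_bochner_integral_gauss_moment:
  assumes "B > 0"
  shows "has_bochner_integral lborel (\<lambda>\<tau>. complex_of_real (\<tau> ^ j * exp (- B * \<tau>\<^sup>2)) * iexp (\<tau> * \<zeta>))
     ((- \<i>) ^ j * complex_of_real (gauss_deriv j (\<zeta> / sqrt B) / sqrt B ^ Suc j))"
proof -
  define c where "c = sqrt B"
  have c: "c > 0" "c\<^sup>2 = B" using assms by (auto simp: c_def)
  have "has_bochner_integral lborel (\<lambda>\<tau>. complex_of_real (\<tau> ^ j * exp (- \<tau>\<^sup>2)) * iexp (\<tau> * (\<zeta> / c)))
     ((- \<i>) ^ j * complex_of_real (gauss_deriv j (\<zeta> / c)))"
    by (simp only: has_bochner_integral_iff integral_gauss_moment integrable_gauss_moment simp_thms)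
  then have "has_bochner_integral lborel (\<lambda>\<tau>. complex_of_real ((0 + c * \<tau>) ^ j * exp (- (0 + c * \<tau>)\<^sup>2)) * iexp ((0 + c * \<tau>) * (\<zeta> / c)))
     ((- \<i>) ^ j * complex_of_real (gauss_deriv j (\<zeta> / c)) /\<^sub>R \<bar>c\<bar>)"
    using c(1) by (subst (asm) lborel_has_bochner_integral_real_affine_iff[of c _ _ 0]) (auto simp del: of_real_add)
  from has_bochner_integral_mult_right[OF this, of "complex_of_real (1 / c ^ j)"]
  have "has_bochner_integral lborel (\<lambda>\<tau>. complex_of_real (1 / c ^ j) * (complex_of_real ((0 + c * \<tau>) ^ j * exp (- (0 + c * \<tau>)\<^sup>2)) * iexp ((0 + c * \<tau>) * (\<zeta> / c))))
     (complex_of_real (1 / c ^ j) * ((- \<i>) ^ j * complex_of_real (gauss_deriv j (\<zeta> / c)) /\<^sub>R \<bar>c\<bar>))" .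
  moreover have "complex_of_real (1 / c ^ j) * (complex_of_real ((0 + c * \<tau>) ^ j * exp (- (0 + c * \<tau>)\<^sup>2)) * iexp ((0 + c * \<tau>) * (\<zeta> / c)))
      = complex_of_real (\<tau> ^ j * exp (- B * \<tau>\<^sup>2)) * iexp (\<tau> * \<zeta>)" for \<tau> :: real
  proof -
    have "1 / c ^ j * ((0 + c * \<tau>) ^ j * exp (- (0 + c * \<tau>)\<^sup>2)) = \<tau> ^ j * exp (- B * \<tau>\<^sup>2)"
      using c by (simp add: power_mult_distrib)
    moreover have "(0 + c * \<tau>) * (\<zeta> / c) = \<tau> * \<zeta>"
      using c(1) by simp
    ultimately show ?thesis by (simp only: mult.assoc[symmetric] of_real_mult[symmetric])
  qed
  moreover have "complex_of_real (1 / c ^ j) * ((- \<i>) ^ j * complex_of_real (gauss_deriv j (\<zeta> / c)) /\<^sub>R \<bar>c\<bar>)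
      = (- \<i>) ^ j * complex_of_real (gauss_deriv j (\<zeta> / sqrt B) / sqrt B ^ Suc j)"
    using c(1) by (simp add: scaleR_conv_of_real c_def[symmetric] field_simps)
  ultimately show ?thesis by simp
qed

text \<open>Rescaling by \<open>sqrt B\<close> leaves
  \<open>gauss_deriv (2 * k) (\<zeta> / sqrt B)\<close>, whose rapid decay supplies (1 +
  \<zeta>^2/B)^(-k); the surplus factor \<open>1 / sqrt B\<close> is dropped since
  \<open>B \<ge> 1\<close>. Later \<open>B\<close> carries the distance in y' and
  \<open>\<zeta>\<close> the distance in y_0, so one power of \<open>B + \<zeta>\<^sup>2\<close>
  sees all coordinates of y.\<close>

lemma gauss_moment_bound:
  "\<exists>C>0. \<forall>B \<zeta>. B \<ge> 1 \<longrightarrow>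
     norm (integral\<^sup>L lborel (\<lambda>\<tau>. complex_of_real (\<tau> ^ (2 * k) * exp (- B * \<tau>\<^sup>2)) * iexp (\<tau> * \<zeta>))) \<le> C / (B + \<zeta>\<^sup>2) ^ k"
proof -
  obtain C where C: "C > 0" "\<forall>x. (1 + \<bar>x\<bar>) ^ (2 * k) * \<bar>gauss_deriv (2 * k) x\<bar> \<le> C * exp (- (1/8) * x\<^sup>2)"
    using gauss_deriv_bound by blast
  have *: "\<bar>gauss_deriv (2 * k) x\<bar> * (1 + x\<^sup>2) ^ k \<le> C" for x
  proof -
    have "(1 + x\<^sup>2) ^ k \<le> ((1 + \<bar>x\<bar>)\<^sup>2) ^ k"
      by (intro power_mono) (auto simp: power2_eq_square algebra_simps abs_if)
    then have "(1 + x\<^sup>2) ^ k \<le> (1 + \<bar>x\<bar>) ^ (2 * k)" by (simp add: power_mult)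
    then have "\<bar>gauss_deriv (2 * k) x\<bar> * (1 + x\<^sup>2) ^ k \<le> \<bar>gauss_deriv (2 * k) x\<bar> * (1 + \<bar>x\<bar>) ^ (2 * k)"
      by (rule mult_left_mono) auto
    also have "\<dots> \<le> C * exp (- (1/8) * x\<^sup>2)" using C(2) by (simp only: mult.commute)
    also have "\<dots> \<le> C * 1" using C(1) by (intro mult_left_mono) auto
    finally show ?thesis by simp
  qed
  have "norm (integral\<^sup>L lborel (\<lambda>\<tau>. complex_of_real (\<tau> ^ (2 * k) * exp (- B * \<tau>\<^sup>2)) * iexp (\<tau> * \<zeta>))) \<le> C / (B + \<zeta>\<^sup>2) ^ k"
    if "B \<ge> 1" for B \<zeta> :: real
  proof -
    have B: "B > 0" using that by simp
    let ?g = "\<bar>gauss_deriv (2 * k) (\<zeta> / sqrt B)\<bar>"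
    have "norm (integral\<^sup>L lborel (\<lambda>\<tau>. complex_of_real (\<tau> ^ (2 * k) * exp (- B * \<tau>\<^sup>2)) * iexp (\<tau> * \<zeta>)))
        = ?g / sqrt B ^ Suc (2 * k)"
      unfolding has_bochner_integral_integral_eq[OF has_bochner_integral_gauss_moment[OF B]]
      using B unfolding norm_mult norm_power norm_minus_cancel norm_of_real by simp
    also have "\<dots> \<le> ?g / sqrt B ^ (2 * k)"
      using that by (intro divide_left_mono power_increasing) auto
    also have "\<dots> = ?g * (1 + (\<zeta> / sqrt B)\<^sup>2) ^ k / (B + \<zeta>\<^sup>2) ^ k"
    proof -
      have "B + \<zeta>\<^sup>2 = B * (1 + (\<zeta> / sqrt B)\<^sup>2)" using B by (simp add: power_divide field_simps)
      moreover have "1 + (\<zeta> / sqrt B)\<^sup>2 > 0" by (simp add: add_pos_nonneg)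
      moreover have "sqrt B ^ (2 * k) = B ^ k" using B by (simp add: power_mult)
      ultimately show ?thesis by (simp add: power_mult_distrib)
    qed
    also have "\<dots> \<le> C / (B + \<zeta>\<^sup>2) ^ k" using B by (intro divide_right_mono *) auto
    finally show ?thesis .
  qed
  then show ?thesis using C(1) by (intro exI[of _ C] conjI allI impI)
qed

text \<open>\<open>lowpass m x\<close> is \<open>gauss_deriv (2 * m + 1) x / x\<close> without the division (\<open>lowpass_times\<close>). Up to a constant
  its Fourier transform is \<open>1 + O(\<tau> ^ (2 * m + 2))\<close> at the origin, so that differentiating the dilates in the
  scale gives a kernel with many vanishing moments (\<open>DERIV_dilated_lowpass\<close>).\<close>

fun lowpass :: "nat \<Rightarrow> real \<Rightarrow> real" where
  "lowpass 0 x = - gauss_deriv 0 x / 2"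
| "lowpass (Suc m) x = - gauss_deriv (2 * Suc m) x / 2 - real (Suc m) * lowpass m x"

declare lowpass.simps [simp del]

lemma lowpass_times: "x * lowpass m x = gauss_deriv (Suc (2 * m)) x"
proof (induction m)
  case 0
  then show ?case by (simp add: gauss_deriv.simps lowpass.simps)
next
  case (Suc m)
  have "gauss_deriv (Suc (2 * Suc m)) x = - (x / 2) * gauss_deriv (2 * Suc m) x - real (Suc m) * gauss_deriv (Suc (2 * m)) x"
    by (simp add: gauss_deriv.simps(3))
  then show ?case unfolding Suc[symmetric] lowpass.simps by (simp add: algebra_simps)
qed

text \<open>The bounded derivative gives the Lipschitz estimate in t, and its existence gives the
  derivative in the scale also where \<open>lowpass_times\<close> would require division by
  0.\<close>

lemma lowpass_deriv:
  "\<exists>D K. \<forall>x. (lowpass m has_real_derivative D x) (at x) \<and> \<bar>D x\<bar> \<le> K"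
proof (induction m)
  case 0
  obtain C where C: "C > 0" "\<forall>x. \<bar>gauss_deriv 1 x\<bar> \<le> C * exp (- (1/8) * x\<^sup>2)" using gauss_deriv_le_gaussian by blast
  have "((\<lambda>x. - gauss_deriv 0 x / 2) has_real_derivative (- gauss_deriv 1 x / 2)) (at x)" for x
    by (auto intro!: derivative_eq_intros DERIV_gauss_deriv)
  moreover have "lowpass 0 = (\<lambda>x. - gauss_deriv 0 x / 2)" by (simp add: fun_eq_iff lowpass.simps)
  moreover have "\<bar>- gauss_deriv 1 x / 2\<bar> \<le> C" for x
  proof -
    have "C * exp (- (1/8) * x\<^sup>2) \<le> C * 1" using C(1) by (intro mult_left_mono) auto
    then show ?thesis using C(2)[rule_format, of x] by simp
  qed
  ultimately show ?case by (intro exI[of _ "\<lambda>x. - gauss_deriv 1 x / 2"] exI[of _ C]) simp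
next
  case (Suc m)
  obtain C where C: "C > 0" "\<forall>x. \<bar>gauss_deriv (Suc (2 * Suc m)) x\<bar> \<le> C * exp (- (1/8) * x\<^sup>2)" using gauss_deriv_le_gaussian by blast
  obtain D K where D: "\<forall>x. (lowpass m has_real_derivative D x) (at x) \<and> \<bar>D x\<bar> \<le> K" using Suc by blast
  let ?D = "\<lambda>x. - gauss_deriv (Suc (2 * Suc m)) x / 2 - real (Suc m) * D x"
  have "((\<lambda>x. - gauss_deriv (2 * Suc m) x / 2 - real (Suc m) * lowpass m x) has_real_derivative ?D x) (at x)" for x
    using D by (auto intro!: derivative_eq_intros DERIV_gauss_deriv)
  moreover have "lowpass (Suc m) = (\<lambda>x. - gauss_deriv (2 * Suc m) x / 2 - real (Suc m) * lowpass m x)"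
    by (simp add: fun_eq_iff lowpass.simps)
  moreover have "\<bar>?D x\<bar> \<le> C + real (Suc m) * K" for x
  proof -
    have "C * exp (- (1/8) * x\<^sup>2) \<le> C * 1" using C(1) by (intro mult_left_mono) auto
    then have "\<bar>- gauss_deriv (Suc (2 * Suc m)) x / 2\<bar> \<le> C" using C(2)[rule_format, of x] by simp
    moreover have "\<bar>real (Suc m) * D x\<bar> \<le> real (Suc m) * K"
      unfolding abs_mult abs_of_nat using D by (intro mult_left_mono) auto
    ultimately show ?thesis by linarith
  qed
  ultimately show ?case by (intro exI[of _ ?D] exI[of _ "C + real (Suc m) * K"]) simp
qed

lemma continuous_on_lowpass: "continuous_on A (lowpass m)"
  by (metis lowpass_deriv DERIV_isCont continuous_at_imp_continuous_on)

lemma lowpass_bound: "\<exists>C>0. \<forall>x. \<bar>lowpass m x\<bar> \<le> C * exp (- (1/8) * x\<^sup>2)"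
proof (induction m)
  case 0
  obtain C where C: "C > 0" "\<forall>x. \<bar>gauss_deriv 0 x\<bar> \<le> C * exp (- (1/8) * x\<^sup>2)" using gauss_deriv_le_gaussian by blast
  then show ?case by (intro exI[of _ "C / 2"]) (simp add: lowpass.simps)
next
  case (Suc m)
  obtain C where C: "C > 0" "\<forall>x. \<bar>gauss_deriv (2 * Suc m) x\<bar> \<le> C * exp (- (1/8) * x\<^sup>2)" using gauss_deriv_le_gaussian by blast
  obtain K where K: "K > 0" "\<forall>x. \<bar>lowpass m x\<bar> \<le> K * exp (- (1/8) * x\<^sup>2)" using Suc by blast
  have "\<bar>lowpass (Suc m) x\<bar> \<le> (C + real (Suc m) * K) * exp (- (1/8) * x\<^sup>2)" for x
  proof -
    have "\<bar>lowpass (Suc m) x\<bar> \<le> \<bar>gauss_deriv (2 * Suc m) x\<bar> + real (Suc m) * \<bar>lowpass m x\<bar>"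
      unfolding lowpass.simps by (rule order.trans[OF abs_triangle_ineq4]) (simp add: abs_mult)
    also have "\<dots> \<le> C * exp (- (1/8) * x\<^sup>2) + real (Suc m) * (K * exp (- (1/8) * x\<^sup>2))"
      using C K by (intro add_mono mult_left_mono) auto
    finally show ?thesis by (simp add: algebra_simps)
  qed
  moreover have "C + real (Suc m) * K > 0" using C(1) K(1) by (simp add: add_pos_nonneg)
  ultimately show ?case by (intro exI[of _ "C + real (Suc m) * K"]) simp
qed

lemma integrable_lowpass: "integrable lborel (lowpass m)"
proof -
  obtain C where "\<forall>x. \<bar>lowpass m x\<bar> \<le> C * exp (- (1/8) * x\<^sup>2)"
    using lowpass_bound by blast
  then show ?thesis
    by (intro integrable_gaussian_bounded[of "1/8" _ C 0] borel_measurable_continuous_onI continuous_on_lowpass) simp_all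
qed

text \<open>Gaussian derivatives of positive order integrate to 0, so each step of the recursion
  multiplies the mass by \<open>- (m + 1)\<close>. This mass is what cannot disappear in the final
  contradiction.\<close>

lemma integral_lowpass_nonzero: "integral\<^sup>L lborel (lowpass m) \<noteq> 0"
proof (induction m)
  case 0
  have "lowpass 0 = (\<lambda>x. (- 1 / 2) * gauss_deriv 0 x)" by (simp add: fun_eq_iff lowpass.simps)
  then have "integral\<^sup>L lborel (lowpass 0) = (- 1 / 2) * integral\<^sup>L lborel (gauss_deriv 0)"
    by (simp only: integral_mult_right_zero)
  then show ?case using integral_gauss_deriv_0 by simp
next
  case (Suc m)
  have "lowpass (Suc m) = (\<lambda>x. (- 1 / 2) * gauss_deriv (2 * Suc m) x - real (Suc m) * lowpass m x)"
    by (simp add: fun_eq_iff lowpass.simps)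
  then have "integral\<^sup>L lborel (lowpass (Suc m)) = (- 1 / 2) * integral\<^sup>L lborel (gauss_deriv (2 * Suc m)) - real (Suc m) * integral\<^sup>L lborel (lowpass m)"
    by (simp add: integrable_gauss_deriv integrable_lowpass)
  moreover have "integral\<^sup>L lborel (gauss_deriv (2 * Suc m)) = 0"
    using integral_gauss_deriv_Suc[of "Suc (2 * m)"] by simp
  ultimately show ?case using Suc by simp
qed

text \<open>For X \<noteq> 0 the dilate is \<open>gauss_deriv (2 * m + 1) (N * X) / X\<close>, and
  differentiating in N cancels the denominator. The identity for
  \<open>lowpass m x + x * D x\<close>, obtained from uniqueness of derivatives, also covers X =
  0.\<close>

lemma DERIV_dilated_lowpass:
  "((\<lambda>N. N * lowpass m (N * X)) has_real_derivative gauss_deriv (2 * Suc m) (N * X)) (at N)"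
proof -
  obtain D K where D: "\<forall>x. (lowpass m has_real_derivative D x) (at x) \<and> \<bar>D x\<bar> \<le> K"
    using lowpass_deriv by blast
  have D': "(lowpass m has_real_derivative D x) (at x)" for x using D by blast
  have "((\<lambda>x. x * lowpass m x) has_real_derivative lowpass m x + x * D x) (at x)" for x
    using D' by (auto intro!: derivative_eq_intros)
  moreover have "((\<lambda>x. x * lowpass m x) has_real_derivative gauss_deriv (2 * Suc m) x) (at x)" for x
    unfolding lowpass_times using DERIV_gauss_deriv[of "Suc (2 * m)" x] by simp
  ultimately have eq: "lowpass m x + x * D x = gauss_deriv (2 * Suc m) x" for x
    by (rule DERIV_unique)
  have "((\<lambda>N. N * lowpass m (N * X)) has_real_derivative lowpass m (N * X) + N * (D (N * X) * X)) (at N)"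
    by (auto intro!: derivative_eq_intros DERIV_chain2[OF D'])
  then show ?thesis using eq[of "N * X"] by (simp add: mult_ac)
qed

section \<open>Decay of bilinear oscillatory sums\<close>

text \<open>With A = \<Sum> a_p f_p and B = \<Sum> b_r g_r the left side is the modulus of the
  integral of A B, and 2 |A B| \<le> s |A|^2 + |B|^2 / s pointwise. This form of Cauchy-Schwarz is
  linear in the two energies, so it can be integrated in a further variable on which
  \<open>s\<close> depends.\<close>

lemma norm_sum_integral_le:
  fixes f :: "'p \<Rightarrow> 'x \<Rightarrow> complex" and g :: "'r \<Rightarrow> 'x \<Rightarrow> complex"
  assumes "s > 0"
    and fg: "\<And>p r. p \<in> P \<Longrightarrow> r \<in> R \<Longrightarrow> integrable M (\<lambda>x. f p x * g r x)"
    and ff: "\<And>p q. p \<in> P \<Longrightarrow> q \<in> P \<Longrightarrow> integrable M (\<lambda>x. f p x * cnj (f q x))"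
    and gg: "\<And>r r'. r \<in> R \<Longrightarrow> r' \<in> R \<Longrightarrow> integrable M (\<lambda>x. g r x * cnj (g r' x))"
  shows "norm (\<Sum>p\<in>P. \<Sum>r\<in>R. a p * b r * (\<integral>x. f p x * g r x \<partial>M))
    \<le> (s * Re (\<Sum>p\<in>P. \<Sum>q\<in>P. a p * cnj (a q) * (\<integral>x. f p x * cnj (f q x) \<partial>M))
      + Re (\<Sum>r\<in>R. \<Sum>r'\<in>R. b r * cnj (b r') * (\<integral>x. g r x * cnj (g r' x) \<partial>M)) / s) / 2"
proof -
  define A where "A x = (\<Sum>p\<in>P. a p * f p x)" for x
  define B where "B x = (\<Sum>r\<in>R. b r * g r x)" for x
  have AB: "A x * B x = (\<Sum>p\<in>P. \<Sum>r\<in>R. a p * b r * (f p x * g r x))" for x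
    by (simp add: A_def B_def sum_product mult_ac)
  have AA: "A x * cnj (A x) = (\<Sum>p\<in>P. \<Sum>q\<in>P. a p * cnj (a q) * (f p x * cnj (f q x)))" for x
    by (simp add: A_def sum_product cnj_sum mult_ac)
  have BB: "B x * cnj (B x) = (\<Sum>r\<in>R. \<Sum>r'\<in>R. b r * cnj (b r') * (g r x * cnj (g r' x)))" for x
    by (simp add: B_def sum_product cnj_sum mult_ac)
  have iAB: "integrable M (\<lambda>x. A x * B x)" unfolding AB
    by (intro Bochner_Integration.integrable_sum integrable_mult_right fg)
  have iAA: "integrable M (\<lambda>x. A x * cnj (A x))" unfolding AA
    by (intro Bochner_Integration.integrable_sum integrable_mult_right ff)
  have iBB: "integrable M (\<lambda>x. B x * cnj (B x))" unfolding BB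
    by (intro Bochner_Integration.integrable_sum integrable_mult_right gg)
  have "(\<Sum>p\<in>P. \<Sum>r\<in>R. a p * b r * (\<integral>x. f p x * g r x \<partial>M)) = (\<integral>x. A x * B x \<partial>M)"
    unfolding AB by (simp add: Bochner_Integration.integral_sum fg)
  also have "norm \<dots> \<le> (\<integral>x. norm (A x * B x) \<partial>M)" by simp
  also have "\<dots> \<le> (\<integral>x. (s * Re (A x * cnj (A x)) + Re (B x * cnj (B x)) / s) / 2 \<partial>M)"
  proof (rule integral_mono)
    fix x
    have "0 \<le> (sqrt s * norm (A x) - norm (B x) / sqrt s)\<^sup>2" by simp
    also have "\<dots> = s * (norm (A x))\<^sup>2 + (norm (B x))\<^sup>2 / s - 2 * (norm (A x) * norm (B x))"
      using \<open>s > 0\<close> by (simp add: power2_diff power_mult_distrib power_divide)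
    finally show "norm (A x * B x) \<le> (s * Re (A x * cnj (A x)) + Re (B x * cnj (B x)) / s) / 2"
      by (simp add: norm_mult complex_norm_square[symmetric])
  next
    show "integrable M (\<lambda>x. (s * Re (A x * cnj (A x)) + Re (B x * cnj (B x)) / s) / 2)"
      by (intro integrable_divide_zero Bochner_Integration.integrable_add integrable_mult_right integrable_Re iAA iBB)
  qed (rule integrable_norm[OF iAB])
  also have "\<dots> = (s * Re (\<integral>x. A x * cnj (A x) \<partial>M) + Re (\<integral>x. B x * cnj (B x) \<partial>M) / s) / 2"
    using integrable_Re[OF iAA] integrable_Re[OF iBB] integral_Re[OF iAA] integral_Re[OF iBB]
    by (simp del: times_complex.sel complex_mult_cnj)
  also have "(\<integral>x. A x * cnj (A x) \<partial>M) = (\<Sum>p\<in>P. \<Sum>q\<in>P. a p * cnj (a q) * (\<integral>x. f p x * cnj (f q x) \<partial>M))"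
    unfolding AA by (simp add: Bochner_Integration.integral_sum ff)
  also have "(\<integral>x. B x * cnj (B x) \<partial>M) = (\<Sum>r\<in>R. \<Sum>r'\<in>R. b r * cnj (b r') * (\<integral>x. g r x * cnj (g r' x) \<partial>M))"
    unfolding BB by (simp add: Bochner_Integration.integral_sum gg)
  finally show ?thesis .
qed

lemma
  fixes h :: "'i \<Rightarrow> real \<Rightarrow> complex"
  assumes "finite J" "\<And>i. i \<in> J \<Longrightarrow> has_bochner_integral lborel (h i) (v i)"
  shows integrable_PiM_lborel_prod: "integrable (PiM J (\<lambda>_. lborel)) (\<lambda>x. \<Prod>i\<in>J. h i (x i))"
    and integral_PiM_lborel_prod: "(\<integral>x. (\<Prod>i\<in>J. h i (x i)) \<partial>PiM J (\<lambda>_. lborel)) = (\<Prod>i\<in>J. v i)"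
proof -
  interpret product_sigma_finite "\<lambda>_::'i. lborel :: real measure" by standard
  have int: "integrable lborel (h i)" if "i \<in> J" for i
    using assms(2)[OF that] by (simp add: has_bochner_integral_iff)
  show "integrable (PiM J (\<lambda>_. lborel)) (\<lambda>x. \<Prod>i\<in>J. h i (x i))"
    by (rule product_integrable_prod[OF assms(1) int])
  have "(\<integral>x. (\<Prod>i\<in>J. h i (x i)) \<partial>PiM J (\<lambda>_. lborel)) = (\<Prod>i\<in>J. integral\<^sup>L lborel (h i))"
    by (rule product_integral_prod[OF assms(1) int])
  also have "\<dots> = (\<Prod>i\<in>J. v i)"
    using assms(2) by (intro prod.cong refl) (simp add: has_bochner_integral_iff)
  finally show "(\<integral>x. (\<Prod>i\<in>J. h i (x i)) \<partial>PiM J (\<lambda>_. lborel)) = (\<Prod>i\<in>J. v i)" .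
qed

text \<open>Each factor \<open>iexp (y * w)\<close> is an integral over \<open>\<eta>\<close> of \<open>iexp (\<eta> * w)\<close> against a Gaussian centred at \<open>y\<close>;
  the Gaussian weight of width \<open>\<delta>\<close> is moved between the two factors before Cauchy-Schwarz. The free
  parameter \<open>s\<close> replaces the square root of the product of the two energies.\<close>

lemma bilinear_phase_bound:
  fixes w :: "'p \<Rightarrow> 'i \<Rightarrow> real" and y :: "'r \<Rightarrow> 'i \<Rightarrow> real" and \<alpha> :: "'p \<Rightarrow> complex" and \<beta> :: "'r \<Rightarrow> complex"
  assumes "finite J" "0 < \<delta>" "\<delta> < 1" "s > 0"
  shows "norm (\<Sum>p\<in>P. \<Sum>r\<in>R. \<alpha> p * \<beta> r * (\<Prod>i\<in>J. iexp (y r i * w p i)))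
    \<le> (s * Re (\<Sum>p\<in>P. \<Sum>q\<in>P. \<alpha> p * cnj (\<alpha> q) * complex_of_real (\<Prod>i\<in>J.
            exp (((w p i)\<^sup>2 + (w q i)\<^sup>2) / 2) / (2 * pi) * (sqrt (pi / \<delta>) * exp (- ((w p i - w q i)\<^sup>2 / (4 * \<delta>))))))
      + Re (\<Sum>r\<in>R. \<Sum>r'\<in>R. \<beta> r * cnj (\<beta> r') * complex_of_real (\<Prod>i\<in>J.
            sqrt (pi / (1 - \<delta>)) * exp ((y r i + y r' i)\<^sup>2 / (4 * (1 - \<delta>)) - ((y r i)\<^sup>2 + (y r' i)\<^sup>2) / 2))) / s) / 2"
proof -
  \<comment> \<open>A unit Gaussian average centred at y damps the phase by exp(-w^2/2), which the
    prefactor undoes. The factors in \<delta> cancel in \<open>f * g\<close>;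
    \<open>\<delta> > 0\<close> makes \<open>f\<close> square integrable and
    \<open>\<delta> < 1\<close> keeps \<open>g\<close> square integrable.\<close>
  define f where "f p i \<eta> = complex_of_real (exp ((w p i)\<^sup>2 / 2) / sqrt (2 * pi) * exp (- (\<delta> / 2) * \<eta>\<^sup>2)) * iexp (\<eta> * w p i)" for p i \<eta>
  define g where "g r i \<eta> = complex_of_real (exp (- (\<eta> - y r i)\<^sup>2 / 2 + \<delta> / 2 * \<eta>\<^sup>2))" for r i \<eta>
  have fg: "has_bochner_integral lborel (\<lambda>\<eta>. f p i \<eta> * g r i \<eta>) (iexp (y r i * w p i))" for p r i
  proof -
    let ?W = "w p i" and ?Y = "y r i"
    let ?c = "complex_of_real (exp (?W\<^sup>2 / 2) / sqrt (2 * pi) * exp (- ?Y\<^sup>2 / 2))"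
    have 1: "f p i \<eta> * g r i \<eta> = ?c * (complex_of_real (exp (- (1/2) * \<eta>\<^sup>2 + ?Y * \<eta>)) * iexp (\<eta> * ?W))" for \<eta>
    proof -
      have "- (\<delta> / 2) * \<eta>\<^sup>2 + (- (\<eta> - ?Y)\<^sup>2 / 2 + \<delta> / 2 * \<eta>\<^sup>2) = - ?Y\<^sup>2 / 2 + (- (1/2) * \<eta>\<^sup>2 + ?Y * \<eta>)"
        by (simp add: power2_eq_square field_simps)
      then have "exp (- (\<delta> / 2) * \<eta>\<^sup>2) * exp (- (\<eta> - ?Y)\<^sup>2 / 2 + \<delta> / 2 * \<eta>\<^sup>2) = exp (- ?Y\<^sup>2 / 2) * exp (- (1/2) * \<eta>\<^sup>2 + ?Y * \<eta>)"
        by (simp only: exp_add[symmetric])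
      then have "exp (?W\<^sup>2 / 2) / sqrt (2 * pi) * (exp (- (\<delta> / 2) * \<eta>\<^sup>2) * exp (- (\<eta> - ?Y)\<^sup>2 / 2 + \<delta> / 2 * \<eta>\<^sup>2))
          = exp (?W\<^sup>2 / 2) / sqrt (2 * pi) * (exp (- ?Y\<^sup>2 / 2) * exp (- (1/2) * \<eta>\<^sup>2 + ?Y * \<eta>))" by (rule arg_cong)
      then have "complex_of_real (exp (?W\<^sup>2 / 2) / sqrt (2 * pi) * exp (- (\<delta> / 2) * \<eta>\<^sup>2)) * complex_of_real (exp (- (\<eta> - ?Y)\<^sup>2 / 2 + \<delta> / 2 * \<eta>\<^sup>2))
          = ?c * complex_of_real (exp (- (1/2) * \<eta>\<^sup>2 + ?Y * \<eta>))"
        unfolding of_real_mult[symmetric] of_real_eq_iff by (simp only: mult.assoc)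
      then show ?thesis unfolding f_def g_def by (simp only: mult_ac)
    qed
    have 2: "?c * (complex_of_real (sqrt (pi / (1/2)) * exp ((?Y\<^sup>2 - ?W\<^sup>2) / (4 * (1/2)))) * iexp (?Y * ?W / (2 * (1/2)))) = iexp (?Y * ?W)"
    proof -
      have "exp (?W\<^sup>2 / 2) * exp (- ?Y\<^sup>2 / 2) * exp ((?Y\<^sup>2 - ?W\<^sup>2) / (4 * (1/2))) = 1"
        by (simp flip: exp_add) (simp add: field_simps)
      then have "exp (?W\<^sup>2 / 2) / sqrt (2 * pi) * exp (- ?Y\<^sup>2 / 2) * (sqrt (pi / (1/2)) * exp ((?Y\<^sup>2 - ?W\<^sup>2) / (4 * (1/2)))) = 1"
        by (simp add: mult_ac)
      then have "?c * complex_of_real (sqrt (pi / (1/2)) * exp ((?Y\<^sup>2 - ?W\<^sup>2) / (4 * (1/2)))) = 1"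
        by (simp only: of_real_mult[symmetric] of_real_1)
      then show ?thesis by (simp only: mult.assoc[symmetric]) simp
    qed
    show ?thesis unfolding 1
      using has_bochner_integral_mult_right[OF has_bochner_integral_gaussian_exp[of "1/2" ?Y ?W], of ?c]
      unfolding 2 by simp
  qed
  have ff: "has_bochner_integral lborel (\<lambda>\<eta>. f p i \<eta> * cnj (f q i \<eta>)) (complex_of_real
      (exp (((w p i)\<^sup>2 + (w q i)\<^sup>2) / 2) / (2 * pi) * (sqrt (pi / \<delta>) * exp (- ((w p i - w q i)\<^sup>2 / (4 * \<delta>))))))" for p q i
  proof -
    let ?W = "w p i" and ?V = "w q i"
    let ?c = "complex_of_real (exp ((?W\<^sup>2 + ?V\<^sup>2) / 2) / (2 * pi))"
    have 1: "f p i \<eta> * cnj (f q i \<eta>) = ?c * (complex_of_real (exp (- \<delta> * \<eta>\<^sup>2)) * iexp (\<eta> * (?W - ?V)))" for \<eta>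
    proof -
      have "- (\<delta> / 2) * \<eta>\<^sup>2 + - (\<delta> / 2) * \<eta>\<^sup>2 = - \<delta> * \<eta>\<^sup>2" by simp
      then have "exp (- (\<delta> / 2) * \<eta>\<^sup>2) * exp (- (\<delta> / 2) * \<eta>\<^sup>2) = exp (- \<delta> * \<eta>\<^sup>2)"
        by (simp only: exp_add[symmetric])
      moreover have "exp (?W\<^sup>2 / 2) * exp (?V\<^sup>2 / 2) = exp ((?W\<^sup>2 + ?V\<^sup>2) / 2)"
        by (simp only: exp_add[symmetric] add_divide_distrib)
      moreover have "sqrt (2 * pi) * sqrt (2 * pi) = 2 * pi" by simp
      moreover have "a / d * e * (b / d * e) = a * b / (d * d) * (e * e)" for a b d e :: real by simp
      ultimately have 3: "(exp (?W\<^sup>2 / 2) / sqrt (2 * pi) * exp (- (\<delta> / 2) * \<eta>\<^sup>2)) * (exp (?V\<^sup>2 / 2) / sqrt (2 * pi) * exp (- (\<delta> / 2) * \<eta>\<^sup>2))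
          = exp ((?W\<^sup>2 + ?V\<^sup>2) / 2) / (2 * pi) * exp (- \<delta> * \<eta>\<^sup>2)"
        by (simp only:)
      have 4: "iexp (\<eta> * ?W) * cnj (iexp (\<eta> * ?V)) = iexp (\<eta> * (?W - ?V))"
        by (simp add: exp_cnj algebra_simps flip: exp_add)
      have alg: "A * x * (B * z) = A * B * (x * z)" for A B x z :: complex by simp
      have "f p i \<eta> * cnj (f q i \<eta>) = (complex_of_real (exp (?W\<^sup>2 / 2) / sqrt (2 * pi) * exp (- (\<delta> / 2) * \<eta>\<^sup>2))
            * complex_of_real (exp (?V\<^sup>2 / 2) / sqrt (2 * pi) * exp (- (\<delta> / 2) * \<eta>\<^sup>2))) * (iexp (\<eta> * ?W) * cnj (iexp (\<eta> * ?V)))"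
        unfolding f_def complex_cnj_mult complex_cnj_complex_of_real by (rule alg)
      also have "\<dots> = complex_of_real (exp ((?W\<^sup>2 + ?V\<^sup>2) / 2) / (2 * pi) * exp (- \<delta> * \<eta>\<^sup>2)) * iexp (\<eta> * (?W - ?V))"
        unfolding 4 3[symmetric] of_real_mult[of "exp (?W\<^sup>2 / 2) / sqrt (2 * pi) * exp (- (\<delta> / 2) * \<eta>\<^sup>2)"] ..
      finally show ?thesis by (simp only: of_real_mult mult.assoc)
    qed
    show ?thesis unfolding 1
      using has_bochner_integral_mult_right[OF has_bochner_integral_gaussian_char[of \<delta> "?W - ?V"], of ?c] assms(2)
      by (simp add: mult.assoc)
  qed
  have gg: "has_bochner_integral lborel (\<lambda>\<eta>. g r i \<eta> * cnj (g r' i \<eta>)) (complex_of_real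
      (sqrt (pi / (1 - \<delta>)) * exp ((y r i + y r' i)\<^sup>2 / (4 * (1 - \<delta>)) - ((y r i)\<^sup>2 + (y r' i)\<^sup>2) / 2)))" for r r' i
  proof -
    let ?Y = "y r i" and ?Z = "y r' i"
    let ?c = "complex_of_real (exp (- ((?Y\<^sup>2 + ?Z\<^sup>2) / 2)))"
    have 1: "g r i \<eta> * cnj (g r' i \<eta>) = ?c * (complex_of_real (exp (- (1 - \<delta>) * \<eta>\<^sup>2 + (?Y + ?Z) * \<eta>)) * iexp (\<eta> * 0))" for \<eta>
    proof -
      have "(- (\<eta> - ?Y)\<^sup>2 / 2 + \<delta> / 2 * \<eta>\<^sup>2) + (- (\<eta> - ?Z)\<^sup>2 / 2 + \<delta> / 2 * \<eta>\<^sup>2) = - ((?Y\<^sup>2 + ?Z\<^sup>2) / 2) + (- (1 - \<delta>) * \<eta>\<^sup>2 + (?Y + ?Z) * \<eta>)"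
        by (simp add: power2_eq_square field_simps)
      then show ?thesis unfolding g_def complex_cnj_complex_of_real by (simp flip: exp_add of_real_mult)
    qed
    have 2: "?c * (complex_of_real (sqrt (pi / (1 - \<delta>)) * exp (((?Y + ?Z)\<^sup>2 - 0\<^sup>2) / (4 * (1 - \<delta>)))) * iexp ((?Y + ?Z) * 0 / (2 * (1 - \<delta>))))
        = complex_of_real (sqrt (pi / (1 - \<delta>)) * exp ((?Y + ?Z)\<^sup>2 / (4 * (1 - \<delta>)) - (?Y\<^sup>2 + ?Z\<^sup>2) / 2))"
    proof -
      have "exp (- A) * (S * exp B) = S * exp (B - A)" for A B S :: real
        by (simp add: exp_diff exp_minus field_simps)
      then show ?thesis
        by (simp only: mult_zero_right div_0 of_real_0 exp_zero mult_1_right of_real_mult[symmetric] zero_power2 diff_0_right)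
    qed
    show ?thesis unfolding 1
      using has_bochner_integral_mult_right[OF has_bochner_integral_gaussian_exp[of "1 - \<delta>" "?Y + ?Z" 0], of ?c] assms(3)
      unfolding 2 by simp
  qed
  let ?M = "PiM J (\<lambda>_. lborel) :: ('i \<Rightarrow> real) measure"
  let ?F = "\<lambda>p x. \<Prod>i\<in>J. f p i (x i)" and ?G = "\<lambda>r x. \<Prod>i\<in>J. g r i (x i)"
  have FG: "?F p x * ?G r x = (\<Prod>i\<in>J. f p i (x i) * g r i (x i))" for p r x by (simp add: prod.distrib)
  have FF: "?F p x * cnj (?F q x) = (\<Prod>i\<in>J. f p i (x i) * cnj (f q i (x i)))" for p q x by (simp add: prod.distrib)
  have GG: "?G r x * cnj (?G r' x) = (\<Prod>i\<in>J. g r i (x i) * cnj (g r' i (x i)))" for r r' x by (simp add: prod.distrib)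
  have "norm (\<Sum>p\<in>P. \<Sum>r\<in>R. \<alpha> p * \<beta> r * (\<integral>x. ?F p x * ?G r x \<partial>?M))
    \<le> (s * Re (\<Sum>p\<in>P. \<Sum>q\<in>P. \<alpha> p * cnj (\<alpha> q) * (\<integral>x. ?F p x * cnj (?F q x) \<partial>?M))
      + Re (\<Sum>r\<in>R. \<Sum>r'\<in>R. \<beta> r * cnj (\<beta> r') * (\<integral>x. ?G r x * cnj (?G r' x) \<partial>?M)) / s) / 2"
    unfolding FG FF GG
    by (intro norm_sum_integral_le[where f = ?F and g = ?G, unfolded FG FF GG] assms(4) integrable_PiM_lborel_prod[OF assms(1)])
       (rule fg ff gg)+
  then show ?thesis unfolding FG FF GG
    integral_PiM_lborel_prod[OF assms(1) fg] integral_PiM_lborel_prod[OF assms(1) ff] integral_PiM_lborel_prod[OF assms(1) gg]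
    by (simp only: of_real_prod)
qed

abbreviation sqdist :: "'i set \<Rightarrow> ('i \<Rightarrow> real) \<Rightarrow> ('i \<Rightarrow> real) \<Rightarrow> real" where
  "sqdist I x y \<equiv> \<Sum>i\<in>I. (x i - y i)\<^sup>2"

text \<open>The phase bound is applied at each frequency \<open>\<tau>\<close> with a parameter depending on \<open>\<tau>\<close>, chosen so that the
  integral over \<open>\<tau>\<close> produces a Gaussian in \<open>u\<close> on one side and all the decay from \<open>\<tau> ^ (4 * m)\<close> on the other.\<close>

lemma bilinear_decay:
  fixes w :: "'p \<Rightarrow> 'i \<Rightarrow> real" and y :: "'r \<Rightarrow> 'i \<Rightarrow> real" and u a :: "'p \<Rightarrow> real" and z b :: "'r \<Rightarrow> real"
  assumes J: "finite J" and \<epsilon>: "0 < \<epsilon>" "\<epsilon> \<le> 1 / 2" "\<epsilon> * (1 + 2 * real (card J) * K\<^sup>2) \<le> 1"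
    and N: "N \<ge> 1" and s: "s > 0"
    and Cm: "\<forall>B \<zeta>. B \<ge> 1 \<longrightarrow> norm (integral\<^sup>L lborel (\<lambda>\<tau>. complex_of_real (\<tau> ^ (2 * (2 * m)) * exp (- B * \<tau>\<^sup>2)) * iexp (\<tau> * \<zeta>)))
          \<le> Cm / (B + \<zeta>\<^sup>2) ^ (2 * m)"
    and a: "\<And>p. p \<in> P \<Longrightarrow> a p \<ge> 0" and b: "\<And>r. r \<in> R \<Longrightarrow> b r \<ge> 0"
    and w: "\<And>p i. p \<in> P \<Longrightarrow> i \<in> J \<Longrightarrow> \<bar>w p i\<bar> \<le> K"
    and y: "\<And>r i. r \<in> R \<Longrightarrow> i \<in> J \<Longrightarrow> \<bar>y r i\<bar> \<le> K"
  shows "\<bar>\<Sum>p\<in>P. \<Sum>r\<in>R. a p * b r * gauss_deriv (2 * m) (N * (t * u p + (\<Sum>i\<in>J. w p i * y r i) + z r))\<bar>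
    \<le> (s * (sqrt (pi / \<epsilon>) * (exp (K\<^sup>2) * (sqrt (pi / \<epsilon>) * N)) ^ card J *
          (\<Sum>p\<in>P. \<Sum>q\<in>P. a p * a q * exp (- (N\<^sup>2 / (4 * \<epsilon>) * (t\<^sup>2 * (u p - u q)\<^sup>2 + sqdist J (w p) (w q))))))
      + sqrt (2 * pi) ^ card J * Cm *
          (\<Sum>r\<in>R. \<Sum>r'\<in>R. b r * b r' / (1 + N\<^sup>2 * ((z r - z r')\<^sup>2 + sqdist J (y r) (y r') / 4)) ^ (2 * m)) / s) / 2"
proof -
  \<comment> \<open>At scale N this makes the w-kernel exp(-N^2 (w - w')^2 / (4 \<epsilon>)), while
    the y-kernel loses at most exp(2 \<epsilon> K^2 \<tau>^2) per coordinate. The hypothesis on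
    \<epsilon> lets the Gaussian in \<tau> absorb that loss.\<close>
  define \<delta> where "\<delta> = \<epsilon> / N\<^sup>2"
  have N2: "N\<^sup>2 \<ge> 1" using N by (rule one_le_power)
  then have N20: "N\<^sup>2 > 0" by linarith
  have \<delta>: "0 < \<delta>" "\<delta> \<le> 1 / 2"
  proof -
    show "0 < \<delta>" using \<epsilon>(1) N20 by (simp add: \<delta>_def)
    have "\<delta> \<le> \<epsilon> / 1" unfolding \<delta>_def using \<epsilon>(1) N2 by (intro divide_left_mono) auto
    then show "\<delta> \<le> 1 / 2" using \<epsilon>(2) by simp
  qed
  define X where "X p r = N * (t * u p + (\<Sum>i\<in>J. w p i * y r i) + z r)" for p r
  define KA where "KA p q = (\<Prod>i\<in>J. exp (((w p i)\<^sup>2 + (w q i)\<^sup>2) / 2) / (2 * pi) * (sqrt (pi / \<delta>) * exp (- ((w p i - w q i)\<^sup>2 / (4 * \<delta>)))))" for p q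
  define \<beta> where "\<beta> r r' = N\<^sup>2 * (\<Sum>i\<in>J. ((y r i)\<^sup>2 + (y r' i)\<^sup>2) / 2 - (y r i + y r' i)\<^sup>2 / (4 * (1 - \<delta>)))" for r r'
  define D where "D = sqrt (pi / (1 - \<delta>))"
  define \<omega> where "\<omega> p q = N * t * (u p - u q)" for p q
  define \<nu> where "\<nu> r r' = N * (z r - z r')" for r r'
  define gA where "gA p q \<tau> = complex_of_real (exp (- \<epsilon> * \<tau>\<^sup>2)) * iexp (\<tau> * \<omega> p q)" for p q \<tau>
  define gB where "gB r r' \<tau> = complex_of_real (\<tau> ^ (2 * (2 * m)) * exp (- (2 - \<epsilon> + \<beta> r r') * \<tau>\<^sup>2)) * iexp (\<tau> * \<nu> r r')" for r r' \<tau>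
  define f where "f \<tau> = (\<Sum>p\<in>P. \<Sum>r\<in>R. complex_of_real (a p * b r) * (complex_of_real (\<tau> ^ (2 * m) * exp (- \<tau>\<^sup>2)) * iexp (\<tau> * X p r)))" for \<tau>
  define g where "g \<tau> = (s * Re (\<Sum>p\<in>P. \<Sum>q\<in>P. complex_of_real (a p * a q * KA p q) * gA p q \<tau>)
     + Re (\<Sum>r\<in>R. \<Sum>r'\<in>R. complex_of_real (b r * b r' * D ^ card J) * gB r r' \<tau>) / s) / 2" for \<tau>

  \<comment> \<open>Write 1/(1 - \<delta>) = 1 + \<delta>/(1 - \<delta>). The 1 yields the squared
    difference over 4; the rest is at most 2 \<delta> K^2 per coordinate, which N^2 turns into 2
    \<epsilon> K^2.\<close>
  have \<beta>: "2 - \<epsilon> + \<beta> r r' \<ge> 1 + N\<^sup>2 * (sqdist J (y r) (y r') / 4)" if "r \<in> R" "r' \<in> R" for r r'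
  proof -
    have "N\<^sup>2 * (((y r i)\<^sup>2 + (y r' i)\<^sup>2) / 2 - (y r i + y r' i)\<^sup>2 / (4 * (1 - \<delta>))) \<ge> N\<^sup>2 * ((y r i - y r' i)\<^sup>2 / 4) - 2 * \<epsilon> * K\<^sup>2"
      if "i \<in> J" for i
    proof -
      let ?Y = "y r i" and ?Z = "y r' i"
      have "(?Y + ?Z)\<^sup>2 / (4 * (1 - \<delta>)) = (?Y + ?Z)\<^sup>2 / 4 + (?Y + ?Z)\<^sup>2 / 4 * (\<delta> / (1 - \<delta>))"
        using \<delta> by (simp add: field_simps)
      moreover have "(?Y\<^sup>2 + ?Z\<^sup>2) / 2 - (?Y + ?Z)\<^sup>2 / 4 = (?Y - ?Z)\<^sup>2 / 4"
        by (simp add: power2_eq_square field_simps)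
      ultimately have eq: "(?Y\<^sup>2 + ?Z\<^sup>2) / 2 - (?Y + ?Z)\<^sup>2 / (4 * (1 - \<delta>)) = (?Y - ?Z)\<^sup>2 / 4 - (?Y + ?Z)\<^sup>2 / 4 * (\<delta> / (1 - \<delta>))"
        by linarith
      have "\<bar>?Y + ?Z\<bar> \<le> 2 * K" using y[OF \<open>r \<in> R\<close> \<open>i \<in> J\<close>] y[OF \<open>r' \<in> R\<close> \<open>i \<in> J\<close>] by linarith
      then have 1: "(?Y + ?Z)\<^sup>2 / 4 \<le> K\<^sup>2"
        using power_mono[of "\<bar>?Y + ?Z\<bar>" "2 * K" 2] by (simp add: power_mult_distrib)
      have "\<delta> / (1 - \<delta>) \<le> \<delta> / (1 / 2)" using \<delta> by (intro divide_left_mono) auto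
      then have 2: "\<delta> / (1 - \<delta>) \<le> 2 * \<delta>" by simp
      have "(?Y + ?Z)\<^sup>2 / 4 * (\<delta> / (1 - \<delta>)) \<le> K\<^sup>2 * (2 * \<delta>)"
        using \<delta> by (intro mult_mono 1 2) auto
      then have "N\<^sup>2 * ((?Y + ?Z)\<^sup>2 / 4 * (\<delta> / (1 - \<delta>))) \<le> N\<^sup>2 * (K\<^sup>2 * (2 * \<delta>))"
        by (rule mult_left_mono) simp
      also have "\<dots> = 2 * \<epsilon> * K\<^sup>2" using N20 by (simp add: \<delta>_def)
      finally show ?thesis unfolding eq by (simp add: right_diff_distrib)
    qed
    then have "(\<Sum>i\<in>J. N\<^sup>2 * ((y r i - y r' i)\<^sup>2 / 4) - 2 * \<epsilon> * K\<^sup>2) \<le> \<beta> r r'"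
      unfolding \<beta>_def sum_distrib_left by (intro sum_mono)
    moreover have "(\<Sum>i\<in>J. N\<^sup>2 * ((y r i - y r' i)\<^sup>2 / 4) - 2 * \<epsilon> * K\<^sup>2) = N\<^sup>2 * (sqdist J (y r) (y r') / 4) - real (card J) * (2 * \<epsilon> * K\<^sup>2)"
      by (simp add: sum_subtractf sum_distrib_left sum_divide_distrib)
    moreover have "\<epsilon> + real (card J) * (2 * \<epsilon> * K\<^sup>2) \<le> 1" using \<epsilon>(3) by (simp add: algebra_simps)
    ultimately show ?thesis by linarith
  qed
  have B0: "2 - \<epsilon> + \<beta> r r' \<ge> 1" if "r \<in> R" "r' \<in> R" for r r'
  proof -
    have "N\<^sup>2 * (sqdist J (y r) (y r') / 4) \<ge> 0" by (intro mult_nonneg_nonneg divide_nonneg_nonneg sum_nonneg) auto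
    then show ?thesis using \<beta>[OF that] by linarith
  qed

  have int_f: "has_bochner_integral lborel f
      (\<Sum>p\<in>P. \<Sum>r\<in>R. complex_of_real (a p * b r) * ((- \<i>) ^ (2 * m) * complex_of_real (gauss_deriv (2 * m) (X p r))))"
    unfolding f_def
    by (intro has_bochner_integral_sum has_bochner_integral_mult_right)
       (simp only: has_bochner_integral_iff integral_gauss_moment integrable_gauss_moment simp_thms)
  have int_A: "has_bochner_integral lborel (gA p q) (complex_of_real (sqrt (pi / \<epsilon>) * exp (- ((\<omega> p q)\<^sup>2 / (4 * \<epsilon>)))))" for p q
    unfolding gA_def by (rule has_bochner_integral_gaussian_char[OF \<epsilon>(1)])
  have int_B: "has_bochner_integral lborel (gB r r') (integral\<^sup>L lborel (gB r r'))" if "r \<in> R" "r' \<in> R" for r r'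
  proof -
    have "2 - \<epsilon> + \<beta> r r' > 0" using B0[OF that] by linarith
    from has_bochner_integral_gauss_moment[OF this] show ?thesis
      unfolding gB_def has_bochner_integral_iff by blast
  qed
  have int_g: "has_bochner_integral lborel g
     ((s * Re (\<Sum>p\<in>P. \<Sum>q\<in>P. complex_of_real (a p * a q * KA p q) * complex_of_real (sqrt (pi / \<epsilon>) * exp (- ((\<omega> p q)\<^sup>2 / (4 * \<epsilon>)))))
     + Re (\<Sum>r\<in>R. \<Sum>r'\<in>R. complex_of_real (b r * b r' * D ^ card J) * integral\<^sup>L lborel (gB r r')) / s) / 2)"
    unfolding g_def
    by (intro has_bochner_integral_divide_zero has_bochner_integral_add has_bochner_integral_mult_right
        has_bochner_integral_bounded_linear[OF bounded_linear_Re] has_bochner_integral_sum int_A int_B)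

  \<comment> \<open>The value 0 is left out because the parameter \<open>S\<close> divides by a
    power of \<tau>; one point does not affect the integral.\<close>
  have le: "norm (f \<tau>) \<le> g \<tau>" if "\<tau> \<noteq> 0" for \<tau>
  proof -
    let ?SA = "\<Sum>p\<in>P. \<Sum>q\<in>P. complex_of_real (a p * a q * KA p q) * iexp (\<tau> * \<omega> p q)"
    let ?SB = "\<Sum>r\<in>R. \<Sum>r'\<in>R. complex_of_real (b r * b r' * (D ^ card J * exp (- \<beta> r r' * \<tau>\<^sup>2))) * iexp (\<tau> * \<nu> r r')"
    define c where "c = \<tau> ^ (2 * m) * exp (- \<tau>\<^sup>2)"
    \<comment> \<open>Solves \<open>c * S = s * exp (- \<epsilon> * \<tau>\<^sup>2)\<close>: a
      Gaussian just wide enough to give a Gaussian in u stays on the x-side, and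
      \<open>c / S\<close> keeps \<tau>^(4m) and almost all of exp(-2 \<tau>^2).\<close>
    define S where "S = s * exp ((1 - \<epsilon>) * \<tau>\<^sup>2) / \<tau> ^ (2 * m)"
    have \<tau>m: "\<tau> ^ (2 * m) > 0" using that by (simp add: zero_less_power_eq)
    have S: "S > 0" using s \<tau>m by (simp add: S_def)
    have c0: "c > 0" using \<tau>m by (simp add: c_def)
    have cS: "c * S = s * exp (- \<epsilon> * \<tau>\<^sup>2)"
    proof -
      have "exp (- \<tau>\<^sup>2) * exp ((1 - \<epsilon>) * \<tau>\<^sup>2) = exp (- \<epsilon> * \<tau>\<^sup>2)"
        by (simp add: algebra_simps flip: exp_add)
      moreover have "x * e * (s * e' / x) = s * (e * e')" if "x > 0" for x e e' :: real using that by simp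
      ultimately show ?thesis using \<tau>m unfolding c_def S_def by (simp only:)
    qed
    have cS': "c / S = \<tau> ^ (2 * (2 * m)) * exp (- (2 - \<epsilon>) * \<tau>\<^sup>2) / s"
    proof -
      have "exp (- \<tau>\<^sup>2) / exp ((1 - \<epsilon>) * \<tau>\<^sup>2) = exp (- (2 - \<epsilon>) * \<tau>\<^sup>2)"
        by (simp add: algebra_simps flip: exp_diff)
      moreover have "\<tau> ^ (2 * (2 * m)) = \<tau> ^ (2 * m) * \<tau> ^ (2 * m)" by (simp flip: power_add)
      moreover have "x * e / (s * e' / x) = x * x * (e / e') / s" for x e e' :: real by (simp add: mult_ac)
      ultimately show ?thesis unfolding c_def S_def by (simp only:)
    qed
    define \<alpha> where "\<alpha> p = complex_of_real (a p) * iexp (\<tau> * (N * t * u p))" for p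
    define \<gamma> where "\<gamma> r = complex_of_real (b r) * iexp (\<tau> * (N * z r))" for r
    have f: "f \<tau> = complex_of_real c * (\<Sum>p\<in>P. \<Sum>r\<in>R. \<alpha> p * \<gamma> r * (\<Prod>i\<in>J. iexp (\<tau> * N * y r i * w p i)))"
    proof -
      have "iexp (\<tau> * X p r) = iexp (\<tau> * (N * t * u p)) * iexp (\<tau> * (N * z r)) * (\<Prod>i\<in>J. iexp (\<tau> * N * y r i * w p i))" for p r
        unfolding X_def exp_sum[OF J, symmetric]
        by (simp add: algebra_simps sum_distrib_left flip: exp_add)
      then show ?thesis unfolding f_def \<alpha>_def \<gamma>_def c_def by (simp add: sum_distrib_left mult_ac)
    qed
    have A: "\<alpha> p * cnj (\<alpha> q) * complex_of_real k = complex_of_real (a p * a q * k) * iexp (\<tau> * \<omega> p q)" for p q k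
    proof -
      have "iexp (\<tau> * (N * t * u p)) * cnj (iexp (\<tau> * (N * t * u q))) = iexp (\<tau> * \<omega> p q)"
        by (simp add: exp_cnj \<omega>_def algebra_simps flip: exp_add)
      moreover have "\<alpha> p * cnj (\<alpha> q) * complex_of_real k = complex_of_real (a p * a q * k) * (iexp (\<tau> * (N * t * u p)) * cnj (iexp (\<tau> * (N * t * u q))))"
        by (simp add: \<alpha>_def mult_ac)
      ultimately show ?thesis by simp
    qed
    have G: "\<gamma> r * cnj (\<gamma> r') * complex_of_real k = complex_of_real (b r * b r' * k) * iexp (\<tau> * \<nu> r r')" for r r' k
    proof -
      have "iexp (\<tau> * (N * z r)) * cnj (iexp (\<tau> * (N * z r'))) = iexp (\<tau> * \<nu> r r')"
        by (simp add: exp_cnj \<nu>_def algebra_simps flip: exp_add)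
      moreover have "\<gamma> r * cnj (\<gamma> r') * complex_of_real k = complex_of_real (b r * b r' * k) * (iexp (\<tau> * (N * z r)) * cnj (iexp (\<tau> * (N * z r'))))"
        by (simp add: \<gamma>_def mult_ac)
      ultimately show ?thesis by simp
    qed
    have KB: "(\<Prod>i\<in>J. sqrt (pi / (1 - \<delta>)) * exp ((\<tau> * N * y r i + \<tau> * N * y r' i)\<^sup>2 / (4 * (1 - \<delta>)) - ((\<tau> * N * y r i)\<^sup>2 + (\<tau> * N * y r' i)\<^sup>2) / 2))
        = D ^ card J * exp (- \<beta> r r' * \<tau>\<^sup>2)" for r r'
    proof -
      have "(\<tau> * N * y r i + \<tau> * N * y r' i)\<^sup>2 / (4 * (1 - \<delta>)) - ((\<tau> * N * y r i)\<^sup>2 + (\<tau> * N * y r' i)\<^sup>2) / 2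
          = - (N\<^sup>2 * \<tau>\<^sup>2) * (((y r i)\<^sup>2 + (y r' i)\<^sup>2) / 2 - (y r i + y r' i)\<^sup>2 / (4 * (1 - \<delta>)))" for i
      proof -
        have "(\<tau> * N * y r i + \<tau> * N * y r' i)\<^sup>2 = (N\<^sup>2 * \<tau>\<^sup>2) * (y r i + y r' i)\<^sup>2"
          by (simp add: power2_eq_square algebra_simps)
        moreover have "(\<tau> * N * y r i)\<^sup>2 + (\<tau> * N * y r' i)\<^sup>2 = (N\<^sup>2 * \<tau>\<^sup>2) * ((y r i)\<^sup>2 + (y r' i)\<^sup>2)"
          by (simp add: power_mult_distrib algebra_simps)
        moreover have "k * A / c - k * B / 2 = - k * (B / 2 - A / c)" for k A B c :: real
          by (simp add: right_diff_distrib)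
        ultimately show ?thesis by (simp only:)
      qed
      note eq = this
      show ?thesis
        unfolding eq prod.distrib exp_sum[OF J, symmetric] sum_distrib_left[symmetric] prod_constant D_def \<beta>_def
        by (simp only: mult_minus_left mult_minus_right mult_ac)
    qed
    have "norm (f \<tau>) = c * norm (\<Sum>p\<in>P. \<Sum>r\<in>R. \<alpha> p * \<gamma> r * (\<Prod>i\<in>J. iexp (\<tau> * N * y r i * w p i)))"
      unfolding f norm_mult norm_of_real using c0 by simp
    also have "\<dots> \<le> c * ((S * Re (\<Sum>p\<in>P. \<Sum>q\<in>P. \<alpha> p * cnj (\<alpha> q) * complex_of_real (KA p q))
      + Re (\<Sum>r\<in>R. \<Sum>r'\<in>R. \<gamma> r * cnj (\<gamma> r') * complex_of_real (D ^ card J * exp (- \<beta> r r' * \<tau>\<^sup>2))) / S) / 2)"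
      using bilinear_phase_bound[OF J \<delta>(1) _ S, where w = w and y = "\<lambda>r i. \<tau> * N * y r i" and \<alpha> = \<alpha> and \<beta> = \<gamma> and P = P and R = R] \<delta>(2) c0
      unfolding KB KA_def[symmetric] by (intro mult_left_mono) auto
    also have "\<dots> = (c * S * Re ?SA
      + c / S * Re ?SB) / 2"
      unfolding A G by (simp add: field_simps)
    also have "\<dots> = g \<tau>"
    proof -
      have "c * S * Re ?SA
          = s * Re (complex_of_real (exp (- \<epsilon> * \<tau>\<^sup>2)) * ?SA)"
        unfolding cS Re_complex_of_real[symmetric] by simp
      also have "complex_of_real (exp (- \<epsilon> * \<tau>\<^sup>2)) * ?SA
          = (\<Sum>p\<in>P. \<Sum>q\<in>P. complex_of_real (a p * a q * KA p q) * gA p q \<tau>)"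
        unfolding sum_distrib_left gA_def by (intro sum.cong refl) (simp only: mult_ac)
      finally have 1: "c * S * Re ?SA
          = s * Re (\<Sum>p\<in>P. \<Sum>q\<in>P. complex_of_real (a p * a q * KA p q) * gA p q \<tau>)" .
      define v where "v = \<tau> ^ (2 * (2 * m)) * exp (- (2 - \<epsilon>) * \<tau>\<^sup>2)"
      have "c / S * Re ?SB
          = Re (complex_of_real v * ?SB) / s"
        unfolding cS' v_def[symmetric] by simp
      also have "complex_of_real v * ?SB
          = (\<Sum>r\<in>R. \<Sum>r'\<in>R. complex_of_real (b r * b r' * D ^ card J) * gB r r' \<tau>)"
        unfolding sum_distrib_left
      proof (intro sum.cong refl)
        fix r r'
        have eq: "exp (- (2 - \<epsilon>) * \<tau>\<^sup>2) * exp (- \<beta> r r' * \<tau>\<^sup>2) = exp (- (2 - \<epsilon> + \<beta> r r') * \<tau>\<^sup>2)"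
          by (simp add: algebra_simps flip: exp_add)
        have "v * (b r * b r' * (D ^ card J * exp (- \<beta> r r' * \<tau>\<^sup>2))) = b r * b r' * D ^ card J * (\<tau> ^ (2 * (2 * m)) * exp (- (2 - \<epsilon> + \<beta> r r') * \<tau>\<^sup>2))"
        proof -
          have alg: "(x * e) * (k * (d * e')) = k * d * (x * (e * e'))" for x e k d e' :: real by simp
          show ?thesis unfolding v_def alg eq ..
        qed
        then show "complex_of_real v * (complex_of_real (b r * b r' * (D ^ card J * exp (- \<beta> r r' * \<tau>\<^sup>2))) * iexp (\<tau> * \<nu> r r'))
            = complex_of_real (b r * b r' * D ^ card J) * gB r r' \<tau>"
          unfolding gB_def mult.assoc[symmetric] of_real_mult[symmetric] by (simp only: mult.assoc)
      qed
      finally show ?thesis unfolding g_def 1 by simp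
    qed
    finally show ?thesis .
  qed

  have Re_mult: "Re (complex_of_real x * z) = x * Re z" for x z by simp
  have "\<bar>\<Sum>p\<in>P. \<Sum>r\<in>R. a p * b r * gauss_deriv (2 * m) (X p r)\<bar> = norm (integral\<^sup>L lborel f)"
  proof -
    have "integral\<^sup>L lborel f = (- \<i>) ^ (2 * m) * complex_of_real (\<Sum>p\<in>P. \<Sum>r\<in>R. a p * b r * gauss_deriv (2 * m) (X p r))"
      unfolding has_bochner_integral_integral_eq[OF int_f] of_real_sum sum_distrib_left
      by (intro sum.cong refl) (simp only: of_real_mult mult_ac)
    then show ?thesis by (simp only: norm_mult norm_power norm_minus_cancel norm_ii power_one norm_of_real mult_1_left)
  qed
  also have "\<dots> \<le> (\<integral>\<tau>. norm (f \<tau>) \<partial>lborel)" by simp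
  also have "\<dots> \<le> integral\<^sup>L lborel g"
  proof (rule integral_mono_AE)
    show "integrable lborel (\<lambda>\<tau>. norm (f \<tau>))" "integrable lborel g"
      using int_f int_g by (auto simp: has_bochner_integral_iff)
    have "AE \<tau> in lborel. \<tau> \<noteq> (0::real)" by (rule AE_lborel_singleton)
    then show "AE \<tau> in lborel. norm (f \<tau>) \<le> g \<tau>" by eventually_elim (rule le)
  qed
  also have "integral\<^sup>L lborel g = (s * (\<Sum>p\<in>P. \<Sum>q\<in>P. a p * a q * (KA p q * (sqrt (pi / \<epsilon>) * exp (- ((\<omega> p q)\<^sup>2 / (4 * \<epsilon>))))))
     + (\<Sum>r\<in>R. \<Sum>r'\<in>R. b r * b r' * (D ^ card J * Re (integral\<^sup>L lborel (gB r r')))) / s) / 2"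
    unfolding has_bochner_integral_integral_eq[OF int_g]
    by (simp only: Re_sum Re_mult Re_complex_of_real mult.assoc)
  also have "\<dots> \<le> (s * (\<Sum>p\<in>P. \<Sum>q\<in>P. a p * a q * (sqrt (pi / \<epsilon>) * (exp (K\<^sup>2) * (sqrt (pi / \<epsilon>) * N)) ^ card J *
          exp (- (N\<^sup>2 / (4 * \<epsilon>) * (t\<^sup>2 * (u p - u q)\<^sup>2 + sqdist J (w p) (w q))))))
      + (\<Sum>r\<in>R. \<Sum>r'\<in>R. b r * b r' * (sqrt (2 * pi) ^ card J *
          (Cm / (1 + N\<^sup>2 * ((z r - z r')\<^sup>2 + sqdist J (y r) (y r') / 4)) ^ (2 * m)))) / s) / 2"
  proof (intro divide_right_mono add_mono mult_left_mono sum_mono)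
    fix p q assume pq: "p \<in> P" "q \<in> P"
    have "KA p q \<le> (\<Prod>i\<in>J. exp (K\<^sup>2) * (sqrt (pi / \<epsilon>) * N) * exp (- (N\<^sup>2 / (4 * \<epsilon>) * (w p i - w q i)\<^sup>2)))"
      unfolding KA_def
    proof (intro prod_mono conjI)
      fix i assume i: "i \<in> J"
      have sq: "sqrt (pi / \<delta>) = sqrt (pi / \<epsilon>) * N"
        using N by (simp add: \<delta>_def real_sqrt_mult real_sqrt_divide)
      have "(w p i)\<^sup>2 \<le> K\<^sup>2" "(w q i)\<^sup>2 \<le> K\<^sup>2"
        using power_mono[OF w[OF pq(1) i], of 2] power_mono[OF w[OF pq(2) i], of 2] by simp_all
      then have "exp (((w p i)\<^sup>2 + (w q i)\<^sup>2) / 2) \<le> exp (K\<^sup>2)" by simp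
      moreover have "exp (((w p i)\<^sup>2 + (w q i)\<^sup>2) / 2) / (2 * pi) \<le> exp (((w p i)\<^sup>2 + (w q i)\<^sup>2) / 2) / 1"
        using pi_ge_two by (intro divide_left_mono) auto
      ultimately have "exp (((w p i)\<^sup>2 + (w q i)\<^sup>2) / 2) / (2 * pi) \<le> exp (K\<^sup>2)" by linarith
      then have "exp (((w p i)\<^sup>2 + (w q i)\<^sup>2) / 2) / (2 * pi) * (sqrt (pi / \<delta>) * exp (- ((w p i - w q i)\<^sup>2 / (4 * \<delta>))))
          \<le> exp (K\<^sup>2) * (sqrt (pi / \<delta>) * exp (- ((w p i - w q i)\<^sup>2 / (4 * \<delta>))))"
        using \<delta>(1) by (intro mult_right_mono) auto
      also have "\<dots> = exp (K\<^sup>2) * (sqrt (pi / \<epsilon>) * N) * exp (- (N\<^sup>2 / (4 * \<epsilon>) * (w p i - w q i)\<^sup>2))"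
        unfolding sq by (simp add: \<delta>_def mult_ac)
      finally show "exp (((w p i)\<^sup>2 + (w q i)\<^sup>2) / 2) / (2 * pi) * (sqrt (pi / \<delta>) * exp (- ((w p i - w q i)\<^sup>2 / (4 * \<delta>)))) \<le> \<dots>" .
    qed (use \<delta>(1) in auto)
    also have "\<dots> = (exp (K\<^sup>2) * (sqrt (pi / \<epsilon>) * N)) ^ card J * exp (- (N\<^sup>2 / (4 * \<epsilon>) * sqdist J (w p) (w q)))"
      by (simp add: prod.distrib exp_sum[OF J, symmetric] sum_negf sum_distrib_left)
    finally have "KA p q * (sqrt (pi / \<epsilon>) * exp (- ((\<omega> p q)\<^sup>2 / (4 * \<epsilon>))))
        \<le> (exp (K\<^sup>2) * (sqrt (pi / \<epsilon>) * N)) ^ card J * exp (- (N\<^sup>2 / (4 * \<epsilon>) * sqdist J (w p) (w q))) * (sqrt (pi / \<epsilon>) * exp (- ((\<omega> p q)\<^sup>2 / (4 * \<epsilon>))))"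
      using \<epsilon>(1) by (intro mult_right_mono) auto
    also have "\<dots> = sqrt (pi / \<epsilon>) * (exp (K\<^sup>2) * (sqrt (pi / \<epsilon>) * N)) ^ card J * (exp (- (N\<^sup>2 / (4 * \<epsilon>) * sqdist J (w p) (w q))) * exp (- ((\<omega> p q)\<^sup>2 / (4 * \<epsilon>))))"
      by (simp only: mult_ac)
    also have "exp (- (N\<^sup>2 / (4 * \<epsilon>) * sqdist J (w p) (w q))) * exp (- ((\<omega> p q)\<^sup>2 / (4 * \<epsilon>)))
        = exp (- (N\<^sup>2 / (4 * \<epsilon>) * (t\<^sup>2 * (u p - u q)\<^sup>2 + sqdist J (w p) (w q))))"
    proof -
      have "(\<omega> p q)\<^sup>2 / (4 * \<epsilon>) = N\<^sup>2 / (4 * \<epsilon>) * (t\<^sup>2 * (u p - u q)\<^sup>2)"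
        by (simp add: \<omega>_def power_mult_distrib)
      then show ?thesis by (simp only: exp_add[symmetric] distrib_left minus_add_distrib add.commute)
    qed
    finally show "KA p q * (sqrt (pi / \<epsilon>) * exp (- ((\<omega> p q)\<^sup>2 / (4 * \<epsilon>)))) \<le> sqrt (pi / \<epsilon>) * (exp (K\<^sup>2) * (sqrt (pi / \<epsilon>) * N)) ^ card J *
          exp (- (N\<^sup>2 / (4 * \<epsilon>) * (t\<^sup>2 * (u p - u q)\<^sup>2 + sqdist J (w p) (w q))))" .
  next
    fix r r' assume rr: "r \<in> R" "r' \<in> R"
    let ?B = "2 - \<epsilon> + \<beta> r r'" and ?E = "1 + N\<^sup>2 * ((z r - z r')\<^sup>2 + sqdist J (y r) (y r') / 4)"
    have E: "?E \<ge> 1" by (intro add_increasing2 mult_nonneg_nonneg add_nonneg_nonneg divide_nonneg_nonneg sum_nonneg) auto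
    have "?E \<le> ?B + (\<nu> r r')\<^sup>2" using \<beta>[OF rr] unfolding \<nu>_def power_mult_distrib distrib_left by linarith
    moreover have "0 \<le> Cm"
      using order.trans[OF norm_ge_zero Cm[rule_format, of 1 0]] by simp
    ultimately have "Cm / (?B + (\<nu> r r')\<^sup>2) ^ (2 * m) \<le> Cm / ?E ^ (2 * m)"
      using E by (intro divide_left_mono power_mono mult_pos_pos zero_less_power) linarith+
    moreover have "norm (integral\<^sup>L lborel (gB r r')) \<le> Cm / (?B + (\<nu> r r')\<^sup>2) ^ (2 * m)"
      unfolding gB_def by (rule Cm[rule_format]) (rule B0[OF rr])
    ultimately have le: "norm (integral\<^sup>L lborel (gB r r')) \<le> Cm / ?E ^ (2 * m)" by linarith
    have "D ^ card J * Re (integral\<^sup>L lborel (gB r r')) \<le> D ^ card J * norm (integral\<^sup>L lborel (gB r r'))"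
      using \<delta>(2) complex_Re_le_cmod by (intro mult_left_mono) (auto simp: D_def)
    also have "\<dots> \<le> sqrt (2 * pi) ^ card J * (Cm / ?E ^ (2 * m))"
    proof (intro mult_mono le power_mono)
      have "pi / (1 - \<delta>) \<le> pi / (1 / 2)" using \<delta>(2) by (intro divide_left_mono) auto
      then show "D \<le> sqrt (2 * pi)" unfolding D_def by simp
      show "0 \<le> D" using \<delta>(2) by (simp add: D_def)
    qed auto
    finally show "D ^ card J * Re (integral\<^sup>L lborel (gB r r')) \<le> sqrt (2 * pi) ^ card J * (Cm / ?E ^ (2 * m))" .
  qed (use s a b in auto)
  finally show ?thesis unfolding X_def sum_distrib_left
    by (simp only: mult_ac times_divide_eq_left times_divide_eq_right)
qed

section \<open>The projective chart\<close>

text \<open>The inverse chart is Lipschitz where the distinguished coordinate is bounded above and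
  away from 0: x_0 - x_0' = -x_0 x_0' (u - u') and x_i - x_i' = (w_i - w_i') x_0 + w_i' (x_0 -
  x_0'). The difference in u carries the factor \<open>c0\<close> because in the application it
  occurs multiplied by t with \<bar>t\<bar> \<ge> c0.\<close>

lemma chart_lipschitz:
  fixes x x' :: "'i \<Rightarrow> real"
  assumes J: "finite J" and c: "0 < c" "0 < c0"
    and x0: "c \<le> \<bar>x0\<bar>" "\<bar>x0\<bar> \<le> K" "c \<le> \<bar>x0'\<bar>" "\<bar>x0'\<bar> \<le> K"
    and x: "\<And>i. i \<in> J \<Longrightarrow> \<bar>x i\<bar> \<le> K" "\<And>i. i \<in> J \<Longrightarrow> \<bar>x' i\<bar> \<le> K"
  shows "(x0 - x0')\<^sup>2 + sqdist J x x'
    \<le> (K ^ 4 * (1 + 2 * real (card J) * (K / c)\<^sup>2) / c0\<^sup>2 + 2 * K\<^sup>2)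
       * (c0\<^sup>2 * (1 / x0 - 1 / x0')\<^sup>2 + (\<Sum>i\<in>J. (x i / x0 - x' i / x0')\<^sup>2))"
proof -
  define D where "D = 1 / x0 - 1 / x0'"
  define w w' where "w i = x i / x0" and "w' i = x' i / x0'" for i
  have nz: "x0 \<noteq> 0" "x0' \<noteq> 0" and K: "K > 0" using c x0 by auto
  have diff: "x0 - x0' = - (x0 * x0' * D)" using nz by (simp add: D_def field_simps)
  have "\<bar>x0 * x0'\<bar> \<le> K * K" unfolding abs_mult using x0 K by (intro mult_mono) auto
  then have "(x0 * x0')\<^sup>2 \<le> (K * K)\<^sup>2" using power_mono[of "\<bar>x0 * x0'\<bar>" "K * K" 2] by simp
  then have "(x0 * x0')\<^sup>2 * D\<^sup>2 \<le> (K * K)\<^sup>2 * D\<^sup>2" by (rule mult_right_mono) simp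
  then have 0: "(x0 - x0')\<^sup>2 \<le> K ^ 4 * D\<^sup>2"
    unfolding diff by (simp add: power_mult_distrib flip: power_add)
  have 1: "(x i - x' i)\<^sup>2 \<le> 2 * K\<^sup>2 * (w i - w' i)\<^sup>2 + 2 * (K / c)\<^sup>2 * (K ^ 4 * D\<^sup>2)" if i: "i \<in> J" for i
  proof -
    have eq: "x i - x' i = (w i - w' i) * x0 + w' i * (x0 - x0')" using nz by (simp add: w_def w'_def field_simps)
    have sq: "(\<alpha> + \<beta>)\<^sup>2 \<le> 2 * \<alpha>\<^sup>2 + 2 * \<beta>\<^sup>2" for \<alpha> \<beta> :: real
      using sum_squares_ge_zero[of "\<alpha> - \<beta>" 0] by (simp add: power2_eq_square algebra_simps)
    have "x0\<^sup>2 \<le> K\<^sup>2" using power_mono[of "\<bar>x0\<bar>" K 2] x0 by simp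
    then have a: "((w i - w' i) * x0)\<^sup>2 \<le> K\<^sup>2 * (w i - w' i)\<^sup>2"
      unfolding power_mult_distrib by (subst mult.commute) (rule mult_right_mono, auto)
    have "\<bar>w' i\<bar> \<le> K / c" unfolding w'_def abs_divide using x(2)[OF i] x0 c K by (intro frac_le) auto
    then have "(w' i)\<^sup>2 \<le> (K / c)\<^sup>2" using power_mono[of "\<bar>w' i\<bar>" "K / c" 2] by simp
    then have b: "(w' i * (x0 - x0'))\<^sup>2 \<le> (K / c)\<^sup>2 * (K ^ 4 * D\<^sup>2)"
      unfolding power_mult_distrib by (intro mult_mono 0) auto
    show ?thesis unfolding eq using sq[of "(w i - w' i) * x0" "w' i * (x0 - x0')"] a b by linarith
  qed
  have "sqdist J x x' \<le> (\<Sum>i\<in>J. 2 * K\<^sup>2 * (w i - w' i)\<^sup>2 + 2 * (K / c)\<^sup>2 * (K ^ 4 * D\<^sup>2))"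
    by (intro sum_mono 1)
  also have "\<dots> = 2 * K\<^sup>2 * sqdist J w w' + real (card J) * (2 * (K / c)\<^sup>2 * (K ^ 4 * D\<^sup>2))"
    by (simp add: sum.distrib sum_distrib_left)
  finally have 2: "(x0 - x0')\<^sup>2 + sqdist J x x'
      \<le> K ^ 4 * (1 + 2 * real (card J) * (K / c)\<^sup>2) * D\<^sup>2 + 2 * K\<^sup>2 * sqdist J w w'"
    using 0 by (simp add: algebra_simps)
  define \<Sigma> where "\<Sigma> = sqdist J w w'"
  define Q where "Q = K ^ 4 * (1 + 2 * real (card J) * (K / c)\<^sup>2)"
  have nonneg: "\<Sigma> \<ge> 0" "Q \<ge> 0" by (auto simp: \<Sigma>_def Q_def sum_nonneg)
  have "Q * D\<^sup>2 = Q / c0\<^sup>2 * (c0\<^sup>2 * D\<^sup>2)" using c by simp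
  moreover have "0 \<le> Q / c0\<^sup>2 * \<Sigma>" "0 \<le> 2 * K\<^sup>2 * (c0\<^sup>2 * D\<^sup>2)" using nonneg by auto
  ultimately have "Q * D\<^sup>2 + 2 * K\<^sup>2 * \<Sigma> \<le> (Q / c0\<^sup>2 + 2 * K\<^sup>2) * (c0\<^sup>2 * D\<^sup>2 + \<Sigma>)"
    by (simp only: distrib_left distrib_right)
  with 2 show ?thesis unfolding Q_def \<Sigma>_def D_def w_def w'_def by linarith
qed

text \<open>Brings \<open>bilinear_decay\<close> back from the chart to the original coordinates.
  The constants come before the point sets, weights, t, N and \<open>\<sigma>\<close>, so they are
  uniform in the discretisation; \<open>\<sigma>\<close> stays free to balance the two energies
  later.\<close>

lemma chart_decay:
  fixes I :: "'i set" and m :: nat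
  assumes I: "finite I" "i0 \<in> I" and c: "0 < c" "0 < c0" and K: "0 < K"
  shows "\<exists>C \<gamma>. 0 < C \<and> 0 < \<gamma> \<and> (\<forall>(P :: 'p set) (R :: 'r set) a b x y t N \<sigma>.
     1 \<le> N \<longrightarrow> 0 < \<sigma> \<longrightarrow> c0 \<le> \<bar>t\<bar> \<longrightarrow>
     (\<forall>p\<in>P. 0 \<le> a p \<and> c \<le> \<bar>x p i0\<bar> \<and> (\<forall>i\<in>I. \<bar>x p i\<bar> \<le> K)) \<longrightarrow>
     (\<forall>r\<in>R. 0 \<le> b r \<and> (\<forall>i\<in>I. \<bar>y r i\<bar> \<le> K)) \<longrightarrow>
     \<bar>\<Sum>p\<in>P. \<Sum>r\<in>R. a p * b r * gauss_deriv (2 * m) (N * (1 / x p i0 * (t - (\<Sum>i\<in>I. x p i * y r i))))\<bar>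
     \<le> C * (\<sigma> * N ^ (card I - 1) * (\<Sum>p\<in>P. \<Sum>q\<in>P. a p * a q * exp (- \<gamma> * (N\<^sup>2 * sqdist I (x p) (x q))))
       + 1 / \<sigma> * (\<Sum>r\<in>R. \<Sum>r'\<in>R. b r * b r' * (1 / (1 + N\<^sup>2 * sqdist I (y r) (y r') / 4) ^ (2 * m)))))"
proof -
  define J where "J = I - {i0}"
  have J: "finite J" "card J = card I - 1" "I = insert i0 J" "i0 \<notin> J" using I by (auto simp: J_def)
  \<comment> \<open>One bound for both sides: the quotients w are at most K / c, the coordinates of
    y at most K.\<close>
  define K' where "K' = K / c + K"
  have K': "K' \<ge> K" "K' \<ge> K / c" "K' > 0" using K c by (auto simp: K'_def add_pos_pos)
  \<comment> \<open>Half of what the constraint of \<open>bilinear_decay\<close> permits; as the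
    bracket is at least 1, this also gives \<epsilon> \<le> 1/2.\<close>
  define \<epsilon> where "\<epsilon> = 1 / (2 * (1 + 2 * real (card J) * K'\<^sup>2))"
  have e1: "1 + 2 * real (card J) * K'\<^sup>2 \<ge> 1" by simp
  have \<epsilon>: "0 < \<epsilon>" "\<epsilon> \<le> 1 / 2" "\<epsilon> * (1 + 2 * real (card J) * K'\<^sup>2) \<le> 1"
  proof -
    show "0 < \<epsilon>" unfolding \<epsilon>_def using e1 by (intro divide_pos_pos mult_pos_pos) linarith+
    have "\<epsilon> \<le> 1 / (2 * 1)" unfolding \<epsilon>_def using e1 by (intro divide_left_mono mult_left_mono mult_pos_pos) linarith+
    then show "\<epsilon> \<le> 1 / 2" by simp
    have "\<epsilon> * (1 + 2 * real (card J) * K'\<^sup>2) = 1 / 2" 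
    proof -
      have "1 / (2 * X) * X = 1 / 2" if "X \<ge> 1" for X :: real using that by simp
      then show ?thesis unfolding \<epsilon>_def using e1 by blast
    qed
    then show "\<epsilon> * (1 + 2 * real (card J) * K'\<^sup>2) \<le> 1" by simp
  qed
  obtain Cm where Cm: "Cm > 0" "\<forall>B \<zeta>. B \<ge> 1 \<longrightarrow> norm (integral\<^sup>L lborel (\<lambda>\<tau>. complex_of_real (\<tau> ^ (2 * (2 * m)) * exp (- B * \<tau>\<^sup>2)) * iexp (\<tau> * \<zeta>)))
          \<le> Cm / (B + \<zeta>\<^sup>2) ^ (2 * m)"
    using gauss_moment_bound[of "2 * m"] by blast
  define L where "L = K ^ 4 * (1 + 2 * real (card J) * (K / c)\<^sup>2) / c0\<^sup>2 + 2 * K\<^sup>2"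
  have L: "L > 0" unfolding L_def using K by (intro add_nonneg_pos) auto
  \<comment> \<open>The Gaussian rate 1/(4 \<epsilon>) in the chart, divided by the Lipschitz
    constant \<open>L\<close> of the inverse chart.\<close>
  define \<gamma> where "\<gamma> = 1 / (4 * \<epsilon> * L)"
  have \<gamma>: "\<gamma> > 0" using \<epsilon> L by (simp add: \<gamma>_def)
  define C1 where "C1 = sqrt (pi / \<epsilon>) * (exp (K'\<^sup>2) * sqrt (pi / \<epsilon>)) ^ card J"
  define C2 where "C2 = sqrt (2 * pi) ^ card J * Cm"
  have C12: "C1 > 0" "C2 > 0" using \<epsilon>(1) Cm(1) by (simp_all add: C1_def C2_def)
  have main: "\<bar>\<Sum>p\<in>P. \<Sum>r\<in>R. a p * b r * gauss_deriv (2 * m) (N * (1 / x p i0 * (t - (\<Sum>i\<in>I. x p i * y r i))))\<bar>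
     \<le> (C1 + C2) * (\<sigma> * N ^ (card I - 1) * (\<Sum>p\<in>P. \<Sum>q\<in>P. a p * a q * exp (- \<gamma> * (N\<^sup>2 * sqdist I (x p) (x q))))
       + 1 / \<sigma> * (\<Sum>r\<in>R. \<Sum>r'\<in>R. b r * b r' * (1 / (1 + N\<^sup>2 * sqdist I (y r) (y r') / 4) ^ (2 * m))))"
    if N: "1 \<le> N" and \<sigma>: "0 < \<sigma>" and t: "c0 \<le> \<bar>t\<bar>"
      and a: "\<forall>p\<in>P. 0 \<le> a p \<and> c \<le> \<bar>x p i0\<bar> \<and> (\<forall>i\<in>I. \<bar>x p i\<bar> \<le> K)"
      and b: "\<forall>r\<in>R. 0 \<le> b r \<and> (\<forall>i\<in>I. \<bar>y r i\<bar> \<le> K)"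
    for P :: "'p set" and R :: "'r set" and a b x y t N \<sigma>
  proof -
    define u where "u p = 1 / x p i0" for p
    define w where "w p i = x p i / x p i0" for p i
    have nz: "x p i0 \<noteq> 0" if "p \<in> P" for p using a that c(1) by fastforce
    have arg: "N * (1 / x p i0 * (t - (\<Sum>i\<in>I. x p i * y r i))) = N * (t * u p + (\<Sum>i\<in>J. w p i * (- y r i)) + (- y r i0))" if "p \<in> P" for p r
    proof -
      have "(\<Sum>i\<in>J. w p i * (- y r i)) = - (1 / x p i0) * (\<Sum>i\<in>J. x p i * y r i)"
        unfolding sum_distrib_left by (intro sum.cong refl) (simp add: w_def)
      moreover have "1 / x p i0 * (x p i0 * y r i0) = y r i0" using nz[OF that] by simp
      ultimately show ?thesis unfolding J(3) sum.insert[OF J(1,4)]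
        by (simp add: u_def right_diff_distrib distrib_left)
    qed
    have wb: "\<bar>w p i\<bar> \<le> K'" if "p \<in> P" "i \<in> J" for p i
    proof -
      have "\<bar>x p i\<bar> / \<bar>x p i0\<bar> \<le> K / c" using a that J(3) c K by (intro frac_le) auto
      then show ?thesis using K' by (simp add: w_def)
    qed
    have yb: "\<bar>- y r i\<bar> \<le> K'" if "r \<in> R" "i \<in> J" for r i
    proof -
      have "\<bar>y r i\<bar> \<le> K" using b that J(3) by blast
      then show ?thesis using K' by simp
    qed
    have "\<bar>\<Sum>p\<in>P. \<Sum>r\<in>R. a p * b r * gauss_deriv (2 * m) (N * (1 / x p i0 * (t - (\<Sum>i\<in>I. x p i * y r i))))\<bar>
      = \<bar>\<Sum>p\<in>P. \<Sum>r\<in>R. a p * b r * gauss_deriv (2 * m) (N * (t * u p + (\<Sum>i\<in>J. w p i * (- y r i)) + (- y r i0)))\<bar>"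
      by (intro arg_cong[of _ _ abs] sum.cong refl) (simp only: arg)
    also have "\<dots> \<le> (\<sigma> * (sqrt (pi / \<epsilon>) * (exp (K'\<^sup>2) * (sqrt (pi / \<epsilon>) * N)) ^ card J *
          (\<Sum>p\<in>P. \<Sum>q\<in>P. a p * a q * exp (- (N\<^sup>2 / (4 * \<epsilon>) * (t\<^sup>2 * (u p - u q)\<^sup>2 + sqdist J (w p) (w q))))))
      + sqrt (2 * pi) ^ card J * Cm *
          (\<Sum>r\<in>R. \<Sum>r'\<in>R. b r * b r' / (1 + N\<^sup>2 * ((- y r i0 - - y r' i0)\<^sup>2 + (\<Sum>i\<in>J. (- y r i - - y r' i)\<^sup>2) / 4)) ^ (2 * m)) / \<sigma>) / 2"
      (is "_ \<le> (\<sigma> * (?c1 * ?A) + ?c2 * ?B / \<sigma>) / 2")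
      using a b by (intro bilinear_decay[OF J(1) \<epsilon> N \<sigma> Cm(2)] wb yb) auto
    also have "\<dots> \<le> \<sigma> * (?c1 * ?A) + ?c2 * ?B / \<sigma>"
    proof -
      have "?A \<ge> 0" "?B \<ge> 0"
        using a b by (auto intro!: sum_nonneg mult_nonneg_nonneg divide_nonneg_nonneg zero_le_even_power')
      then have "\<sigma> * (?c1 * ?A) + ?c2 * ?B / \<sigma> \<ge> 0"
        using \<sigma> \<epsilon>(1) N Cm(1) by (intro add_nonneg_nonneg mult_nonneg_nonneg divide_nonneg_nonneg) auto
      moreover have "x / 2 \<le> x" if "x \<ge> 0" for x :: real using that by simp
      ultimately show ?thesis by blast
    qed
    also have "?c1 = C1 * N ^ (card I - 1)"
      unfolding C1_def J(2)[symmetric] by (simp add: power_mult_distrib)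
    also have "\<sigma> * (C1 * N ^ (card I - 1) * ?A) + ?c2 * ?B / \<sigma>
      \<le> \<sigma> * (C1 * N ^ (card I - 1) * (\<Sum>p\<in>P. \<Sum>q\<in>P. a p * a q * exp (- \<gamma> * (N\<^sup>2 * sqdist I (x p) (x q)))))
       + C2 * (\<Sum>r\<in>R. \<Sum>r'\<in>R. b r * b r' * (1 / (1 + N\<^sup>2 * sqdist I (y r) (y r') / 4) ^ (2 * m))) / \<sigma>"
      unfolding C2_def
    proof (intro add_mono mult_left_mono divide_right_mono sum_mono)
      fix p q assume pq: "p \<in> P" "q \<in> P"
      have "(x p i0 - x q i0)\<^sup>2 + sqdist J (x p) (x q)
        \<le> L * (c0\<^sup>2 * (1 / x p i0 - 1 / x q i0)\<^sup>2 + (\<Sum>i\<in>J. (x p i / x p i0 - x q i / x q i0)\<^sup>2))"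
        unfolding L_def using a pq I(2) J(3) by (intro chart_lipschitz[OF J(1) c]) auto
      also have "\<dots> \<le> L * (t\<^sup>2 * (u p - u q)\<^sup>2 + sqdist J (w p) (w q))"
      proof -
        have "c0\<^sup>2 \<le> t\<^sup>2" using power_mono[of c0 "\<bar>t\<bar>" 2] t c(2) by simp
        then show ?thesis unfolding u_def w_def using L by (intro mult_left_mono add_right_mono mult_right_mono) auto
      qed
      finally have "sqdist I (x p) (x q) \<le> L * (t\<^sup>2 * (u p - u q)\<^sup>2 + sqdist J (w p) (w q))"
        unfolding J(3) sum.insert[OF J(1,4)] .
      then have "N\<^sup>2 / (4 * \<epsilon> * L) * sqdist I (x p) (x q) \<le> N\<^sup>2 / (4 * \<epsilon> * L) * (L * (t\<^sup>2 * (u p - u q)\<^sup>2 + sqdist J (w p) (w q)))"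
        using \<epsilon>(1) L by (intro mult_left_mono) auto
      also have "\<dots> = N\<^sup>2 / (4 * \<epsilon>) * (t\<^sup>2 * (u p - u q)\<^sup>2 + sqdist J (w p) (w q))" using L by simp
      finally have "\<gamma> * (N\<^sup>2 * sqdist I (x p) (x q)) \<le> N\<^sup>2 / (4 * \<epsilon>) * (t\<^sup>2 * (u p - u q)\<^sup>2 + sqdist J (w p) (w q))"
        by (simp add: \<gamma>_def)
      then show "exp (- (N\<^sup>2 / (4 * \<epsilon>) * (t\<^sup>2 * (u p - u q)\<^sup>2 + sqdist J (w p) (w q)))) \<le> exp (- \<gamma> * (N\<^sup>2 * sqdist I (x p) (x q)))"
        by simp
    next
      fix r r' assume rr: "r \<in> R" "r' \<in> R"
      \<comment> \<open>The shift coordinate y_0 enters with weight 1 and the others with weight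
        1/4; lowering the first to 1/4 gives the full squared distance.\<close>
      have le: "1 + N\<^sup>2 * sqdist I (y r) (y r') / 4 \<le> 1 + N\<^sup>2 * ((- y r i0 - - y r' i0)\<^sup>2 + (\<Sum>i\<in>J. (- y r i - - y r' i)\<^sup>2) / 4)"
      proof -
        have "(y r i0 - y r' i0)\<^sup>2 / 4 \<le> (- y r i0 - - y r' i0)\<^sup>2" by (simp add: power2_commute)
        moreover have "(- y r i - - y r' i)\<^sup>2 = (y r i - y r' i)\<^sup>2" for i by (simp add: power2_commute)
        ultimately have "sqdist I (y r) (y r') / 4 \<le> (- y r i0 - - y r' i0)\<^sup>2 + (\<Sum>i\<in>J. (- y r i - - y r' i)\<^sup>2) / 4"
          unfolding J(3) sum.insert[OF J(1,4)] by (simp add: add_divide_distrib)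
        then have "N\<^sup>2 * (sqdist I (y r) (y r') / 4) \<le> N\<^sup>2 * ((- y r i0 - - y r' i0)\<^sup>2 + (\<Sum>i\<in>J. (- y r i - - y r' i)\<^sup>2) / 4)"
          by (rule mult_left_mono) simp
        then show ?thesis by simp
      qed
      have pos: "0 < 1 + N\<^sup>2 * sqdist I (y r) (y r') / 4"
        by (intro add_pos_nonneg divide_nonneg_nonneg mult_nonneg_nonneg sum_nonneg) auto
      have "b r * b r' / (1 + N\<^sup>2 * ((- y r i0 - - y r' i0)\<^sup>2 + (\<Sum>i\<in>J. (- y r i - - y r' i)\<^sup>2) / 4)) ^ (2 * m)
        \<le> b r * b r' / (1 + N\<^sup>2 * sqdist I (y r) (y r') / 4) ^ (2 * m)"
        using b rr pos le by (intro divide_left_mono power_mono mult_pos_pos zero_less_power) (auto intro: less_le_trans)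
      then show "b r * b r' / (1 + N\<^sup>2 * ((- y r i0 - - y r' i0)\<^sup>2 + (\<Sum>i\<in>J. (- y r i - - y r' i)\<^sup>2) / 4)) ^ (2 * m)
        \<le> b r * b r' * (1 / (1 + N\<^sup>2 * sqdist I (y r) (y r') / 4) ^ (2 * m))" by simp
    qed (use \<sigma> N a C12 Cm(1) in auto)
    also have "\<dots> \<le> (C1 + C2) * (\<sigma> * N ^ (card I - 1) * (\<Sum>p\<in>P. \<Sum>q\<in>P. a p * a q * exp (- \<gamma> * (N\<^sup>2 * sqdist I (x p) (x q))))
       + 1 / \<sigma> * (\<Sum>r\<in>R. \<Sum>r'\<in>R. b r * b r' * (1 / (1 + N\<^sup>2 * sqdist I (y r) (y r') / 4) ^ (2 * m))))"
    proof -
      have alg: "\<sigma> * (C1 * k * A) + C2 * B / \<sigma> \<le> (C1 + C2) * (\<sigma> * k * A + 1 / \<sigma> * B)" if "k \<ge> 0" "A \<ge> 0" "B \<ge> 0" for k A B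
      proof -
        have "0 \<le> C2 * (\<sigma> * k * A)" "0 \<le> C1 * (1 / \<sigma> * B)" using that C12 \<sigma> by auto
        then show ?thesis by (simp add: algebra_simps add_divide_distrib)
      qed
      show ?thesis
        using a b N by (intro alg sum_nonneg mult_nonneg_nonneg divide_nonneg_nonneg zero_le_even_power') auto
    qed
    finally show ?thesis .
  qed
  show ?thesis
    by (rule exI[of _ "C1 + C2"], rule exI[of _ \<gamma>]) (use C12 \<gamma> main in \<open>simp add: add_pos_pos\<close>)
qed

section \<open>Energies of product weights\<close>

text \<open>Replaces the Gaussian kernel of the x-side by the rational kernel of the y-side, so that
  one energy estimate serves both.\<close>

lemma exp_le_kernel:
  assumes "\<gamma> > 0"
  shows "exp (- \<gamma> * v\<^sup>2) \<le> exp (real M ^ 2 / \<gamma>) * (1 / (1 + v\<^sup>2) ^ M)"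
proof -
  have pos: "1 + v\<^sup>2 > 0" by (simp add: add_pos_nonneg)
  have "1 + v\<^sup>2 \<le> (1 + \<bar>v\<bar>)\<^sup>2" by (simp add: power2_eq_square algebra_simps flip: abs_mult)
  then have "(1 + v\<^sup>2) ^ M \<le> ((1 + \<bar>v\<bar>)\<^sup>2) ^ M" using pos by (intro power_mono) auto
  then have "(1 + v\<^sup>2) ^ M * exp (- \<gamma> * v\<^sup>2) \<le> (1 + \<bar>v\<bar>) ^ (2 * M) * exp (- \<gamma> * v\<^sup>2)"
    unfolding power_mult by (rule mult_right_mono) simp
  also have "\<dots> \<le> exp (real (2 * M) ^ 2 / (4 * \<gamma>))" by (rule power_exp_bound[OF assms])
  also have "real (2 * M) ^ 2 / (4 * \<gamma>) = real M ^ 2 / \<gamma>" by (simp add: power_mult_distrib)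
  finally show ?thesis using pos by (simp add: field_simps)
qed

lemma product_energy:
  fixes \<mu> :: "'j \<Rightarrow> 'x \<Rightarrow> real"
  assumes "finite L" "\<And>j. j \<in> L \<Longrightarrow> finite (X j)"
  shows "(\<Sum>p\<in>PiE L X. \<Sum>q\<in>PiE L X. (\<Prod>j\<in>L. \<mu> j (p j)) * (\<Prod>j\<in>L. \<mu> j (q j)) * (\<Prod>j\<in>L. k (p j) (q j)))
    = (\<Prod>j\<in>L. \<Sum>x\<in>X j. \<Sum>y\<in>X j. \<mu> j x * \<mu> j y * k x y)"
proof -
  have "(\<Prod>j\<in>L. \<Sum>x\<in>X j. \<Sum>y\<in>X j. \<mu> j x * \<mu> j y * k x y) = (\<Sum>p\<in>PiE L X. \<Prod>j\<in>L. \<Sum>y\<in>X j. \<mu> j (p j) * \<mu> j y * k (p j) y)"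
    by (rule prod_sum_PiE) (use assms in auto)
  also have "\<dots> = (\<Sum>p\<in>PiE L X. \<Sum>q\<in>PiE L X. \<Prod>j\<in>L. \<mu> j (p j) * \<mu> j (q j) * k (p j) (q j))"
    by (intro sum.cong refl prod_sum_PiE) (use assms in auto)
  finally show ?thesis by (simp add: prod.distrib)
qed

text \<open>A product weight paired with a product kernel has an energy that factors. Factors of
  size N^(-s) thus give N^(-ls) in the product space, without any ball estimate for the product
  weight.\<close>

lemma weighted_product_energy_le:
  fixes \<mu> :: "'j \<Rightarrow> 'x \<Rightarrow> real"
  assumes L: "finite L" and fin: "\<And>j. j \<in> L \<Longrightarrow> finite (X j)" and \<mu>: "\<And>j x. j \<in> L \<Longrightarrow> 0 \<le> \<mu> j x"
    and k: "\<And>x y. 0 \<le> k x y" and D: "0 \<le> D"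
    and e: "\<And>j. j \<in> L \<Longrightarrow> (\<Sum>x\<in>X j. \<Sum>y\<in>X j. \<mu> j x * \<mu> j y * k x y) \<le> e"
    and W: "\<And>p q. p \<in> PiE L X \<Longrightarrow> q \<in> PiE L X \<Longrightarrow> W p q \<le> (\<Prod>j\<in>L. D * k (p j) (q j))"
  shows "(\<Sum>p\<in>PiE L X. \<Sum>q\<in>PiE L X. (\<Prod>j\<in>L. \<mu> j (p j)) * (\<Prod>j\<in>L. \<mu> j (q j)) * W p q) \<le> (D * e) ^ card L"
proof -
  have "(\<Sum>p\<in>PiE L X. \<Sum>q\<in>PiE L X. (\<Prod>j\<in>L. \<mu> j (p j)) * (\<Prod>j\<in>L. \<mu> j (q j)) * W p q)
    \<le> (\<Sum>p\<in>PiE L X. \<Sum>q\<in>PiE L X. (\<Prod>j\<in>L. \<mu> j (p j)) * (\<Prod>j\<in>L. \<mu> j (q j)) * (\<Prod>j\<in>L. D * k (p j) (q j)))"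
    by (intro sum_mono mult_left_mono W mult_nonneg_nonneg prod_nonneg \<mu>)
  also have "\<dots> = (\<Prod>j\<in>L. \<Sum>x\<in>X j. \<Sum>y\<in>X j. \<mu> j x * \<mu> j y * (D * k x y))"
    by (rule product_energy[OF L fin])
  also have "\<dots> \<le> (\<Prod>j\<in>L. D * e)"
  proof (intro prod_mono conjI)
    fix j assume j: "j \<in> L"
    have eq: "(\<Sum>x\<in>X j. \<Sum>y\<in>X j. \<mu> j x * \<mu> j y * (D * k x y)) = D * (\<Sum>x\<in>X j. \<Sum>y\<in>X j. \<mu> j x * \<mu> j y * k x y)"
      by (simp add: sum_distrib_left mult_ac)
    show "(\<Sum>x\<in>X j. \<Sum>y\<in>X j. \<mu> j x * \<mu> j y * (D * k x y)) \<le> D * e"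
      unfolding eq using e[OF j] D by (rule mult_left_mono)
    show "0 \<le> (\<Sum>x\<in>X j. \<Sum>y\<in>X j. \<mu> j x * \<mu> j y * (D * k x y))"
      using \<mu>[OF j] k D by (intro sum_nonneg mult_nonneg_nonneg)
  qed
  finally show ?thesis by simp
qed

section \<open>Intervals in the sumset from decay in the scale\<close>

lemma gaussian_tail_le:
  fixes M :: real
  assumes "\<alpha> > 0" "M > 0"
  shows "M * exp (- \<alpha> * M\<^sup>2) \<le> exp (1 / \<alpha>) * M powr (-1)"
proof -
  have "M * (M * exp (- \<alpha> * M\<^sup>2)) \<le> (1 + \<bar>M\<bar>) ^ 2 * exp (- \<alpha> * M\<^sup>2)"
    using assms(2) by (simp add: power2_eq_square mult_mono flip: mult.assoc)
  also have "\<dots> \<le> exp (real 2 ^ 2 / (4 * \<alpha>))" by (rule power_exp_bound[OF assms(1)])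
  finally have "M * (M * exp (- \<alpha> * M\<^sup>2)) \<le> exp (1 / \<alpha>)" by simp
  then show ?thesis using assms(2) by (simp add: powr_minus_divide field_simps)
qed

text \<open>The order of choices matters. For fixed M the filtered densities are Lipschitz in t
  uniformly in n, so smallness on a finite net of points outside \<open>S\<close> suffices; n is
  chosen after that net, making the density at frequency \<open>2 ^ n\<close> negligible there, and
  \<open>decay\<close> carries the smallness down to M. The points \<open>\<tau> n z\<close> stay
  within \<rho>/2 of \<open>u0\<close>, so beyond distance \<rho> only Gaussian tails are
  left.\<close>

lemma nonempty_interior_of_decay:
  fixes S :: "real set" and Z :: "nat \<Rightarrow> 'z set" and g \<tau> v :: "nat \<Rightarrow> 'z \<Rightarrow> real"
  assumes S: "closed S" and pos: "\<rho> > 0" "c > 0" "\<eta> > 0"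
    and fin: "\<And>n. finite (Z n)" and g: "\<And>n z. g n z \<ge> 0" "\<And>n. sum (g n) (Z n) = 1"
    and \<tau>: "\<And>n z. z \<in> Z n \<Longrightarrow> \<tau> n z \<in> S" "\<And>n z. z \<in> Z n \<Longrightarrow> \<bar>\<tau> n z - u0\<bar> \<le> \<rho> / 2"
    and v: "\<And>n z. z \<in> Z n \<Longrightarrow> c \<le> \<bar>v n z\<bar>" "\<And>n z. z \<in> Z n \<Longrightarrow> \<bar>v n z\<bar> \<le> K"
    and decay: "\<And>n N t. \<bar>t - u0\<bar> \<le> \<rho> \<Longrightarrow> 1 \<le> N \<Longrightarrow> N \<le> 2 ^ n \<Longrightarrow>
       \<bar>\<Sum>z\<in>Z n. g n z * gauss_deriv (2 * Suc m) (N * (v n z * (t - \<tau> n z)))\<bar> \<le> C * N powr (- 1 - \<eta>)"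
  shows "interior S \<noteq> {}"
proof
  assume empty: "interior S = {}"
  define F where "F n t N = (\<Sum>z\<in>Z n. g n z * (N * lowpass m (N * (v n z * (t - \<tau> n z)))))" for n t N
  define I where "I = {u0 - \<rho>..u0 + \<rho>}"
  have I_iff: "t \<in> I \<longleftrightarrow> \<bar>t - u0\<bar> \<le> \<rho>" for t by (auto simp: I_def)
  obtain Kh where Kh: "Kh > 0" "\<And>x. \<bar>lowpass m x\<bar> \<le> Kh * exp (- (1/8) * x\<^sup>2)"
    using lowpass_bound by blast
  obtain D KD where D: "\<And>x. (lowpass m has_real_derivative D x) (at x)" "\<And>x. \<bar>D x\<bar> \<le> KD"
    using lowpass_deriv by blast
  have KD: "KD \<ge> 0" using D(2)[of 0] by linarith
  have Zne: "Z n \<noteq> {}" for n using g(2)[of n] by auto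
  have K: "K > 0"
  proof -
    obtain z where "z \<in> Z 0" using Zne by blast
    then show ?thesis using v[of z 0] pos(2) by linarith
  qed
  have C: "C \<ge> 0"
    using order.trans[OF abs_ge_zero decay[of u0 1 0]] pos(1) by simp
  have sum_le: "\<bar>\<Sum>z\<in>Z n. g n z * h z\<bar> \<le> B" if "\<And>z. z \<in> Z n \<Longrightarrow> \<bar>h z\<bar> \<le> B" for n h B
  proof -
    have "\<bar>\<Sum>z\<in>Z n. g n z * h z\<bar> \<le> (\<Sum>z\<in>Z n. \<bar>g n z * h z\<bar>)" by (rule sum_abs)
    also have "\<dots> \<le> (\<Sum>z\<in>Z n. g n z * B)"
      unfolding abs_mult using g(1) that by (intro sum_mono mult_mono) auto
    also have "\<dots> = B" using g(2) by (simp flip: sum_distrib_right)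
    finally show ?thesis .
  qed

  \<comment> \<open>The N-derivative of F is the sum in \<open>decay\<close>, so \<plusminus>F -
    (C/\<eta>) N^(-\<eta>) is nondecreasing in N; comparing the values at M and N gives the
    bound.\<close>
  have telescope: "\<bar>F n t N - F n t M\<bar> \<le> C / \<eta> * M powr (- \<eta>)"
    if t: "t \<in> I" and MN: "1 \<le> M" "M \<le> N" "N \<le> 2 ^ n" for n t M N
  proof -
    let ?G = "\<lambda>N. \<Sum>z\<in>Z n. g n z * gauss_deriv (2 * Suc m) (N * (v n z * (t - \<tau> n z)))"
    have dF: "((\<lambda>N. F n t N) has_real_derivative ?G x) (at x)" for x
      unfolding F_def by (intro DERIV_sum DERIV_cmult DERIV_dilated_lowpass)
    have mono: "\<sigma> * F n t M - C / \<eta> * M powr (- \<eta>) \<le> \<sigma> * F n t N - C / \<eta> * N powr (- \<eta>)" if \<sigma>: "\<sigma> = 1 \<or> \<sigma> = -1" for \<sigma> :: real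
    proof (rule DERIV_nonneg_imp_nondecreasing[OF MN(2)])
      fix x assume x: "M \<le> x" "x \<le> N"
      have x0: "x > 0" using x MN by linarith
      have "((\<lambda>x. x powr (- \<eta>)) has_real_derivative (- \<eta>) * x powr (- \<eta> - 1)) (at x)"
        by (rule has_real_derivative_powr[OF x0])
      then have "((\<lambda>x. \<sigma> * F n t x - C / \<eta> * x powr (- \<eta>)) has_real_derivative \<sigma> * ?G x - C / \<eta> * ((- \<eta>) * x powr (- \<eta> - 1))) (at x)"
        by (intro DERIV_diff DERIV_cmult dF)
      moreover have "\<sigma> * ?G x - C / \<eta> * ((- \<eta>) * x powr (- \<eta> - 1)) \<ge> 0"
      proof -
        have "\<bar>?G x\<bar> \<le> C * x powr (- 1 - \<eta>)" using t x MN by (intro decay) (auto simp: I_iff)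
        moreover have "- 1 - \<eta> = - \<eta> - 1" by simp
        ultimately have "\<bar>?G x\<bar> \<le> C * x powr (- \<eta> - 1)" by (simp only:)
        moreover have "C / \<eta> * ((- \<eta>) * x powr (- \<eta> - 1)) = - (C * x powr (- \<eta> - 1))" using pos(3) by simp
        moreover have "\<bar>\<sigma> * ?G x\<bar> = \<bar>?G x\<bar>" using \<sigma> by (auto simp: abs_mult)
        ultimately show ?thesis by linarith
      qed
      ultimately show "\<exists>y. ((\<lambda>x. \<sigma> * F n t x - C / \<eta> * x powr (- \<eta>)) has_real_derivative y) (at x) \<and> 0 \<le> y" by blast
    qed
    have "0 \<le> C / \<eta> * N powr (- \<eta>)" using C pos(3) by simp
    with mono[of 1] mono[of "-1"] show ?thesis by (simp; linarith)
  qed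

  have small: "\<exists>n. \<forall>t\<in>I. \<bar>F n t M\<bar> \<le> (C / \<eta> + 2) * M powr (- \<eta>)" if M: "M \<ge> 1" for M
  proof -
    define e where "e = M powr (- \<eta>)"
    have e: "e > 0" using M by (simp add: e_def)
    \<comment> \<open>One factor M is the normalisation, the other together with K comes from the
      inner derivative; adding 1 makes the constant positive.\<close>
    define Lp where "Lp = M * (M * K * KD) + 1"
    have Lp: "Lp > 0" using M K KD unfolding Lp_def by (intro add_nonneg_pos mult_nonneg_nonneg) auto
    have lip: "\<bar>F n t M - F n t' M\<bar> \<le> Lp * \<bar>t - t'\<bar>" for n t t'
    proof -
      have "\<bar>M * lowpass m (M * (v n z * (t - \<tau> n z))) - M * lowpass m (M * (v n z * (t' - \<tau> n z)))\<bar> \<le> Lp * \<bar>t - t'\<bar>"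
        if z: "z \<in> Z n" for z
      proof -
        have lp: "\<bar>lowpass m x - lowpass m y\<bar> \<le> KD * \<bar>x - y\<bar>" for x y
          using field_differentiable_bound[of UNIV "lowpass m" D KD x y] D by (auto intro: DERIV_subset)
        let ?x = "M * (v n z * (t - \<tau> n z))" and ?y = "M * (v n z * (t' - \<tau> n z))"
        have xy: "\<bar>?x - ?y\<bar> \<le> M * K * \<bar>t - t'\<bar>"
        proof -
          have "?x - ?y = M * v n z * (t - t')" by (simp add: algebra_simps)
          then have "\<bar>?x - ?y\<bar> = M * \<bar>v n z\<bar> * \<bar>t - t'\<bar>" using M by (simp add: abs_mult)
          also have "\<dots> \<le> M * K * \<bar>t - t'\<bar>" using v(2)[OF z] M by (intro mult_right_mono mult_left_mono) auto
          finally show ?thesis .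
        qed
        have "\<bar>M * lowpass m ?x - M * lowpass m ?y\<bar> = M * \<bar>lowpass m ?x - lowpass m ?y\<bar>"
          using M by (simp add: abs_mult flip: right_diff_distrib)
        also have "\<dots> \<le> M * (KD * \<bar>?x - ?y\<bar>)" using M by (intro mult_left_mono lp) auto
        also have "\<dots> \<le> M * (KD * (M * K * \<bar>t - t'\<bar>))" using M KD by (intro mult_left_mono xy) auto
        also have "\<dots> \<le> Lp * \<bar>t - t'\<bar>" by (simp add: Lp_def algebra_simps)
        finally show ?thesis .
      qed
      from sum_le[OF this] show ?thesis
        by (simp add: F_def flip: sum_subtractf right_diff_distrib)
    qed
    define \<delta> where "\<delta> = e / Lp"
    have \<delta>: "\<delta> > 0" using e Lp by (simp add: \<delta>_def)
    \<comment> \<open>Empty interior means that the complement of \<open>S\<close> is dense, so the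
      \<delta>-balls around its points in \<open>I\<close> cover \<open>I\<close>; compactness then
      gives a finite net.\<close>
    have cov: "I \<subseteq> (\<Union>t'\<in>I - S. ball t' \<delta>)"
    proof
      fix t assume t: "t \<in> I"
      define r where "r = min \<delta> \<rho>"
      have r: "r > 0" "r \<le> \<delta>" "r \<le> \<rho>" using \<delta> pos(1) by (auto simp: r_def)
      \<comment> \<open>The short interval next to t points towards \<open>u0\<close>, so it cannot
        leave \<open>I\<close>.\<close>
      define a where "a = (if t \<le> u0 then t else t - r)"
      have sub: "{a<..<a + r} \<subseteq> I" using t r by (auto simp: I_def a_def)
      have "\<not> {a<..<a + r} \<subseteq> S"
      proof
        assume "{a<..<a + r} \<subseteq> S"
        then have "{a<..<a + r} \<subseteq> interior S" by (intro interior_maximal) auto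
        moreover have "a + r / 2 \<in> {a<..<a + r}" using r by simp
        ultimately show False using empty by blast
      qed
      then obtain t' where t': "t' \<in> {a<..<a + r}" "t' \<notin> S" by blast
      then have "\<bar>t' - t\<bar> < \<delta>" using r by (auto simp: a_def split: if_splits)
      then show "t \<in> (\<Union>t'\<in>I - S. ball t' \<delta>)" using t' sub by (auto simp: dist_real_def)
    qed
    have "compact I" by (simp add: I_def)
    from compactE_image[OF this _ cov] obtain T where T: "T \<subseteq> I - S" "finite T" "I \<subseteq> (\<Union>t'\<in>T. ball t' \<delta>)"
      using open_ball by blast
    have "u0 \<in> I" using pos(1) by (simp add: I_iff)
    then have Tne: "T \<noteq> {}" using T(3) by blast
    have Sne: "S \<noteq> {}" using \<tau>(1) Zne by blast
    \<comment> \<open>Positive since the net is finite and \<open>S\<close> is closed: every net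
      point keeps at least this distance from every \<open>\<tau> n z\<close>, for all n at
      once.\<close>
    define d where "d = Min ((\<lambda>t. infdist t S) ` T)"
    have d: "d > 0"
      unfolding d_def using T Tne S Sne in_closed_iff_infdist_zero[OF S Sne] infdist_nonneg
      by (subst Min_gr_iff) (auto simp: less_le)
    have dist_T: "d \<le> \<bar>t' - x\<bar>" if "t' \<in> T" "x \<in> S" for t' x
    proof -
      have "d \<le> infdist t' S" unfolding d_def using that T(2) by (intro Min_le) auto
      also have "\<dots> \<le> dist t' x" by (rule infdist_le[OF that(2)])
      finally show ?thesis by (simp add: dist_real_def)
    qed
    define \<alpha> where "\<alpha> = (c * d)\<^sup>2 / 8"
    have \<alpha>: "\<alpha> > 0" using pos(2) d by (simp add: \<alpha>_def)
    have F_T: "\<bar>F n t' (2 ^ n)\<bar> \<le> Kh * exp (1 / \<alpha>) * (1 / 2) ^ n" if t': "t' \<in> T" for n t'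
      unfolding F_def
    proof (rule sum_le)
      fix z assume z: "z \<in> Z n"
      let ?N = "2 ^ n :: real" and ?w = "v n z * (t' - \<tau> n z)"
      have "c * d \<le> \<bar>v n z\<bar> * \<bar>t' - \<tau> n z\<bar>"
        using v(1)[OF z] dist_T[OF t' \<tau>(1)[OF z]] pos d by (intro mult_mono) auto
      then have "(?N * (c * d))\<^sup>2 \<le> (?N * (\<bar>v n z\<bar> * \<bar>t' - \<tau> n z\<bar>))\<^sup>2"
        using pos d by (intro power_mono mult_left_mono) auto
      also have "\<dots> = (?N * ?w)\<^sup>2" by (simp add: power_mult_distrib)
      finally have le: "- (1/8) * (?N * ?w)\<^sup>2 \<le> - \<alpha> * ?N\<^sup>2"
        by (simp add: \<alpha>_def power_mult_distrib mult_ac)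
      have "\<bar>?N * lowpass m (?N * ?w)\<bar> \<le> ?N * (Kh * exp (- (1/8) * (?N * ?w)\<^sup>2))"
        unfolding abs_mult using Kh(2) by (intro mult_mono) auto
      also have "\<dots> \<le> ?N * (Kh * exp (- \<alpha> * ?N\<^sup>2))"
        using Kh(1) le by (intro mult_left_mono) auto
      also have "\<dots> = Kh * (?N * exp (- \<alpha> * ?N\<^sup>2))" by simp
      also have "\<dots> \<le> Kh * (exp (1 / \<alpha>) * ?N powr (-1))"
        using Kh(1) by (intro mult_left_mono gaussian_tail_le \<alpha>) auto
      also have "\<dots> = Kh * exp (1 / \<alpha>) * (1 / 2) ^ n" by (simp add: powr_minus_divide power_divide)
      finally show "\<bar>?N * lowpass m (?N * ?w)\<bar> \<le> Kh * exp (1 / \<alpha>) * (1 / 2) ^ n" .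
    qed
    obtain n1 where n1: "M < 2 ^ n1" using real_arch_pow[of 2 M] by auto
    obtain n2 where n2: "(1 / 2) ^ n2 < e / (Kh * exp (1 / \<alpha>))"
      using real_arch_pow_inv[of "e / (Kh * exp (1 / \<alpha>))" "1 / 2"] e Kh(1) by auto
    \<comment> \<open>Large enough both for M \<le> 2^n and for the Gaussian tails at the net points
      to drop below \<open>e\<close>.\<close>
    define n where "n = max n1 n2"
    have "(2::real) ^ n1 \<le> 2 ^ n" by (intro power_increasing) (auto simp: n_def)
    then have Mn: "M \<le> 2 ^ n" using n1 by linarith
    have "(1 / 2 :: real) ^ n \<le> (1 / 2) ^ n2" by (intro power_decreasing) (auto simp: n_def)
    then have "(1 / 2) ^ n \<le> e / (Kh * exp (1 / \<alpha>))" using n2 by linarith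
    then have "Kh * exp (1 / \<alpha>) * (1 / 2) ^ n \<le> Kh * exp (1 / \<alpha>) * (e / (Kh * exp (1 / \<alpha>)))"
      using Kh(1) by (intro mult_left_mono) auto
    also have "\<dots> = e" using Kh(1) by simp
    finally have small_n: "Kh * exp (1 / \<alpha>) * (1 / 2) ^ n \<le> e" .
    have "\<bar>F n t M\<bar> \<le> (C / \<eta> + 2) * e" if t: "t \<in> I" for t
    proof -
      obtain t' where t': "t' \<in> T" "\<bar>t - t'\<bar> < \<delta>" using T(3) t by (auto simp: dist_real_def abs_minus_commute)
      have "\<bar>F n t M - F n t' M\<bar> \<le> Lp * \<bar>t - t'\<bar>" by (rule lip)
      also have "\<dots> \<le> Lp * \<delta>" using t'(2) Lp by (intro mult_left_mono) auto
      also have "\<dots> = e" using Lp by (simp add: \<delta>_def)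
      finally have 1: "\<bar>F n t M - F n t' M\<bar> \<le> e" .
      have 2: "\<bar>F n t' (2 ^ n) - F n t' M\<bar> \<le> C / \<eta> * e"
        unfolding e_def using t'(1) T(1) M Mn by (intro telescope) auto
      have 3: "\<bar>F n t' (2 ^ n)\<bar> \<le> e" using F_T[OF t'(1), of n] small_n by linarith
      show ?thesis using 1 2 3 by (simp add: distrib_right; linarith)
    qed
    then show ?thesis unfolding e_def by blast
  qed

  define \<kappa> where "\<kappa> = \<bar>integral\<^sup>L lborel (lowpass m)\<bar>"
  have \<kappa>: "\<kappa> > 0" using integral_lowpass_nonzero by (simp add: \<kappa>_def)
  \<comment> \<open>Outside \<open>I\<close> the kernel exponent is at least M^2 c^2 (t - u0)^2 / 32
    = 2 q M^2 (t - u0)^2. One half yields the decay in M, the other a Gaussian in t.\<close>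
  define q where "q = c\<^sup>2 / 64"
  have q: "q > 0" using pos(2) by (simp add: q_def)
  \<comment> \<open>The coefficient of a single Gaussian majorant on the whole line: the first
    summand is for \<open>I\<close>, where the factor exp(q \<rho>^2) compensates the Gaussian, the
    second for the tails.\<close>
  define B where "B M = (C / \<eta> + 2) * exp (q * \<rho>\<^sup>2) * M powr (- \<eta>) + Kh * exp (1 / (q * \<rho>\<^sup>2)) * M powr (-1)" for M
  have lower: "\<kappa> / K \<le> B M * sqrt (pi / q)" if M: "M \<ge> 1" for M
  proof -
    obtain n where n: "\<And>t. t \<in> I \<Longrightarrow> \<bar>F n t M\<bar> \<le> (C / \<eta> + 2) * M powr (- \<eta>)" using small[OF M] by blast
    \<comment> \<open>The dilation changes the mass only by 1/\<bar>v\<bar>. The sign of v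
      disappears, so different z cannot cancel and the total mass is bounded below independently of
      M and n.\<close>
    have int_z: "has_bochner_integral lborel (\<lambda>t. M * lowpass m (M * (v n z * (t - \<tau> n z)))) (integral\<^sup>L lborel (lowpass m) / \<bar>v n z\<bar>)"
      if z: "z \<in> Z n" for z
    proof -
      have v0: "M * v n z \<noteq> 0" using v(1)[OF z] pos(2) M by auto
      have "has_bochner_integral lborel (lowpass m) (integral\<^sup>L lborel (lowpass m))"
        using integrable_lowpass by (simp add: has_bochner_integral_iff)
      then have int: "has_bochner_integral lborel (\<lambda>t. lowpass m (- (M * v n z * \<tau> n z) + M * v n z * t)) (integral\<^sup>L lborel (lowpass m) /\<^sub>R \<bar>M * v n z\<bar>)"
        by (subst (asm) lborel_has_bochner_integral_real_affine_iff[OF v0, of _ _ "- (M * v n z * \<tau> n z)"])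
      have val: "M * (integral\<^sup>L lborel (lowpass m) /\<^sub>R \<bar>M * v n z\<bar>) = integral\<^sup>L lborel (lowpass m) / \<bar>v n z\<bar>"
        using M v0 by (simp add: abs_mult divide_inverse)
      have arg: "M * (v n z * (t - \<tau> n z)) = - (M * v n z * \<tau> n z) + M * v n z * t" for t
        by (simp add: algebra_simps)
      show ?thesis using has_bochner_integral_mult_right[OF int, of M] unfolding val arg .
    qed
    have int_F: "has_bochner_integral lborel (\<lambda>t. F n t M) (\<Sum>z\<in>Z n. g n z * (integral\<^sup>L lborel (lowpass m) / \<bar>v n z\<bar>))"
      unfolding F_def by (intro has_bochner_integral_sum has_bochner_integral_mult_right int_z)
    have bound: "\<bar>F n t M\<bar> \<le> B M * exp (- q * (t - u0)\<^sup>2)" for t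
    proof (cases "t \<in> I")
      case True
      then have "(t - u0)\<^sup>2 \<le> \<rho>\<^sup>2" using power_mono[of "\<bar>t - u0\<bar>" \<rho> 2] by (simp add: I_iff)
      then have "1 \<le> exp (q * \<rho>\<^sup>2) * exp (- q * (t - u0)\<^sup>2)" using q by (simp flip: exp_add)
      then have "(C / \<eta> + 2) * M powr (- \<eta>) * 1 \<le> (C / \<eta> + 2) * M powr (- \<eta>) * (exp (q * \<rho>\<^sup>2) * exp (- q * (t - u0)\<^sup>2))"
        using C pos(3) by (intro mult_left_mono) auto
      also have "\<dots> \<le> B M * exp (- q * (t - u0)\<^sup>2)"
        using Kh(1) by (simp add: B_def algebra_simps)
      finally show ?thesis using n[OF True] by linarith
    next
      case False
      then have far: "\<bar>t - u0\<bar> > \<rho>" by (simp add: I_iff)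
      have "\<bar>F n t M\<bar> \<le> Kh * exp (1 / (q * \<rho>\<^sup>2)) * M powr (-1) * exp (- q * (t - u0)\<^sup>2)"
        unfolding F_def
      proof (rule sum_le)
        fix z assume z: "z \<in> Z n"
        let ?x = "M * (v n z * (t - \<tau> n z))" and ?R = "Kh * exp (1 / (q * \<rho>\<^sup>2)) * M powr (-1) * exp (- q * (t - u0)\<^sup>2)"
        let ?e = "exp (- (1/8) * ?x\<^sup>2)"
        let ?L = "M * (Kh * ?e)"
        have "\<bar>t - \<tau> n z\<bar> \<ge> \<bar>t - u0\<bar> / 2" 
          using \<tau>(2)[OF z] far abs_triangle_ineq[of "t - \<tau> n z" "\<tau> n z - u0"] by simp
        then have "c * (\<bar>t - u0\<bar> / 2) \<le> \<bar>v n z\<bar> * \<bar>t - \<tau> n z\<bar>"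
          using v(1)[OF z] pos by (intro mult_mono) auto
        then have "(M * (c * (\<bar>t - u0\<bar> / 2)))\<^sup>2 \<le> (M * (\<bar>v n z\<bar> * \<bar>t - \<tau> n z\<bar>))\<^sup>2"
          using pos M by (intro power_mono mult_left_mono) auto
        then have "M\<^sup>2 * (c\<^sup>2 * (t - u0)\<^sup>2) / 4 \<le> (?x)\<^sup>2"
          by (simp add: power_mult_distrib power_divide)
        then have "- (1/8) * (?x)\<^sup>2 \<le> - (2 * (M\<^sup>2 * (q * (t - u0)\<^sup>2)))"
          by (simp add: q_def)
        also have "\<dots> \<le> - (q * \<rho>\<^sup>2) * M\<^sup>2 + - q * (t - u0)\<^sup>2"
        proof -
          have "\<rho>\<^sup>2 \<le> (t - u0)\<^sup>2" using power_mono[of \<rho> "\<bar>t - u0\<bar>" 2] far pos(1) by simp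
          then have "M\<^sup>2 * (q * \<rho>\<^sup>2) \<le> M\<^sup>2 * (q * (t - u0)\<^sup>2)" using q by (intro mult_left_mono) auto
          moreover have "1 * (q * (t - u0)\<^sup>2) \<le> M\<^sup>2 * (q * (t - u0)\<^sup>2)"
            using q M by (intro mult_right_mono one_le_power) auto
          ultimately show ?thesis by (simp add: mult.commute)
        qed
        finally have "?e \<le> exp (- (q * \<rho>\<^sup>2) * M\<^sup>2) * exp (- q * (t - u0)\<^sup>2)"
          by (simp flip: exp_add)
        then have "?L \<le> M * (Kh * (exp (- (q * \<rho>\<^sup>2) * M\<^sup>2) * exp (- q * (t - u0)\<^sup>2)))"
          using M Kh(1) by (intro mult_left_mono) auto
        also have "\<dots> = Kh * (M * exp (- (q * \<rho>\<^sup>2) * M\<^sup>2)) * exp (- q * (t - u0)\<^sup>2)" by simp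
        also have "\<dots> \<le> Kh * (exp (1 / (q * \<rho>\<^sup>2)) * M powr (-1)) * exp (- q * (t - u0)\<^sup>2)"
          using Kh(1) q pos(1) M by (intro mult_right_mono mult_left_mono gaussian_tail_le) auto
        finally have 1: "?L \<le> ?R"
          by (simp only: mult.assoc)
        have "\<bar>M * lowpass m (?x)\<bar> \<le> ?L"
          unfolding abs_mult using M Kh(2) by (intro mult_mono) auto
        with 1 show "\<bar>M * lowpass m (?x)\<bar> \<le> ?R"
          by linarith
      qed
      also have "\<dots> \<le> B M * exp (- q * (t - u0)\<^sup>2)"
        using C pos(3) by (intro mult_right_mono) (auto simp: B_def)
      finally show ?thesis .
    qed
    have int_g: "has_bochner_integral lborel (\<lambda>t. exp (- q * (t - u0)\<^sup>2)) (sqrt (pi / q))"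
    proof -
      have "has_bochner_integral lborel (\<lambda>x. exp (- q * x\<^sup>2)) (sqrt (pi / q))"
        using integrable_gaussian[OF q] integral_gaussian[OF q] by (simp add: has_bochner_integral_iff)
      then have "has_bochner_integral lborel (\<lambda>x. exp (- q * (- u0 + 1 * x)\<^sup>2)) (sqrt (pi / q) /\<^sub>R \<bar>1\<bar>)"
        by (subst (asm) lborel_has_bochner_integral_real_affine_iff[of 1 _ _ "- u0"]) auto
      then show ?thesis by simp
    qed
    have "\<kappa> / K \<le> \<bar>\<Sum>z\<in>Z n. g n z * (integral\<^sup>L lborel (lowpass m) / \<bar>v n z\<bar>)\<bar>"
    proof -
      have "\<kappa> / K = (\<Sum>z\<in>Z n. g n z * (\<kappa> / K))" unfolding sum_distrib_right[symmetric] g(2) by simp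
      also have "\<dots> \<le> (\<Sum>z\<in>Z n. g n z * (\<kappa> / \<bar>v n z\<bar>))"
      proof (intro sum_mono mult_left_mono)
        fix z assume z: "z \<in> Z n"
        have "0 < \<bar>v n z\<bar>" using v(1)[OF z] pos(2) by linarith
        then show "\<kappa> / K \<le> \<kappa> / \<bar>v n z\<bar>" using v(2)[OF z] \<kappa> K by (intro divide_left_mono mult_pos_pos) auto
      qed (use g in auto)
      also have "\<dots> = \<bar>integral\<^sup>L lborel (lowpass m)\<bar> * (\<Sum>z\<in>Z n. g n z / \<bar>v n z\<bar>)"
        by (simp add: \<kappa>_def sum_distrib_left mult_ac)
      also have "\<dots> = \<bar>integral\<^sup>L lborel (lowpass m) * (\<Sum>z\<in>Z n. g n z / \<bar>v n z\<bar>)\<bar>"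
        using g(1) by (simp add: abs_mult sum_nonneg)
      also have "integral\<^sup>L lborel (lowpass m) * (\<Sum>z\<in>Z n. g n z / \<bar>v n z\<bar>) = (\<Sum>z\<in>Z n. g n z * (integral\<^sup>L lborel (lowpass m) / \<bar>v n z\<bar>))"
        by (simp add: sum_distrib_left mult_ac)
      finally show ?thesis .
    qed
    also have "\<dots> = \<bar>LINT t|lborel. F n t M\<bar>" using has_bochner_integral_integral_eq[OF int_F] by simp
    also have "\<dots> \<le> (LINT t|lborel. \<bar>F n t M\<bar>)" by (rule integral_abs_bound)
    also have "\<dots> \<le> (LINT t|lborel. B M * exp (- q * (t - u0)\<^sup>2))"
      using int_F int_g by (intro integral_mono bound integrable_abs integrable_mult_right) (auto simp: has_bochner_integral_iff)
    also have "\<dots> = B M * sqrt (pi / q)"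
      using has_bochner_integral_mult_right[OF int_g, of "B M"] by (rule has_bochner_integral_integral_eq)
    finally show ?thesis .
  qed
  have "(\<lambda>k. B (real k) * sqrt (pi / q)) \<longlonglongrightarrow> ((C / \<eta> + 2) * exp (q * \<rho>\<^sup>2) * 0 + Kh * exp (1 / (q * \<rho>\<^sup>2)) * 0) * sqrt (pi / q)"
    unfolding B_def
    by (rule tendsto_mult_right, rule tendsto_add; rule tendsto_mult_left, rule tendsto_neg_powr)
       (use pos(3) filterlim_real_sequentially in auto)
  moreover have "\<exists>k0. \<forall>k\<ge>k0. \<kappa> / K \<le> B (real k) * sqrt (pi / q)"
    by (intro exI[of _ 1] allI impI lower) simp
  ultimately have "\<kappa> / K \<le> ((C / \<eta> + 2) * exp (q * \<rho>\<^sup>2) * 0 + Kh * exp (1 / (q * \<rho>\<^sup>2)) * 0) * sqrt (pi / q)"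
    by (rule LIMSEQ_le_const)
  moreover have "\<kappa> / K > 0" using \<kappa> K by simp
  ultimately show False by simp
qed

section \<open>Hausdorff content and discrete Frostman weights\<close>

text \<open>Vanishing s-dimensional Hausdorff content. The diameters are not restricted: for s > 0 a
  small total cost forces every set of the cover to be small.\<close>

definition null_content :: "real \<Rightarrow> 'a::metric_space set \<Rightarrow> bool" where
  "null_content s E \<longleftrightarrow> (\<forall>e>0. \<exists>C::nat \<Rightarrow> 'a set. E \<subseteq> (\<Union>n. C n) \<and> (\<forall>n. bounded (C n))
     \<and> (\<Sum>n. ennreal (diameter (C n) powr s)) < ennreal e)"

lemma null_contentE:
  assumes "null_content s E" "e > 0"
  obtains C :: "nat \<Rightarrow> 'a::metric_space set" where "E \<subseteq> (\<Union>n. C n)" "\<And>n. bounded (C n)"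
    "(\<Sum>n. ennreal (diameter (C n) powr s)) < ennreal e"
  using assms unfolding null_content_def by blast

lemma hausdorff_measure_null_content:
  assumes "null_content s E" "s > 0"
  shows "hausdorff_measure s E = 0"
proof -
  have "hausdorff_content_delta s \<delta> E \<le> 0" if "\<delta> > 0" for \<delta>
  proof (rule ennreal_le_epsilon)
    fix e :: real assume "e > 0"
    \<comment> \<open>A cover costing less than \<open>\<delta> powr s\<close> cannot contain a set
      of diameter above \<delta>, hence is admissible for the \<delta>-content.\<close>
    define e' where "e' = min e (\<delta> powr s)"
    have "e' > 0" using \<open>e > 0\<close> that by (simp add: e'_def)
    then obtain C where C: "E \<subseteq> (\<Union>n. C n)" "\<And>n. bounded (C n)" "(\<Sum>n. ennreal (diameter (C n) powr s)) < ennreal e'"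
      using null_contentE[OF assms(1)] by blast
    have "diameter (C n) \<le> \<delta>" for n
    proof (rule ccontr)
      assume "\<not> diameter (C n) \<le> \<delta>"
      then have "\<delta> powr s \<le> diameter (C n) powr s" using that assms(2) by (intro powr_mono2) auto
      moreover have "diameter (C n) powr s < e'"
        using ennreal_suminf_lessD[OF C(3), of n] \<open>e' > 0\<close> by (simp only: ennreal_less_iff powr_ge_zero)
      ultimately show False by (simp add: e'_def)
    qed
    then have "hausdorff_content_delta s \<delta> E \<le> (\<Sum>n. ennreal (diameter (C n) powr s))"
      unfolding hausdorff_content_delta_def using C(1,2) by (intro INF_lower) blast
    also have "\<dots> \<le> ennreal e" 
      by (rule less_imp_le, rule less_le_trans[OF C(3)], rule ennreal_leI) (simp add: e'_def)
    finally show "hausdorff_content_delta s \<delta> E \<le> 0 + ennreal e" by simp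
  qed
  then show ?thesis unfolding hausdorff_measure_def 
    by (intro antisym SUP_least) simp_all
qed

lemma not_null_content_less_dim:
  assumes "0 < s" "s < hausdorff_dim E"
  shows "\<not> null_content s E"
proof
  assume "null_content s E"
  then have "s \<in> {s. 0 < s \<and> hausdorff_measure s E = 0}"
    using hausdorff_measure_null_content assms(1) by auto
  moreover have "bdd_below {s. 0 < s \<and> hausdorff_measure s E = 0}" by (intro bdd_belowI[of _ 0]) auto
  ultimately have "hausdorff_dim E \<le> s" unfolding hausdorff_dim_def by (rule cInf_lower)
  then show False using assms(2) by simp
qed

lemma null_content_subset: "null_content s B \<Longrightarrow> A \<subseteq> B \<Longrightarrow> null_content s A"
  unfolding null_content_def by (meson order.trans)

lemma null_content_empty: "null_content s {}"
proof -
  have "(\<Sum>n::nat. ennreal (diameter {} powr s)) = 0" by simp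
  then show ?thesis unfolding null_content_def by (intro allI impI exI[of _ "\<lambda>_. {}"]) auto
qed

lemma null_content_UN_nat:
  fixes A :: "nat \<Rightarrow> 'a::metric_space set"
  assumes "\<And>k. null_content s (A k)"
  shows "null_content s (\<Union>k. A k)"
  unfolding null_content_def
proof (intro allI impI)
  fix e :: real assume e: "e > 0"
  \<comment> \<open>The budgets add up to e / 2 rather than e because the total has to be strictly
    below e.\<close>
  have "\<exists>C::nat \<Rightarrow> 'a set. A k \<subseteq> (\<Union>n. C n) \<and> (\<forall>n. bounded (C n))
     \<and> (\<Sum>n. ennreal (diameter (C n) powr s)) < ennreal (e / 2 * (1 / 2) ^ Suc k)" for k
    using assms[of k] e unfolding null_content_def by simp
  then obtain C where C: "\<And>k. A k \<subseteq> (\<Union>n. C k n)" "\<And>k n. bounded (C k n)"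
     "\<And>k. (\<Sum>n. ennreal (diameter (C k n) powr s)) < ennreal (e / 2 * (1 / 2) ^ Suc k)"
    by metis
  define D where "D i = (case prod_decode i of (k, n) \<Rightarrow> C k n)" for i
  have D: "D (prod_encode (k, n)) = C k n" for k n by (simp add: D_def)
  have "(\<Union>k. A k) \<subseteq> (\<Union>i. D i)"
  proof
    fix x assume "x \<in> (\<Union>k. A k)"
    then obtain k n where "x \<in> C k n" using C(1) by blast
    then show "x \<in> (\<Union>i. D i)" using D by blast
  qed
  moreover have "\<forall>i. bounded (D i)" using C(2) by (simp add: D_def split: prod.split)
  moreover have "(\<Sum>i. ennreal (diameter (D i) powr s)) < ennreal e"
  proof -
    have "(\<Sum>i. ennreal (diameter (D i) powr s)) = (\<Sum>i. (\<lambda>(k, n). ennreal (diameter (C k n) powr s)) (prod_decode i))"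
      by (simp add: D_def case_prod_beta)
    also have "\<dots> = (\<Sum>k. \<Sum>n. ennreal (diameter (C k n) powr s))"
      by (rule suminf_ennreal_2dimen) simp
    also have "\<dots> \<le> (\<Sum>k. ennreal (e / 2 * (1 / 2) ^ Suc k))"
      using C(3) by (intro suminf_le less_imp_le) auto
    also have "\<dots> = ennreal (e / 2 * 1)"
      using e by (intro suminf_ennreal_eq sums_mult power_half_series) auto
    also have "\<dots> < ennreal e" using e by (simp add: ennreal_less_iff)
    finally show ?thesis .
  qed
  ultimately show "\<exists>D::nat \<Rightarrow> 'a set. (\<Union>k. A k) \<subseteq> (\<Union>n. D n) \<and> (\<forall>n. bounded (D n))
     \<and> (\<Sum>n. ennreal (diameter (D n) powr s)) < ennreal e" by blast
qed

lemma null_content_Union: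
  assumes "countable \<A>" "\<And>A. A \<in> \<A> \<Longrightarrow> null_content s A"
  shows "null_content s (\<Union>\<A>)"
proof (cases "\<A> = {}")
  case True
  then show ?thesis by (simp add: null_content_empty)
next
  case False
  then have "\<Union>\<A> = (\<Union>k. from_nat_into \<A> k)" using assms(1) by (metis range_from_nat_into)
  moreover have "null_content s (\<Union>k. from_nat_into \<A> k)"
    using False by (intro null_content_UN_nat assms(2) from_nat_into)
  ultimately show ?thesis by simp
qed

text \<open>The index type is arbitrary so that families of grid cells can be used directly as
  covers.\<close>

lemma finite_cover_lower_bound:
  fixes E :: "'a::metric_space set"
  assumes "\<not> null_content s E"
  obtains c where "c > 0" "\<And>K (D :: 'k \<Rightarrow> 'a set). finite K \<Longrightarrow> E \<subseteq> (\<Union>k\<in>K. D k) \<Longrightarrow> (\<And>k. k \<in> K \<Longrightarrow> bounded (D k))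
     \<Longrightarrow> c \<le> (\<Sum>k\<in>K. diameter (D k) powr s)"
proof -
  obtain c where c: "c > 0" "\<And>C::nat \<Rightarrow> 'a set. E \<subseteq> (\<Union>n. C n) \<Longrightarrow> (\<forall>n. bounded (C n))
     \<Longrightarrow> ennreal c \<le> (\<Sum>n. ennreal (diameter (C n) powr s))"
  proof -
    obtain c where c: "c > 0" "\<not> (\<exists>C::nat \<Rightarrow> 'a set. E \<subseteq> (\<Union>n. C n) \<and> (\<forall>n. bounded (C n))
        \<and> (\<Sum>n. ennreal (diameter (C n) powr s)) < ennreal c)"
      using assms unfolding null_content_def by blast
    show ?thesis by (rule that[OF c(1)]) (use c(2) not_less in blast)
  qed
  have "c \<le> (\<Sum>k\<in>K. diameter (D k) powr s)"
    if K: "finite K" "E \<subseteq> (\<Union>k\<in>K. D k)" "\<And>k. k \<in> K \<Longrightarrow> bounded (D k)" for K and D :: "'k \<Rightarrow> 'a set"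
  proof -
    obtain h where h: "bij_betw h {0..<card K} K" using ex_bij_betw_nat_finite[OF K(1)] by blast
    \<comment> \<open>Padding with empty sets is free, since \<open>diameter {} = 0\<close> and
      \<open>0 powr s = 0\<close>.\<close>
    define C where "C n = (if n < card K then D (h n) else {})" for n
    have hK: "h n \<in> K" if "n < card K" for n using h that by (auto simp: bij_betw_def)
    have "E \<subseteq> (\<Union>n. C n)"
    proof
      fix x assume "x \<in> E"
      then obtain k where "k \<in> K" "x \<in> D k" using K(2) by blast
      moreover then obtain n where "n < card K" "h n = k" 
        using bij_betw_imp_surj_on[OF h] by (metis imageE atLeastLessThan_iff)
      ultimately have "x \<in> C n" by (simp add: C_def)
      then show "x \<in> (\<Union>n. C n)" by blast
    qed
    moreover have "\<forall>n. bounded (C n)" using K(3) hK by (simp add: C_def)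
    ultimately have "ennreal c \<le> (\<Sum>n. ennreal (diameter (C n) powr s))" by (rule c(2))
    also have "\<dots> = (\<Sum>n\<in>{0..<card K}. ennreal (diameter (C n) powr s))"
      by (rule suminf_finite) (auto simp: C_def)
    also have "\<dots> = ennreal (\<Sum>n\<in>{0..<card K}. diameter (C n) powr s)"
      by (simp add: sum_ennreal)
    also have "(\<Sum>n\<in>{0..<card K}. diameter (C n) powr s) = (\<Sum>n\<in>{0..<card K}. diameter (D (h n)) powr s)"
      by (intro sum.cong) (auto simp: C_def)
    also have "\<dots> = (\<Sum>k\<in>K. diameter (D k) powr s)"
      by (rule sum.reindex_bij_betw[OF h])
    finally show ?thesis by (simp add: ennreal_le_iff sum_nonneg)
  qed
  then show ?thesis using that c(1) by blast
qed

text \<open>The removed set is the support of the content on \<open>E\<close>. Each remaining point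
  has a ball meeting \<open>E\<close> in a null set, and by Lindelof's theorem countably many such
  balls suffice.\<close>

lemma null_content_outside_support:
  fixes E :: "'a::euclidean_space set"
  shows "null_content s (E - {x \<in> E. \<forall>r>0. \<not> null_content s (E \<inter> cball x r)})"
proof -
  let ?S = "{x \<in> E. \<forall>r>0. \<not> null_content s (E \<inter> cball x r)}"
  let ?F = "{ball x r | x r. null_content s (E \<inter> cball x r)}"
  obtain F where F: "F \<subseteq> ?F" "countable F" "\<Union>F = \<Union>?F"
    using Lindelof[of ?F] by (auto simp: Setcompr_eq_image)
  have "null_content s (\<Union>((\<lambda>B. E \<inter> B) ` F))"
  proof (rule null_content_Union)
    fix A assume "A \<in> (\<lambda>B. E \<inter> B) ` F"
    then obtain x r where "A = E \<inter> ball x r" "null_content s (E \<inter> cball x r)" using F(1) by blast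
    then show "null_content s A" by (auto intro: null_content_subset)
  qed (use F(2) in auto)
  moreover have "E - ?S \<subseteq> \<Union>((\<lambda>B. E \<inter> B) ` F)"
  proof
    fix x assume x: "x \<in> E - ?S"
    then obtain r where "r > 0" "null_content s (E \<inter> cball x r)" by blast
    then have "ball x r \<in> ?F" "x \<in> ball x r" by auto
    then have "x \<in> \<Union>F" unfolding F(3) by (rule UnionI)
    then obtain B where "B \<in> F" "x \<in> B" by (rule UnionE)
    moreover have "x \<in> E" using x by simp
    ultimately show "x \<in> \<Union>((\<lambda>B. E \<inter> B) ` F)" by (intro UnionI[of "E \<inter> B"] imageI IntI)
  qed
  ultimately show ?thesis by (rule null_content_subset)
qed

lemma diameter_le_bound:
  fixes S :: "'a::metric_space set"
  assumes "d \<ge> 0" "\<And>x y. x \<in> S \<Longrightarrow> y \<in> S \<Longrightarrow> dist x y \<le> d"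
  shows "diameter S \<le> d"
  using assms by (cases "S = {}") (auto simp: diameter_def intro!: cSUP_least)

text \<open>In orthonormal coordinates along V, a grid of mesh 1/N splits \<open>E\<close> into
  O(N^k) cells of diameter at most k/N, where k = dim V. Their total cost O(N^(k - s)) tends to 0,
  contradicting a positive lower bound for all covers. Only directions of V are discretised, so the
  count involves dim V and not the ambient dimension.\<close>

lemma null_content_affine:
  fixes E V :: "'a::euclidean_space set"
  assumes "bounded E" "subspace V" "E \<subseteq> (+) a ` V" "real (dim V) < s"
  shows "null_content s E"
proof (rule ccontr)
  assume not_null: "\<not> null_content s E"
  obtain B where B: "B \<subseteq> V" "pairwise orthogonal B" "\<And>x. x \<in> B \<Longrightarrow> norm x = 1"
      "independent B" "card B = dim V" "span B = V"
    using orthonormal_basis_subspace[OF assms(2)] by metis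
  have fin: "finite B" using B(4) by (simp add: independent_imp_finite)
  have repr: "v = (\<Sum>b\<in>B. (v \<bullet> b) *\<^sub>R b)" if "v \<in> V" for v
  proof -
    have "v \<in> span B" using that B(6) by simp
    then have "v \<in> range (\<lambda>f. \<Sum>b\<in>B. f b *\<^sub>R b)" by (simp only: span_finite[OF fin])
    then obtain f where f: "v = (\<Sum>b\<in>B. f b *\<^sub>R b)" by (rule rangeE)
    have "v \<bullet> b = f b" if "b \<in> B" for b
    proof -
      have "v \<bullet> b = (\<Sum>c\<in>B. f c * (c \<bullet> b))" by (simp add: f inner_sum_left)
      also have "\<dots> = (\<Sum>c\<in>B. if c = b then f b else 0)"
        using B(2,3) that by (intro sum.cong) (auto simp: pairwise_def orthogonal_def dot_square_norm)
      finally show ?thesis using that fin by simp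
    qed
    then show ?thesis using f by simp
  qed
  obtain c where c: "c > 0" "\<And>K (D :: ('a \<Rightarrow> int) \<Rightarrow> 'a set). finite K \<Longrightarrow> E \<subseteq> (\<Union>k\<in>K. D k) \<Longrightarrow> (\<And>k. k \<in> K \<Longrightarrow> bounded (D k))
     \<Longrightarrow> c \<le> (\<Sum>k\<in>K. diameter (D k) powr s)"
    using finite_cover_lower_bound[OF not_null] by metis
  obtain R where R: "R > 0" "\<And>x. x \<in> E \<Longrightarrow> norm (x - a) \<le> R"
  proof -
    obtain R where "\<And>x. x \<in> E \<Longrightarrow> norm x \<le> R" using assms(1) bounded_iff by blast
    then have "norm (x - a) \<le> \<bar>R\<bar> + norm a + 1" if "x \<in> E" for x
      using norm_triangle_ineq4[of x a] that by fastforce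
    moreover have "\<bar>R\<bar> + norm a + 1 > 0" using norm_ge_zero[of a] by linarith
    ultimately show ?thesis using that by blast
  qed
  let ?k = "card B"
  have s: "s > 0" using assms(4) by (simp add: le_less_trans[rotated])
  have bound: "c \<le> (2 * R + 5) ^ ?k * real ?k powr s * real N powr (real ?k - s)" if N: "N \<ge> 1" for N :: nat
  proof -
    define M where "M = \<lceil>R * N\<rceil> + 1"
    define K where "K = PiE B (\<lambda>_. {-M..M})"
    define D where "D \<phi> = {x \<in> E. \<forall>b\<in>B. \<lfloor>N * ((x - a) \<bullet> b)\<rfloor> = \<phi> b}" for \<phi>
    have "finite K" unfolding K_def using fin by (intro finite_PiE) auto
    moreover have "E \<subseteq> (\<Union>k\<in>K. D k)"
    proof
      fix x assume x: "x \<in> E"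
      define \<phi> where "\<phi> = restrict (\<lambda>b. \<lfloor>N * ((x - a) \<bullet> b)\<rfloor>) B"
      have "\<lfloor>N * ((x - a) \<bullet> b)\<rfloor> \<in> {-M..M}" if "b \<in> B" for b
      proof -
        have "\<bar>(x - a) \<bullet> b\<bar> \<le> R"
          using Cauchy_Schwarz_ineq2[of "x - a" b] B(3)[OF that] R(2)[OF x] by simp
        then have "N * \<bar>(x - a) \<bullet> b\<bar> \<le> N * R" by (intro mult_left_mono) auto
        then have "\<bar>N * ((x - a) \<bullet> b)\<bar> \<le> R * N" by (simp add: abs_mult mult.commute)
        then show ?thesis unfolding M_def by (simp; linarith)
      qed
      then have "\<phi> \<in> K" by (auto simp: K_def \<phi>_def)
      moreover have "x \<in> D \<phi>" using x by (simp add: D_def \<phi>_def)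
      ultimately show "x \<in> (\<Union>k\<in>K. D k)" by blast
    qed
    moreover have "bounded (D k)" for k
      by (rule bounded_subset[OF assms(1)]) (auto simp: D_def)
    ultimately have "c \<le> (\<Sum>k\<in>K. diameter (D k) powr s)" by (rule c(2))
    also have "\<dots> \<le> (\<Sum>k\<in>K. (?k / N) powr s)"
    proof (intro sum_mono powr_mono2 diameter_le_bound)
      fix \<phi> x y assume x: "x \<in> D \<phi>" and y: "y \<in> D \<phi>"
      have "x - a \<in> V" "y - a \<in> V" using x y assms(3) by (auto simp: D_def)
      then have "x - y \<in> V" using subspace_diff[OF assms(2), of "x - a" "y - a"] by simp
      then have "dist x y = norm (\<Sum>b\<in>B. ((x - y) \<bullet> b) *\<^sub>R b)" using repr by (simp add: dist_norm)
      also have "\<dots> \<le> (\<Sum>b\<in>B. norm (((x - y) \<bullet> b) *\<^sub>R b))" by (rule norm_sum)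
      also have "\<dots> \<le> (\<Sum>b\<in>B. 1 / N)"
      proof (rule sum_mono)
        fix b assume b: "b \<in> B"
        have "\<lfloor>N * ((x - a) \<bullet> b)\<rfloor> = \<lfloor>N * ((y - a) \<bullet> b)\<rfloor>" using x y b by (simp add: D_def)
        then have "\<bar>N * ((x - a) \<bullet> b) - N * ((y - a) \<bullet> b)\<bar> \<le> 1" by linarith
        moreover have "N * ((x - a) \<bullet> b) - N * ((y - a) \<bullet> b) = N * ((x - y) \<bullet> b)" by (simp add: algebra_simps)
        ultimately have "N * \<bar>(x - y) \<bullet> b\<bar> \<le> 1" by (simp add: abs_mult)
        then show "norm (((x - y) \<bullet> b) *\<^sub>R b) \<le> 1 / N" using B(3)[OF b] N by (simp add: field_simps)
      qed
      finally show "dist x y \<le> ?k / N" by simp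
    qed (use s in \<open>auto simp: D_def diameter_ge_0 bounded_subset[OF assms(1)]\<close>)
    also have "\<dots> = real (card K) * (?k / N) powr s" by simp
    also have "real (card K) = (2 * real_of_int M + 1) ^ ?k"
    proof -
      have "0 \<le> R * N" using R(1) by simp
      then have "M \<ge> 0" unfolding M_def by linarith
      have "card K = (nat (2 * M + 1)) ^ ?k" using \<open>M \<ge> 0\<close> by (simp add: K_def card_PiE[OF fin])
      then show ?thesis using \<open>M \<ge> 0\<close> by simp
    qed
    also have "(2 * real_of_int M + 1) ^ ?k \<le> ((2 * R + 5) * N) ^ ?k"
    proof (rule power_mono)
      have "real_of_int M \<le> R * N + 2" unfolding M_def by linarith
      then have "2 * real_of_int M + 1 \<le> 2 * (R * N) + 5 * 1" by linarith
      also have "\<dots> \<le> 2 * (R * N) + 5 * N" using N by (intro add_left_mono mult_left_mono) auto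
      finally show "2 * real_of_int M + 1 \<le> (2 * R + 5) * N" by (simp add: algebra_simps)
      have "R * N \<ge> 0" using R(1) by simp
      then have "0 \<le> M" unfolding M_def by linarith
      then show "0 \<le> 2 * real_of_int M + 1" by simp
    qed
    also have "((2 * R + 5) * N) ^ ?k * (?k / N) powr s = (2 * R + 5) ^ ?k * real ?k powr s * (real N powr ?k * real N powr (- s))"
    proof -
      have "(?k / N) powr s = real ?k powr s * real N powr (- s)"
        using N by (simp add: powr_divide powr_minus_divide)
      moreover have "((2 * R + 5) * N) ^ ?k = (2 * R + 5) ^ ?k * real N powr ?k"
        using N unfolding power_mult_distrib by (simp add: powr_realpow)
      ultimately show ?thesis by (simp only: mult_ac)
    qed
    also have "real N powr ?k * real N powr (- s) = real N powr (real ?k - s)" by (simp flip: powr_add)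
    finally show ?thesis by (simp add: mult_right_mono)
  qed
  have "(\<lambda>N. (2 * R + 5) ^ ?k * real ?k powr s * real N powr (real ?k - s)) \<longlonglongrightarrow> (2 * R + 5) ^ ?k * real ?k powr s * 0"
    using assms(4) B(5) by (intro tendsto_mult_left tendsto_neg_powr filterlim_real_sequentially) auto
  then have "c \<le> (2 * R + 5) ^ ?k * real ?k powr s * 0"
    by (rule LIMSEQ_le_const) (use bound in blast)
  then show False using c(1) by simp
qed

section \<open>Discrete Frostman weights and their energies\<close>

text \<open>Frostman's construction on finitely many points, with cells given by labels
  \<open>cl k\<close> and quotas \<open>q k\<close>. From fine to coarse, every cell above its quota
  is scaled down to it. Scaling only decreases the finer sums, so the earlier bounds survive. A
  scaled cell is saturated at the current level, and in an unscaled cell all earlier saturations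
  persist.\<close>

lemma saturated_weights:
  fixes cl :: "nat \<Rightarrow> 'a \<Rightarrow> 'c" and q :: "nat \<Rightarrow> real"
  assumes X: "finite X" and refine: "\<And>k x y. cl (Suc k) x = cl (Suc k) y \<Longrightarrow> cl k x = cl k y"
    and q: "\<And>k. q k > 0"
  obtains \<mu> where "\<And>x. \<mu> x \<ge> 0" "\<And>k x. k \<le> n \<Longrightarrow> x \<in> X \<Longrightarrow> sum \<mu> {y\<in>X. cl k y = cl k x} \<le> q k"
    "\<And>x. x \<in> X \<Longrightarrow> \<exists>k\<le>n. sum \<mu> {y\<in>X. cl k y = cl k x} = q k"
proof -
  have refine': "cl j x = cl j y" if "j \<le> k" "cl k x = cl k y" for j k x y
    using that by (induction k rule: dec_induct) (auto dest: refine)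
  define Q where "Q m \<mu> \<longleftrightarrow> (\<forall>x. \<mu> x \<ge> 0) \<and> (\<forall>k x. m \<le> k \<longrightarrow> k \<le> n \<longrightarrow> x \<in> X \<longrightarrow> sum \<mu> {y\<in>X. cl k y = cl k x} \<le> q k)
    \<and> (\<forall>x\<in>X. \<exists>k\<le>n. m \<le> k \<and> sum \<mu> {y\<in>X. cl k y = cl k x} = q k)" for m and \<mu> :: "'a \<Rightarrow> real"
  have "\<exists>\<mu>. Q 0 \<mu>"
  proof (rule inc_induct[of 0 n "\<lambda>m. \<exists>\<mu>. Q m \<mu>"])
    \<comment> \<open>At the finest level the quota is spread evenly over each cell, so every point
      starts saturated.\<close>
    define \<mu> where "\<mu> x = q n / card {y\<in>X. cl n y = cl n x}" for x
    have "sum \<mu> {y\<in>X. cl n y = cl n x} = q n" if "x \<in> X" for x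
    proof -
      have "sum \<mu> {y\<in>X. cl n y = cl n x} = (\<Sum>y\<in>{y\<in>X. cl n y = cl n x}. q n / card {y\<in>X. cl n y = cl n x})"
        by (intro sum.cong refl) (simp add: \<mu>_def)
      also have "card {y\<in>X. cl n y = cl n x} \<noteq> 0" using X that by auto
      then have "(\<Sum>y\<in>{y\<in>X. cl n y = cl n x}. q n / card {y\<in>X. cl n y = cl n x}) = q n" by simp
      finally show ?thesis .
    qed
    moreover have "\<mu> x \<ge> 0" for x using q[of n] by (simp add: \<mu>_def)
    ultimately have "Q n \<mu>" unfolding Q_def by auto
    then show "\<exists>\<mu>. Q n \<mu>" by (intro exI[of _ \<mu>])
  next
    fix m assume m: "m < n" and "\<exists>\<mu>. Q (Suc m) \<mu>"
    then obtain \<mu> where "Q (Suc m) \<mu>" by blast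
    then have \<mu>: "\<And>x. \<mu> x \<ge> 0" "\<And>k x. Suc m \<le> k \<Longrightarrow> k \<le> n \<Longrightarrow> x \<in> X \<Longrightarrow> sum \<mu> {y\<in>X. cl k y = cl k x} \<le> q k"
      "\<And>x. x \<in> X \<Longrightarrow> \<exists>k\<le>n. Suc m \<le> k \<and> sum \<mu> {y\<in>X. cl k y = cl k x} = q k"
      unfolding Q_def by blast+
    define M where "M x = sum \<mu> {y\<in>X. cl m y = cl m x}" for x
    \<comment> \<open>The factor is constant on cells of level m, hence on all finer cells, and
      therefore multiplies their sums.\<close>
    define f where "f x = (if M x \<le> q m then 1 else q m / M x)" for x
    have f: "0 < f x" "f x \<le> 1" for x
    proof -
      have "0 < f x \<and> f x \<le> 1"
      proof (cases "M x \<le> q m")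
        case False
        then have "q m < M x" "0 < M x" using q[of m] by linarith+
        then show ?thesis using q[of m] by (simp add: f_def)
      qed (simp add: f_def)
      then show "0 < f x" "f x \<le> 1" by blast+
    qed
    define \<nu> where "\<nu> x = f x * \<mu> x" for x
    have sum_\<nu>: "sum \<nu> {y\<in>X. cl k y = cl k x} = f x * sum \<mu> {y\<in>X. cl k y = cl k x}" if "m \<le> k" for k x
    proof -
      have "\<nu> y = f x * \<mu> y" if "y \<in> {y\<in>X. cl k y = cl k x}" for y
      proof -
        have "cl m y = cl m x" by (rule refine'[OF \<open>m \<le> k\<close>]) (use that in simp)
        then show ?thesis by (simp only: \<nu>_def f_def M_def)
      qed
      then show ?thesis unfolding sum_distrib_left by (intro sum.cong refl)
    qed
    have level_m: "sum \<nu> {y\<in>X. cl m y = cl m x} = min (M x) (q m)" for x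
      using sum_\<nu>[of m x] q[of m] unfolding M_def[symmetric] by (auto simp: f_def)
    have "sum \<nu> {y\<in>X. cl k y = cl k x} \<le> q k" if "m \<le> k" "k \<le> n" "x \<in> X" for k x
    proof (cases "k = m")
      case False
      then have "sum \<mu> {y\<in>X. cl k y = cl k x} \<le> q k" using \<mu>(2) that by auto
      moreover have "f x * sum \<mu> {y\<in>X. cl k y = cl k x} \<le> 1 * sum \<mu> {y\<in>X. cl k y = cl k x}"
        using f(2) \<mu>(1) by (intro mult_right_mono sum_nonneg) auto
      ultimately show ?thesis using sum_\<nu>[OF that(1)] by simp
    qed (simp add: level_m)
    moreover have "\<exists>k\<le>n. m \<le> k \<and> sum \<nu> {y\<in>X. cl k y = cl k x} = q k" if "x \<in> X" for x
    proof (cases "M x \<le> q m")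
      case True
      then have "f x = 1" by (simp add: f_def)
      moreover obtain k where "k \<le> n" "Suc m \<le> k" "sum \<mu> {y\<in>X. cl k y = cl k x} = q k" using \<mu>(3)[OF \<open>x \<in> X\<close>] by blast
      ultimately show ?thesis using sum_\<nu>[of k x] by (intro exI[of _ k]) simp
    next
      case False
      then show ?thesis using level_m[of x] m by (intro exI[of _ m]) simp
    qed
    moreover have "\<nu> x \<ge> 0" for x using f(1)[of x] \<mu>(1)[of x] by (simp add: \<nu>_def)
    ultimately have "Q m \<nu>" unfolding Q_def by blast
    then show "\<exists>\<mu>. Q m \<mu>" by (intro exI[of _ \<nu>])
  qed simp
  then obtain \<mu> where \<mu>: "Q 0 \<mu>" by blast
  show ?thesis
    by (rule that[of \<mu>]; use \<mu> in \<open>simp only: Q_def\<close>; blast)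
qed

text \<open>The cells of level \<open>k\<close> at which a point is saturated for the first time are disjoint and
  cover; this turns a lower bound on the cost of covers into a lower bound on the total weight.\<close>

lemma frostman_discrete:
  fixes E :: "'a::euclidean_space set"
  assumes "bounded E" "\<not> null_content s E" "s > 0"
  obtains C where "C > 0" "\<And>n. \<exists>X \<mu>. finite X \<and> X \<subseteq> E \<and> (\<forall>x. \<mu> x \<ge> 0) \<and> sum \<mu> X = (1::real) \<and>
     (\<forall>k\<le>n. \<forall>x\<in>X. sum \<mu> {y\<in>X. dist x y \<le> 1 / 2 ^ k} \<le> C * (1 / 2 ^ k) powr s)"
proof -
  let ?d = "DIM('a)"
  \<comment> \<open>The label of the half-open dyadic cube of side 2^(-k) that contains x.\<close>
  define cl :: "nat \<Rightarrow> 'a \<Rightarrow> 'a \<Rightarrow> int" where "cl k x = restrict (\<lambda>b. \<lfloor>2 ^ k * (x \<bullet> b)\<rfloor>) Basis" for k x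
  define q :: "nat \<Rightarrow> real" where "q k = (1 / 2 ^ k) powr s" for k
  have q: "q k > 0" for k by (simp add: q_def)
  have cl_iff: "cl k x = cl k y \<longleftrightarrow> (\<forall>b\<in>Basis. \<lfloor>2 ^ k * (x \<bullet> b)\<rfloor> = \<lfloor>2 ^ k * (y \<bullet> b)\<rfloor>)" for k x y
    unfolding cl_def by (auto simp: restrict_def fun_eq_iff)
  have refine: "cl k x = cl k y" if "cl (Suc k) x = cl (Suc k) y" for k x y
  proof -
    have half: "\<lfloor>2 ^ k * v\<rfloor> = \<lfloor>2 ^ Suc k * v\<rfloor> div 2" for v :: real
      using floor_divide_real_eq_div[of 2 "2 ^ Suc k * v"] by simp
    show ?thesis unfolding cl_iff
    proof
      fix b :: 'a assume "b \<in> Basis"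
      then have "\<lfloor>2 ^ Suc k * (x \<bullet> b)\<rfloor> = \<lfloor>2 ^ Suc k * (y \<bullet> b)\<rfloor>" using that unfolding cl_iff by blast
      then show "\<lfloor>2 ^ k * (x \<bullet> b)\<rfloor> = \<lfloor>2 ^ k * (y \<bullet> b)\<rfloor>"
        unfolding half[of "x \<bullet> b"] half[of "y \<bullet> b"] by (rule arg_cong)
    qed
  qed
  have refine': "cl j x = cl j y" if "j \<le> k" "cl k x = cl k y" for j k x y
    using that by (induction k rule: dec_induct) (auto dest: refine)
  have cl_dist: "dist x y \<le> ?d * (1 / 2 ^ k)" if "cl k x = cl k y" for k x y
  proof -
    have "norm (x - y) \<le> (\<Sum>b\<in>Basis. \<bar>(x - y) \<bullet> b\<bar>)" by (rule norm_le_l1)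
    also have "\<dots> \<le> (\<Sum>b\<in>(Basis::'a set). 1 / 2 ^ k)"
    proof (rule sum_mono)
      fix b :: 'a assume "b \<in> Basis"
      then have "\<lfloor>2 ^ k * (x \<bullet> b)\<rfloor> = \<lfloor>2 ^ k * (y \<bullet> b)\<rfloor>" using that cl_iff by blast
      then have "\<bar>2 ^ k * (x \<bullet> b) - 2 ^ k * (y \<bullet> b)\<bar> \<le> 1" by linarith
      moreover have "2 ^ k * (x \<bullet> b) - 2 ^ k * (y \<bullet> b) = 2 ^ k * ((x - y) \<bullet> b)" by (simp add: algebra_simps)
      ultimately have "2 ^ k * \<bar>(x - y) \<bullet> b\<bar> \<le> 1" by (simp add: abs_mult)
      then show "\<bar>(x - y) \<bullet> b\<bar> \<le> 1 / 2 ^ k" by (simp add: field_simps)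
    qed
    finally show ?thesis by (simp add: dist_norm)
  qed
  have fin_cl: "finite (cl k ` E)" for k
  proof -
    obtain R where R: "\<And>x. x \<in> E \<Longrightarrow> norm x \<le> R" using assms(1) bounded_iff by blast
    have "cl k ` E \<subseteq> PiE Basis (\<lambda>_. {- \<lceil>2 ^ k * R\<rceil> - 1..\<lceil>2 ^ k * R\<rceil> + 1})"
    proof (rule image_subsetI)
      fix x assume x: "x \<in> E"
      have "\<lfloor>2 ^ k * (x \<bullet> b)\<rfloor> \<in> {- \<lceil>2 ^ k * R\<rceil> - 1..\<lceil>2 ^ k * R\<rceil> + 1}" if "b \<in> Basis" for b
      proof -
        have "\<bar>x \<bullet> b\<bar> \<le> R" using Basis_le_norm[OF that, of x] R[OF x] by linarith
        then have "2 ^ k * \<bar>x \<bullet> b\<bar> \<le> 2 ^ k * R" by (intro mult_left_mono) auto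
        then have "\<bar>2 ^ k * (x \<bullet> b)\<bar> \<le> 2 ^ k * R" by (simp add: abs_mult)
        then show ?thesis unfolding atLeastAtMost_iff by linarith
      qed
      then show "cl k x \<in> PiE Basis (\<lambda>_. {- \<lceil>2 ^ k * R\<rceil> - 1..\<lceil>2 ^ k * R\<rceil> + 1})" by (simp add: cl_def)
    qed
    then show ?thesis by (rule finite_subset) (intro finite_PiE; simp)
  qed
  obtain c where c: "c > 0" "\<And>K (D :: nat \<times> ('a \<Rightarrow> int) \<Rightarrow> 'a set). finite K \<Longrightarrow> E \<subseteq> (\<Union>k\<in>K. D k) \<Longrightarrow> (\<And>k. k \<in> K \<Longrightarrow> bounded (D k))
     \<Longrightarrow> c \<le> (\<Sum>k\<in>K. diameter (D k) powr s)"
    using finite_cover_lower_bound[OF assms(2)] by metis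
  \<comment> \<open>A ball of radius 2^(-k) meets at most 3^d cells of level k. The factor d^s / c
    is the reciprocal of the lower bound for the total weight: d comes from the diameter of a unit
    cube, c from the cost of covers.\<close>
  define C where "C = 3 ^ ?d * (real ?d powr s / c)"
  have d0: "real ?d powr s > 0" by simp
  have C: "C > 0" using c(1) d0 by (simp add: C_def)
  have "\<exists>X \<mu>. finite X \<and> X \<subseteq> E \<and> (\<forall>x. \<mu> x \<ge> 0) \<and> sum \<mu> X = (1::real) \<and>
     (\<forall>k\<le>n. \<forall>x\<in>X. sum \<mu> {y\<in>X. dist x y \<le> 1 / 2 ^ k} \<le> C * (1 / 2 ^ k) powr s)" for n
  proof -
    \<comment> \<open>One representative in each finest cell that meets \<open>E\<close>; thus the
      weights sit on finitely many points of \<open>E\<close>, and X still detects every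
      cell.\<close>
    obtain X where X: "X \<subseteq> E" "inj_on (cl n) X" "cl n ` X = cl n ` E"
      using subset_image_inj[of "cl n ` E" "cl n" E] by auto
    have finX: "finite X" using fin_cl[of n] X(2,3) finite_imageD by metis
    obtain \<mu> where \<mu>: "\<And>x. \<mu> x \<ge> 0" "\<And>k x. k \<le> n \<Longrightarrow> x \<in> X \<Longrightarrow> sum \<mu> {y\<in>X. cl k y = cl k x} \<le> q k"
      "\<And>x. x \<in> X \<Longrightarrow> \<exists>k\<le>n. sum \<mu> {y\<in>X. cl k y = cl k x} = q k"
      using saturated_weights[of X cl q n, OF finX refine q] by blast
    define sat where "sat k x \<longleftrightarrow> sum \<mu> {y\<in>X. cl k y = cl k x} = q k" for k x
    define \<kappa> where "\<kappa> x = (LEAST k. sat k x)" for x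
    have \<kappa>: "sat (\<kappa> x) x" "\<kappa> x \<le> n" if "x \<in> X" for x
    proof -
      obtain k where "k \<le> n" "sat k x" using \<mu>(3)[OF \<open>x \<in> X\<close>] by (auto simp: sat_def)
      then show "sat (\<kappa> x) x" "\<kappa> x \<le> n" unfolding \<kappa>_def
        by (auto intro: LeastI order.trans[OF Least_le])
    qed
    define h where "h x = (\<kappa> x, cl (\<kappa> x) x)" for x
    \<comment> \<open>At levels up to \<open>\<kappa> x\<close>, saturation depends only on the cell
      of x at level \<open>\<kappa> x\<close>. All points of that cell in X share the same first
      saturated level, so these cells are the fibres of \<open>h\<close> and are disjoint.\<close>
    have cell: "{y\<in>X. cl (\<kappa> x) y = cl (\<kappa> x) x} = {y\<in>X. h y = h x}" if "x \<in> X" for x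
    proof -
      have "\<kappa> y = \<kappa> x" if "y \<in> X" "cl (\<kappa> x) y = cl (\<kappa> x) x" for y
      proof -
        have same: "sat j y \<longleftrightarrow> sat j x" if "j \<le> \<kappa> x" for j
          using refine'[OF that \<open>cl (\<kappa> x) y = cl (\<kappa> x) x\<close>] by (simp add: sat_def)
        show ?thesis unfolding \<kappa>_def[of y]
        proof (rule Least_equality)
          show "sat (\<kappa> x) y" using same \<kappa>[OF \<open>x \<in> X\<close>] by simp
          fix j assume "sat j y"
          show "\<kappa> x \<le> j"
          proof (rule ccontr)
            assume "\<not> \<kappa> x \<le> j"
            then have "sat j x" using same[of j] \<open>sat j y\<close> by simp
            then have "\<kappa> x \<le> j" unfolding \<kappa>_def by (rule Least_le)
            then show False using \<open>\<not> \<kappa> x \<le> j\<close> by simp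
          qed
        qed
      qed
      then show ?thesis by (auto simp: h_def)
    qed
    \<comment> \<open>The same cells taken inside \<open>E\<close> instead of X, because the cost
      bound concerns covers of \<open>E\<close>.\<close>
    define D where "D kc = {y\<in>E. cl (fst kc) y = snd kc}" for kc :: "nat \<times> ('a \<Rightarrow> int)"
    have "c \<le> (\<Sum>kc\<in>h ` X. diameter (D kc) powr s)"
    proof (rule c(2))
      show "E \<subseteq> (\<Union>kc\<in>h ` X. D kc)"
      proof
        fix y assume y: "y \<in> E"
        then have "cl n y \<in> cl n ` X" using X(3) by blast
        then obtain x where x: "x \<in> X" "cl n y = cl n x" by blast
        then have "cl (\<kappa> x) y = cl (\<kappa> x) x" using refine' \<kappa>(2) by blast
        then have "y \<in> D (h x)" using y by (simp add: D_def h_def)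
        then show "y \<in> (\<Union>kc\<in>h ` X. D kc)" using x by blast
      qed
      show "bounded (D kc)" for kc by (rule bounded_subset[OF assms(1)]) (auto simp: D_def)
    qed (use finX in simp)
    also have "\<dots> \<le> (\<Sum>kc\<in>h ` X. real ?d powr s * sum \<mu> {y\<in>X. h y = kc})"
    proof (rule sum_mono)
      fix kc assume "kc \<in> h ` X"
      then obtain x where x: "x \<in> X" "kc = h x" by blast
      have "diameter (D kc) \<le> ?d * (1 / 2 ^ \<kappa> x)"
      proof (rule diameter_le_bound)
        fix y z assume "y \<in> D kc" "z \<in> D kc"
        then have "cl (\<kappa> x) y = cl (\<kappa> x) z" by (simp add: D_def x(2) h_def)
        then show "dist y z \<le> ?d * (1 / 2 ^ \<kappa> x)" by (rule cl_dist)
      qed simp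
      moreover have "bounded (D kc)" by (rule bounded_subset[OF assms(1)]) (auto simp: D_def)
      ultimately have "diameter (D kc) powr s \<le> (?d * (1 / 2 ^ \<kappa> x)) powr s"
        using assms(3) by (intro powr_mono2 diameter_ge_0) simp_all
      also have "\<dots> = real ?d powr s * q (\<kappa> x)" unfolding q_def by (rule powr_mult)
      also have "q (\<kappa> x) = sum \<mu> {y\<in>X. h y = kc}" using \<kappa>(1)[OF x(1)] cell[OF x(1)] x(2) by (simp add: sat_def)
      finally show "diameter (D kc) powr s \<le> real ?d powr s * sum \<mu> {y\<in>X. h y = kc}" .
    qed
    also have "\<dots> = real ?d powr s * sum \<mu> X"
      unfolding sum_distrib_left[symmetric] using sum.image_gen[OF finX, of \<mu> h] by simp
    finally have total: "c / real ?d powr s \<le> sum \<mu> X" using d0 by (simp add: field_simps)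
    then have pos: "sum \<mu> X > 0" using c(1) d0 by (smt (verit) divide_pos_pos)
    define \<nu> where "\<nu> x = \<mu> x / sum \<mu> X" for x
    have "sum \<nu> X = 1" using pos by (simp add: \<nu>_def flip: sum_divide_distrib)
    moreover have "sum \<nu> {y\<in>X. dist x y \<le> 1 / 2 ^ k} \<le> C * (1 / 2 ^ k) powr s" if "k \<le> n" "x \<in> X" for k x
    proof -
      let ?S = "{y\<in>X. dist x y \<le> 1 / 2 ^ k}"
      have finS: "finite ?S" using finX by simp
      have sub: "cl k ` ?S \<subseteq> PiE Basis (\<lambda>b. {\<lfloor>2 ^ k * (x \<bullet> b)\<rfloor> - 1..\<lfloor>2 ^ k * (x \<bullet> b)\<rfloor> + 1})"
      proof (rule image_subsetI)
        fix y assume y: "y \<in> ?S"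
        have "\<lfloor>2 ^ k * (y \<bullet> b)\<rfloor> \<in> {\<lfloor>2 ^ k * (x \<bullet> b)\<rfloor> - 1..\<lfloor>2 ^ k * (x \<bullet> b)\<rfloor> + 1}" if "b \<in> Basis" for b
        proof -
          have "\<bar>(x - y) \<bullet> b\<bar> \<le> 1 / 2 ^ k"
            using Basis_le_norm[OF that, of "x - y"] y by (simp add: dist_norm)
          then have "2 ^ k * \<bar>(x - y) \<bullet> b\<bar> \<le> 1" by (simp add: field_simps)
          then have "\<bar>2 ^ k * ((x - y) \<bullet> b)\<bar> \<le> 1" by (simp add: abs_mult)
          moreover have "2 ^ k * (x \<bullet> b) - 2 ^ k * (y \<bullet> b) = 2 ^ k * ((x - y) \<bullet> b)" by (simp add: algebra_simps)
          ultimately show ?thesis unfolding atLeastAtMost_iff by linarith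
        qed
        then show "cl k y \<in> PiE Basis (\<lambda>b. {\<lfloor>2 ^ k * (x \<bullet> b)\<rfloor> - 1..\<lfloor>2 ^ k * (x \<bullet> b)\<rfloor> + 1})" by (simp add: cl_def)
      qed
      have "card (cl k ` ?S) \<le> card (PiE (Basis::'a set) (\<lambda>b. {\<lfloor>2 ^ k * (x \<bullet> b)\<rfloor> - 1..\<lfloor>2 ^ k * (x \<bullet> b)\<rfloor> + 1}))"
        by (rule card_mono[OF _ sub]) (intro finite_PiE; simp)
      also have "\<dots> = 3 ^ ?d" by (simp add: card_PiE)
      finally have card: "card (cl k ` ?S) \<le> 3 ^ ?d" .
      have "sum \<mu> ?S = (\<Sum>\<phi>\<in>cl k ` ?S. sum \<mu> {y\<in>?S. cl k y = \<phi>})" by (rule sum.image_gen[OF finS])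
      also have "\<dots> \<le> (\<Sum>\<phi>\<in>cl k ` ?S. q k)"
      proof (rule sum_mono)
        fix \<phi> assume "\<phi> \<in> cl k ` ?S"
        then obtain z where z: "z \<in> X" "\<phi> = cl k z" by blast
        have "sum \<mu> {y\<in>?S. cl k y = \<phi>} \<le> sum \<mu> {y\<in>X. cl k y = cl k z}"
          using finX \<mu>(1) z(2) by (intro sum_mono2) auto
        then show "sum \<mu> {y\<in>?S. cl k y = \<phi>} \<le> q k" using \<mu>(2)[OF that(1) z(1)] by linarith
      qed
      also have "\<dots> = real (card (cl k ` ?S)) * q k" by simp
      also have "\<dots> \<le> 3 ^ ?d * q k"
      proof -
        have "real (card (cl k ` ?S)) \<le> real (3 ^ ?d)" using card by (rule of_nat_mono)
        then show ?thesis using q[of k] by (intro mult_right_mono) auto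
      qed
      finally have 1: "sum \<mu> ?S \<le> 3 ^ ?d * q k" .
      have "sum \<nu> ?S = sum \<mu> ?S / sum \<mu> X" by (simp add: \<nu>_def flip: sum_divide_distrib)
      also have "\<dots> \<le> (3 ^ ?d * q k) / (c / real ?d powr s)"
        using total pos c(1) d0 q[of k] by (intro frac_le 1) auto
      also have "\<dots> = C * (1 / 2 ^ k) powr s" by (simp add: C_def q_def)
      finally show ?thesis .
    qed
    moreover have "\<nu> x \<ge> 0" for x using \<mu>(1)[of x] pos by (simp add: \<nu>_def)
    ultimately show ?thesis using finX X(1) by (intro exI[of _ X] exI[of _ \<nu>]) simp
  qed
  then show ?thesis using that C by blast
qed

lemma dyadic_bracket:
  fixes N :: real
  assumes "N \<ge> 1"
  obtains k :: nat where "2 ^ k \<le> N" "N < 2 ^ Suc k"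
proof -
  define m where "m = (LEAST m. N < 2 ^ m)"
  have ex: "\<exists>m. N < 2 ^ m" using real_arch_pow[of 2 N] by simp
  have m: "N < 2 ^ m" unfolding m_def by (rule LeastI_ex[OF ex])
  have "m \<noteq> 0" using m assms by (intro notI) simp
  then obtain k where k: "m = Suc k" using not0_implies_Suc by blast
  have "\<not> N < 2 ^ k" using not_less_Least[of k "\<lambda>m. N < 2 ^ m"] k unfolding m_def by simp
  then show ?thesis using that[of k] m k by simp
qed

text \<open>Take the least i with \<rho> \<le> 2^i / 2^k. If i > 0, then N \<rho> \<ge> 2^(i-1) and
  the kernel is at most 4^(-(i-1)M); if i = 0, it is at most 1. The radii stop at 1, the largest for
  which ball masses are controlled; beyond it the kernel is below N^(-2M).\<close>

lemma energy_kernel_le: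
  fixes N \<rho> :: real
  assumes "2 ^ k \<le> N" "\<rho> \<ge> 0"
  shows "1 / (1 + (N * \<rho>)\<^sup>2) ^ M
    \<le> (\<Sum>i\<le>k. 4 ^ M / 4 ^ (i * M) * of_bool (\<rho> \<le> 2 ^ i / 2 ^ k)) + 1 / (N\<^sup>2) ^ M"
proof -
  have N: "N > 0" using assms(1) less_le_trans[of 0 "2 ^ k" N] by simp
  have nonneg: "0 \<le> (4::real) ^ M / 4 ^ (i * M) * of_bool (\<rho> \<le> 2 ^ i / 2 ^ k)" for i :: nat by (simp add: of_bool_def)
  have large: "1 / (1 + (N * \<rho>)\<^sup>2) ^ M \<le> 1 / (y\<^sup>2) ^ M" if "0 < y" "y \<le> N * \<rho>" for y
  proof -
    have "y\<^sup>2 \<le> (N * \<rho>)\<^sup>2" using that by (intro power_mono) auto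
    then have "(y\<^sup>2) ^ M \<le> (1 + (N * \<rho>)\<^sup>2) ^ M" by (intro power_mono) auto
    then show ?thesis using that(1) by (intro divide_left_mono mult_pos_pos zero_less_power) (auto simp: add_pos_nonneg)
  qed
  show ?thesis
  proof (cases "\<rho> \<le> 1")
    case False
    then have "N * 1 \<le> N * \<rho>" using N by (intro mult_left_mono) auto
    then have "1 / (1 + (N * \<rho>)\<^sup>2) ^ M \<le> 1 / (N\<^sup>2) ^ M" using N by (intro large) auto
    moreover have "0 \<le> (\<Sum>i\<le>k. (4::real) ^ M / 4 ^ (i * M) * of_bool (\<rho> \<le> 2 ^ i / 2 ^ k))" by (intro sum_nonneg nonneg)
    ultimately show ?thesis by linarith
  next
    case True
    define i where "i = (LEAST i. \<rho> \<le> 2 ^ i / 2 ^ k)"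
    have ex: "\<rho> \<le> 2 ^ k / 2 ^ k" using True by simp
    have i: "\<rho> \<le> 2 ^ i / 2 ^ k" unfolding i_def by (rule LeastI[of _ k]) (rule ex)
    have ik: "i \<le> k" unfolding i_def by (rule Least_le) (rule ex)
    have "1 / (1 + (N * \<rho>)\<^sup>2) ^ M \<le> (4::real) ^ M / 4 ^ (i * M)"
    proof (cases i)
      case 0
      have "1 / (1 + (N * \<rho>)\<^sup>2) ^ M \<le> 1 / 1" by (intro divide_left_mono one_le_power) (auto simp: add_pos_nonneg)
      also have "1 / 1 \<le> (4::real) ^ M" by simp
      finally show ?thesis using 0 by simp
    next
      case (Suc j)
      have "\<not> \<rho> \<le> 2 ^ j / 2 ^ k" using not_less_Least[of j "\<lambda>i. \<rho> \<le> 2 ^ i / 2 ^ k"] Suc unfolding i_def by simp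
      then have "2 ^ j \<le> 2 ^ k * \<rho>" by (simp add: field_simps)
      also have "\<dots> \<le> N * \<rho>" using assms by (intro mult_right_mono) auto
      finally have "1 / (1 + (N * \<rho>)\<^sup>2) ^ M \<le> 1 / ((2 ^ j)\<^sup>2) ^ M" by (intro large) auto
      also have "((2 ^ j)\<^sup>2) ^ M = (4::real) ^ (j * M)"
      proof -
        have "((2::real) ^ j)\<^sup>2 = (2\<^sup>2) ^ j" by (simp only: power_mult[symmetric] mult.commute)
        then have "((2::real) ^ j)\<^sup>2 = 4 ^ j" by simp
        then show ?thesis by (simp add: power_mult)
      qed
      also have "1 / (4::real) ^ (j * M) = 4 ^ M / 4 ^ (i * M)" by (simp add: Suc power_add)
      finally show ?thesis .
    qed
    also have "\<dots> = 4 ^ M / 4 ^ (i * M) * of_bool (\<rho> \<le> 2 ^ i / 2 ^ k)" using i by simp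
    also have "\<dots> \<le> (\<Sum>i\<le>k. 4 ^ M / 4 ^ (i * M) * of_bool (\<rho> \<le> 2 ^ i / 2 ^ k))"
      by (rule member_le_sum) (use ik nonneg in auto)
    finally show ?thesis using N by (simp add: add_increasing2)
  qed
qed

text \<open>Inserting the ball estimate, the i-th annulus contributes about 4^(-iM) (2^i / N)^s
  \<le> 2^(-i) N^(-s), because s + 1 \<le> 2M. For N \<le> 2^n only radii at least 2^(-n) occur, so
  the atoms of a discretisation at level n do no harm and C is independent of n.\<close>

lemma discrete_energy:
  fixes E :: "'a::euclidean_space set"
  assumes "bounded E" "\<not> null_content s E" "s > 0" and M: "s + 1 \<le> 2 * real M"
  obtains C where "C > 0" "\<And>n. \<exists>X \<mu>. finite X \<and> X \<subseteq> E \<and> (\<forall>x. \<mu> x \<ge> 0) \<and> sum \<mu> X = (1::real) \<and>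
     (\<forall>N. 1 \<le> N \<and> N \<le> 2 ^ n \<longrightarrow> (\<Sum>x\<in>X. \<Sum>y\<in>X. \<mu> x * \<mu> y * (1 / (1 + (N * dist x y)\<^sup>2) ^ M)) \<le> C * N powr (- s))"
proof -
  obtain C0 where C0: "C0 > 0" and fr: "\<And>n. \<exists>X \<mu>. finite X \<and> X \<subseteq> E \<and> (\<forall>x. \<mu> x \<ge> 0) \<and> sum \<mu> X = (1::real) \<and>
     (\<forall>k\<le>n. \<forall>x\<in>X. sum \<mu> {y\<in>X. dist x y \<le> 1 / 2 ^ k} \<le> C0 * (1 / 2 ^ k) powr s)"
    using frostman_discrete[OF assms(1-3)] by blast
  define C where "C = C0 * 4 ^ M * 2 * 2 powr s + 1"
  have C: "C > 0" using C0 by (simp add: C_def add_nonneg_pos)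
  have "\<exists>X \<mu>. finite X \<and> X \<subseteq> E \<and> (\<forall>x. \<mu> x \<ge> 0) \<and> sum \<mu> X = (1::real) \<and>
     (\<forall>N. 1 \<le> N \<and> N \<le> 2 ^ n \<longrightarrow> (\<Sum>x\<in>X. \<Sum>y\<in>X. \<mu> x * \<mu> y * (1 / (1 + (N * dist x y)\<^sup>2) ^ M)) \<le> C * N powr (- s))" for n
  proof -
    obtain X \<mu> where X: "finite X" "X \<subseteq> E" "\<forall>x. \<mu> x \<ge> 0" "sum \<mu> X = (1::real)"
      and ball: "\<And>k x. k \<le> n \<Longrightarrow> x \<in> X \<Longrightarrow> sum \<mu> {y\<in>X. dist x y \<le> 1 / 2 ^ k} \<le> C0 * (1 / 2 ^ k) powr s"
      using fr[of n] by blast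
    have "(\<Sum>x\<in>X. \<Sum>y\<in>X. \<mu> x * \<mu> y * (1 / (1 + (N * dist x y)\<^sup>2) ^ M)) \<le> C * N powr (- s)"
      if N: "1 \<le> N" "N \<le> 2 ^ n" for N
    proof -
      obtain k where k: "2 ^ k \<le> N" "N < 2 ^ Suc k" using dyadic_bracket[OF N(1)] by blast
      have "(2::real) ^ k \<le> 2 ^ n" using k(1) N(2) by linarith
      then have kn: "k \<le> n" by simp
      have inner: "(\<Sum>y\<in>X. \<mu> y * (1 / (1 + (N * dist x y)\<^sup>2) ^ M)) \<le> C * N powr (- s)" if x: "x \<in> X" for x
      proof -
        have "(\<Sum>y\<in>X. \<mu> y * (1 / (1 + (N * dist x y)\<^sup>2) ^ M))
            \<le> (\<Sum>y\<in>X. \<mu> y * ((\<Sum>i\<le>k. 4 ^ M / 4 ^ (i * M) * of_bool (dist x y \<le> 2 ^ i / 2 ^ k)) + 1 / (N\<^sup>2) ^ M))"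
          using X(3) k(1) by (intro sum_mono mult_left_mono energy_kernel_le) auto
        also have "\<dots> = (\<Sum>i\<le>k. 4 ^ M / 4 ^ (i * M) * sum \<mu> {y\<in>X. dist x y \<le> 2 ^ i / 2 ^ k}) + 1 / (N\<^sup>2) ^ M"
        proof -
          have 1: "(\<Sum>y\<in>X. \<mu> y * (\<Sum>i\<le>k. 4 ^ M / 4 ^ (i * M) * of_bool (dist x y \<le> 2 ^ i / 2 ^ k)))
              = (\<Sum>i\<le>k. 4 ^ M / 4 ^ (i * M) * (\<Sum>y\<in>X. \<mu> y * of_bool (dist x y \<le> 2 ^ i / 2 ^ k)))"
            unfolding sum_distrib_left by (subst sum.swap) (intro sum.cong refl, simp only: mult_ac)
          have 2: "(\<Sum>y\<in>X. \<mu> y * of_bool (dist x y \<le> 2 ^ i / 2 ^ k)) = sum \<mu> {y\<in>X. dist x y \<le> 2 ^ i / 2 ^ k}" for i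
            unfolding of_bool_def using X(1) by (simp add: sum.inter_filter if_distrib cong: if_cong)
          have 3: "(\<Sum>y\<in>X. \<mu> y * (1 / (N\<^sup>2) ^ M)) = 1 / (N\<^sup>2) ^ M"
            using X(4) by (simp add: sum_divide_distrib[symmetric])
          show ?thesis unfolding distrib_left sum.distrib 1 2 3 ..
        qed
        also have "\<dots> \<le> (\<Sum>i\<le>k. C0 * 4 ^ M * 2 powr s * N powr (- s) * (1 / 2) ^ i) + N powr (- s)"
        proof (intro add_mono sum_mono)
          fix i assume "i \<in> {..k}"
          then have i: "i \<le> k" by simp
          have e: "(2::real) ^ i / 2 ^ k = 1 / 2 ^ (k - i)" using i by (simp add: power_diff)
          have "sum \<mu> {y\<in>X. dist x y \<le> 2 ^ i / 2 ^ k} \<le> C0 * (2 ^ i / 2 ^ k) powr s"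
            unfolding e using i kn by (intro ball x) auto
          also have "(2 ^ i / 2 ^ k :: real) powr s \<le> (2 ^ i * (2 / N)) powr s"
          proof (intro powr_mono2)
            have "1 / 2 ^ k \<le> 2 / N" using k N(1) by (simp add: field_simps)
            then have "2 ^ i * (1 / 2 ^ k) \<le> 2 ^ i * (2 / N)" by (intro mult_left_mono) auto
            then show "(2 ^ i / 2 ^ k :: real) \<le> 2 ^ i * (2 / N)" by simp
          qed (use assms(3) in auto)
          also have "(2 ^ i * (2 / N)) powr s = 2 powr (i * s) * (2 powr s * N powr (- s))"
            using N(1) by (simp add: powr_mult powr_divide powr_minus_divide powr_powr flip: powr_realpow)
          finally have "sum \<mu> {y\<in>X. dist x y \<le> 2 ^ i / 2 ^ k} \<le> C0 * (2 powr (i * s) * (2 powr s * N powr (- s)))"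
            using C0 by simp
          then have "4 ^ M / 4 ^ (i * M) * sum \<mu> {y\<in>X. dist x y \<le> 2 ^ i / 2 ^ k}
              \<le> 4 ^ M / 4 ^ (i * M) * (C0 * (2 powr (i * s) * (2 powr s * N powr (- s))))"
            by (intro mult_left_mono) auto
          also have "\<dots> = C0 * 4 ^ M * 2 powr s * N powr (- s) * (2 powr (i * s) / 4 ^ (i * M))"
            by (simp only: times_divide_eq_left times_divide_eq_right mult_ac)
          also have "\<dots> \<le> C0 * 4 ^ M * 2 powr s * N powr (- s) * (1 / 2) ^ i"
          proof (intro mult_left_mono)
            have "(4::real) ^ (i * M) = 2 powr (i * (2 * real M))"
            proof -
              have "(4::real) ^ (i * M) = (2 ^ 2) ^ (i * M)" by simp
              also have "\<dots> = 2 ^ (2 * (i * M))" by (rule power_mult[symmetric])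
              also have "\<dots> = 2 powr real (2 * (i * M))" by (rule powr_realpow[symmetric]) simp
              finally show ?thesis by (simp add: mult_ac)
            qed
            then have "2 powr (i * s) / 4 ^ (i * M) = 2 powr (i * s - i * (2 * real M))" by (simp add: powr_diff)
            also have "\<dots> \<le> 2 powr (- real i)"
            proof (rule powr_mono)
              have "i * (s + 1) \<le> i * (2 * real M)" using M by (intro mult_left_mono) auto
              then show "i * s - i * (2 * real M) \<le> - real i" by (simp add: algebra_simps)
            qed simp
            also have "\<dots> = (1 / 2) ^ i" by (simp add: powr_minus_divide powr_realpow power_divide)
            finally show "2 powr (i * s) / 4 ^ (i * M) \<le> (1 / 2) ^ i" .
          qed (use C0 in auto)
          finally show "4 ^ M / 4 ^ (i * M) * sum \<mu> {y\<in>X. dist x y \<le> 2 ^ i / 2 ^ k} \<le> C0 * 4 ^ M * 2 powr s * N powr (- s) * (1 / 2) ^ i" .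
        next
          have "1 / (N\<^sup>2) ^ M = N powr (- (2 * real M))"
          proof -
            have "N powr (2 * real M) = N powr real (2 * M)" by simp
            also have "\<dots> = N ^ (2 * M)" using N(1) by (intro powr_realpow) simp
            finally have "N powr (2 * real M) = (N\<^sup>2) ^ M" by (simp only: power_mult)
            then show ?thesis by (simp add: powr_minus_divide)
          qed
          also have "\<dots> \<le> N powr (- s)" using N(1) M by (intro powr_mono) auto
          finally show "1 / (N\<^sup>2) ^ M \<le> N powr (- s)" .
        qed
        also have "(\<Sum>i\<le>k. C0 * 4 ^ M * 2 powr s * N powr (- s) * (1 / 2) ^ i) \<le> C0 * 4 ^ M * 2 powr s * N powr (- s) * 2"
        proof -
          have "(\<Sum>i\<le>k. (1 / 2 :: real) ^ i) \<le> 2" by (simp add: sum_gp_basic sum_gp0)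
          then show ?thesis unfolding sum_distrib_left[symmetric] using C0 by (intro mult_left_mono) auto
        qed
        finally show ?thesis by (simp add: C_def algebra_simps)
      qed
      have "(\<Sum>x\<in>X. \<Sum>y\<in>X. \<mu> x * \<mu> y * (1 / (1 + (N * dist x y)\<^sup>2) ^ M)) = (\<Sum>x\<in>X. \<mu> x * (\<Sum>y\<in>X. \<mu> y * (1 / (1 + (N * dist x y)\<^sup>2) ^ M)))"
        unfolding sum_distrib_left by (simp only: mult.assoc)
      also have "\<dots> \<le> (\<Sum>x\<in>X. \<mu> x * (C * N powr (- s)))"
        using X(3) by (intro sum_mono mult_left_mono inner) auto
      also have "\<dots> = C * N powr (- s)" using X(4) by (simp flip: sum_distrib_right)
      finally show ?thesis .
    qed
    then show ?thesis using X by (intro exI[of _ X] exI[of _ \<mu>]) blast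
  qed
  then show ?thesis using that C by blast
qed

section \<open>Bilinear sumsets\<close>

lemma null_content_Un: "null_content s A \<Longrightarrow> null_content s B \<Longrightarrow> null_content s (A \<union> B)"
  using null_content_Union[of "{A, B}" s] by auto

text \<open>Freezing all variables except the first two makes x \<bullet> A_1 y constant on the
  product of the two supports. Let V be spanned by the differences of the first support; then A_1
  maps the second support into the orthogonal complement of V. The two dimensions sum to d < 2s, so
  one of them is below s and its support would be null.\<close>

lemma exists_point_nonzero:
  fixes E :: "nat \<Rightarrow> 'a::euclidean_space set" and A :: "nat \<Rightarrow> 'a \<Rightarrow> 'a"
  assumes l: "l \<ge> 1" and A: "linear (A 1)" "inj (A 1)"
    and bdd: "\<And>i. i \<in> {1..2*l} \<Longrightarrow> bounded (E i)" and E: "\<And>i. i \<in> {1..2*l} \<Longrightarrow> \<not> null_content s (E i)"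
    and s: "real DIM('a) / 2 < s"
  shows "\<exists>x. (\<forall>i\<in>{1..2*l}. \<forall>r>0. \<not> null_content s (E i \<inter> cball (x i) r)) \<and>
    (\<Sum>j\<in>{1..l}. x (2*j-1) \<bullet> A j (x (2*j))) \<noteq> 0"
proof (rule ccontr)
  assume contra: "\<not> ?thesis"
  have zero: "(\<Sum>j\<in>{1..l}. x (2*j-1) \<bullet> A j (x (2*j))) = 0"
    if "\<And>i r. i \<in> {1..2*l} \<Longrightarrow> 0 < r \<Longrightarrow> \<not> null_content s (E i \<inter> cball (x i) r)" for x
    using contra that by blast
  define S where "S i = {x \<in> E i. \<forall>r>0. \<not> null_content s (E i \<inter> cball x r)}" for i
  have not_null_S: "\<not> null_content s (S i)" if "i \<in> {1..2*l}" for i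
  proof
    assume "null_content s (S i)"
    then have "null_content s (S i \<union> (E i - S i))"
      unfolding S_def by (intro null_content_Un null_content_outside_support)
    then have "null_content s (E i)" by (rule null_content_subset) blast
    then show False using E[OF that] by simp
  qed
  have "\<exists>x. x \<in> S i" if "i \<in> {1..2*l}" for i
    using not_null_S[OF that] null_content_empty[of s] by (cases "S i = {}") auto
  then obtain x0 where x0: "\<And>i. i \<in> {1..2*l} \<Longrightarrow> x0 i \<in> S i" by metis
  have i12: "1 \<in> {1..2*l}" "2 \<in> {1..2*l}" using l by auto
  define \<kappa> where "\<kappa> = - (\<Sum>j\<in>{2..l}. x0 (2*j-1) \<bullet> A j (x0 (2*j)))"
  have const: "x \<bullet> A 1 y = \<kappa>" if "x \<in> S 1" "y \<in> S 2" for x y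
  proof -
    define x' where "x' i = (if i = 1 then x else if i = 2 then y else x0 i)" for i :: nat
    have "x' i \<in> S i" if "i \<in> {1..2*l}" for i using x0[OF that] \<open>x \<in> S 1\<close> \<open>y \<in> S 2\<close> by (simp add: x'_def)
    then have "(\<Sum>j\<in>{1..l}. x' (2*j-1) \<bullet> A j (x' (2*j))) = 0" by (intro zero) (simp add: S_def)
    moreover have "{1..l} = insert 1 {2..l}" using l by auto
    moreover have "(\<Sum>j\<in>{2..l}. x' (2*j-1) \<bullet> A j (x' (2*j))) = - \<kappa>"
      unfolding \<kappa>_def minus_minus by (intro sum.cong refl) (auto simp: x'_def)
    ultimately show ?thesis by (simp add: x'_def)
  qed
  define V where "V = span ((\<lambda>x. x - x0 1) ` S 1)"
  define W where "W = {w. \<forall>v\<in>V. orthogonal v w}"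
  have V: "subspace V" by (simp add: V_def)
  have W: "subspace W" unfolding W_def by (rule subspace_orthogonal_to_vectors)
  have dims: "dim W + dim V = DIM('a)"
    using dim_subspace_orthogonal_to_vectors[OF V subspace_UNIV] by (simp add: W_def)
  have "bounded (S i)" if "i \<in> {1..2*l}" for i
    by (rule bounded_subset[OF bdd[OF that]]) (auto simp: S_def)
  note bddS = this
  show False
  proof (cases "real (dim V) < s")
    case True
    have "S 1 \<subseteq> (+) (x0 1) ` V"
    proof
      fix x assume "x \<in> S 1"
      then have "x - x0 1 \<in> V" unfolding V_def by (intro span_base imageI)
      then show "x \<in> (+) (x0 1) ` V" by (intro image_eqI[of _ _ "x - x0 1"]) auto
    qed
    then have "null_content s (S 1)" by (rule null_content_affine[OF bddS[OF i12(1)] V _ True])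
    then show False using not_null_S i12 by blast
  next
    case False
    \<comment> \<open>Injectivity of \<open>A 1\<close> makes the preimage no larger than W, whose
      dimension is at most d - s < s. The second support lies in this linear subspace itself,
      without a translation, since only differences in x are tested.\<close>
    define V' where "V' = A 1 -` W"
    have V': "subspace V'" unfolding V'_def by (rule linear_subspace_vimage[OF A(1) W])
    have "dim V' = dim (A 1 ` V')"
      by (rule dim_image_eq[symmetric, OF A(1)]) (rule inj_on_subset[OF A(2)], simp)
    also have "\<dots> \<le> dim W" by (rule dim_subset) (auto simp: V'_def)
    finally have "real (dim V') < s" using dims False s by linarith
    moreover have "S 2 \<subseteq> (+) 0 ` V'"
    proof
      fix y assume y: "y \<in> S 2"
      have "orthogonal v (A 1 y)" if "v \<in> V" for v
      proof -
        have "orthogonal (A 1 y) v"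
        proof (rule orthogonal_to_span[OF that[unfolded V_def]])
          fix z assume "z \<in> (\<lambda>x. x - x0 1) ` S 1"
          then obtain x where "x \<in> S 1" "z = x - x0 1" by blast
          then show "orthogonal (A 1 y) z"
            using const[OF _ y] x0[OF i12(1)] by (simp add: orthogonal_def inner_diff_right inner_commute)
        qed
        then show ?thesis by (simp add: orthogonal_commute)
      qed
      then show "y \<in> (+) 0 ` V'" by (auto simp: V'_def W_def)
    qed
    ultimately have "null_content s (S 2)" by (intro null_content_affine[OF bddS[OF i12(2)] V'])
    then show False using not_null_S i12 by blast
  qed
qed

section \<open>Compactness, localisation and assembly\<close>

lemma compact_finite_sums:
  fixes K :: "nat \<Rightarrow> real set"
  assumes "\<And>j. j \<in> {1..n} \<Longrightarrow> compact (K j)"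
  shows "compact {\<Sum>j\<in>{1..n}. \<kappa> j | \<kappa>. \<forall>j\<in>{1..n}. \<kappa> j \<in> K j}"
  using assms
proof (induction n)
  case 0
  have "{\<Sum>j\<in>{1..0}. \<kappa> j | \<kappa>. \<forall>j\<in>{1..0::nat}. \<kappa> j \<in> K j} = {0}" by auto
  then show ?case by simp
next
  case (Suc n)
  let ?T = "{\<Sum>j\<in>{1..n}. \<kappa> j | \<kappa>. \<forall>j\<in>{1..n}. \<kappa> j \<in> K j}"
  have "{\<Sum>j\<in>{1..Suc n}. \<kappa> j | \<kappa>. \<forall>j\<in>{1..Suc n}. \<kappa> j \<in> K j} = {x + y | x y. x \<in> ?T \<and> y \<in> K (Suc n)}"
    (is "?L = ?R")
  proof
    show "?L \<subseteq> ?R"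
    proof
      fix v assume "v \<in> ?L"
      then obtain \<kappa> where \<kappa>: "v = (\<Sum>j\<in>{1..Suc n}. \<kappa> j)" "\<forall>j\<in>{1..Suc n}. \<kappa> j \<in> K j" by blast
      then have "v = (\<Sum>j\<in>{1..n}. \<kappa> j) + \<kappa> (Suc n)" by simp
      moreover have "(\<Sum>j\<in>{1..n}. \<kappa> j) \<in> ?T" using \<kappa>(2) by auto
      moreover have "\<kappa> (Suc n) \<in> K (Suc n)" using \<kappa>(2) by simp
      ultimately show "v \<in> ?R" by blast
    qed
    show "?R \<subseteq> ?L"
    proof
      fix v assume "v \<in> ?R"
      then obtain \<kappa> y where \<kappa>: "v = (\<Sum>j\<in>{1..n}. \<kappa> j) + y" "\<forall>j\<in>{1..n}. \<kappa> j \<in> K j" "y \<in> K (Suc n)" by blast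
      define \<kappa>' where "\<kappa>' = \<kappa>(Suc n := y)"
      have "(\<Sum>j\<in>{1..n}. \<kappa>' j) = (\<Sum>j\<in>{1..n}. \<kappa> j)" by (intro sum.cong) (auto simp: \<kappa>'_def)
      then have "v = (\<Sum>j\<in>{1..Suc n}. \<kappa>' j)" using \<kappa>(1) by (simp add: \<kappa>'_def)
      moreover have "\<forall>j\<in>{1..Suc n}. \<kappa>' j \<in> K j" using \<kappa>(2,3) by (auto simp: \<kappa>'_def le_Suc_eq)
      ultimately show "v \<in> ?L" by blast
    qed
  qed
  moreover have "compact {x + y | x y. x \<in> ?T \<and> y \<in> K (Suc n)}"
    using Suc by (intro compact_sums) auto
  ultimately show ?case by simp
qed

text \<open>The variables separate into the pairs (2j-1, 2j), so the set is a finite sum of compact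
  images. Its closedness is what keeps points outside it at positive distance.\<close>

lemma compact_bilinear_sumset:
  fixes E :: "nat \<Rightarrow> 'a::euclidean_space set"
  assumes cpt: "\<And>i. i \<in> {1..2*l} \<Longrightarrow> compact (E i)" and lin: "\<And>j. j \<in> {1..l} \<Longrightarrow> linear (A j)"
  shows "compact {\<Sum>j\<in>{1..l}. x (2*j-1) \<bullet> A j (x (2*j)) | x. \<forall>i\<in>{1..2*l}. x i \<in> E i}"
proof -
  define K where "K j = (\<lambda>z. fst z \<bullet> A j (snd z)) ` (E (2*j-1) \<times> E (2*j))" for j
  have "compact (K j)" if j: "j \<in> {1..l}" for j
    unfolding K_def using j
    by (intro compact_continuous_image compact_Times cpt continuous_intros linear_continuous_on_compose[OF _ lin[OF j]]) auto
  then have "compact {\<Sum>j\<in>{1..l}. \<kappa> j | \<kappa>. \<forall>j\<in>{1..l}. \<kappa> j \<in> K j}" by (rule compact_finite_sums)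
  moreover have "{\<Sum>j\<in>{1..l}. \<kappa> j | \<kappa>. \<forall>j\<in>{1..l}. \<kappa> j \<in> K j} = {\<Sum>j\<in>{1..l}. x (2*j-1) \<bullet> A j (x (2*j)) | x. \<forall>i\<in>{1..2*l}. x i \<in> E i}"
    (is "?L = ?R")
  proof
    show "?L \<subseteq> ?R"
    proof
      fix v assume "v \<in> ?L"
      then obtain \<kappa> where \<kappa>: "v = (\<Sum>j\<in>{1..l}. \<kappa> j)" "\<forall>j\<in>{1..l}. \<kappa> j \<in> K j" by blast
      have "\<forall>j\<in>{1..l}. \<exists>z. z \<in> E (2*j-1) \<times> E (2*j) \<and> \<kappa> j = fst z \<bullet> A j (snd z)"
      proof
        fix j assume "j \<in> {1..l}"
        then have "\<kappa> j \<in> K j" using \<kappa>(2) by blast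
        then show "\<exists>z. z \<in> E (2*j-1) \<times> E (2*j) \<and> \<kappa> j = fst z \<bullet> A j (snd z)" unfolding K_def by blast
      qed
      then obtain z where z: "\<forall>j\<in>{1..l}. z j \<in> E (2*j-1) \<times> E (2*j) \<and> \<kappa> j = fst (z j) \<bullet> A j (snd (z j))" by metis
      \<comment> \<open>Interleaves the pairs: for i = 2j-1 the index (i + 1) div 2 is j, for i = 2j
        the index i div 2 is j.\<close>
      define x where "x i = (if odd i then fst (z ((i + 1) div 2)) else snd (z (i div 2)))" for i :: nat
      have x: "x (2*j-1) = fst (z j)" "x (2*j) = snd (z j)" if "j \<in> {1..l}" for j
        using that by (auto simp: x_def)
      have "v = (\<Sum>j\<in>{1..l}. x (2*j-1) \<bullet> A j (x (2*j)))"
        unfolding \<kappa>(1) by (intro sum.cong refl) (use z x in simp)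
      moreover have "x i \<in> E i" if i: "i \<in> {1..2*l}" for i
      proof (cases "odd i")
        case True
        then obtain k where k: "i = 2 * k + 1" by (elim oddE)
        then have "k + 1 \<in> {1..l}" using i by auto
        then have "x (2*(k+1)-1) \<in> E (2*(k+1)-1)" using z x(1) by (metis mem_Times_iff)
        then show ?thesis by (simp add: k)
      next
        case False
        then have "even i" by simp
        then obtain k where k: "i = 2 * k" by (rule evenE)
        then have "k \<in> {1..l}" using i by auto
        then have "x (2*k) \<in> E (2*k)" using z x(2) by (metis mem_Times_iff)
        then show ?thesis by (simp add: k)
      qed
      ultimately show "v \<in> ?R" by blast
    qed
    show "?R \<subseteq> ?L"
    proof
      fix v assume "v \<in> ?R"
      then obtain x where x: "v = (\<Sum>j\<in>{1..l}. x (2*j-1) \<bullet> A j (x (2*j)))" "\<forall>i\<in>{1..2*l}. x i \<in> E i" by blast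
      have "x (2*j-1) \<bullet> A j (x (2*j)) \<in> K j" if "j \<in> {1..l}" for j
      proof -
        have "2*j-1 \<in> {1..2*l}" "2*j \<in> {1..2*l}" using that by auto
        then have "(x (2*j-1), x (2*j)) \<in> E (2*j-1) \<times> E (2*j)" using x(2) by blast
        then show ?thesis unfolding K_def by (intro image_eqI[of _ _ "(x (2*j-1), x (2*j))"]) simp_all
      qed
      then show "v \<in> ?L" unfolding x(1) by (intro CollectI exI[of _ "\<lambda>j. x (2*j-1) \<bullet> A j (x (2*j))"]) auto
    qed
  qed
  ultimately show ?thesis by simp
qed

lemma bilinear_sum_perturb:
  fixes A :: "nat \<Rightarrow> 'a::euclidean_space \<Rightarrow> 'a"
  assumes lin: "\<And>j. j \<in> {1..l} \<Longrightarrow> linear (A j)" and "\<rho> > 0" "l \<ge> 1"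
  obtains r where "r > 0" "\<And>x. (\<And>i. i \<in> {1..2*l} \<Longrightarrow> dist (x i) (x0 i) \<le> r) \<Longrightarrow>
     \<bar>(\<Sum>j\<in>{1..l}. x (2*j-1) \<bullet> A j (x (2*j))) - (\<Sum>j\<in>{1..l}. x0 (2*j-1) \<bullet> A j (x0 (2*j)))\<bar> \<le> \<rho>"
proof -
  have "\<exists>r>0. \<forall>x y. dist x (x0 (2*j-1)) \<le> r \<longrightarrow> dist y (x0 (2*j)) \<le> r \<longrightarrow> \<bar>x \<bullet> A j y - x0 (2*j-1) \<bullet> A j (x0 (2*j))\<bar> \<le> \<rho> / l"
    if j: "j \<in> {1..l}" for j
  proof -
    let ?f = "\<lambda>z. fst z \<bullet> A j (snd z)" and ?z = "(x0 (2*j-1), x0 (2*j))"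
    have "continuous_on UNIV ?f"
      by (intro continuous_intros linear_continuous_on_compose[OF _ lin[OF j]])
    then have "isCont ?f ?z" by (simp add: continuous_on_eq_continuous_at)
    moreover have "\<rho> / l > 0" using assms by simp
    ultimately obtain d where d: "d > 0" "\<And>z. dist z ?z < d \<Longrightarrow> dist (?f z) (?f ?z) < \<rho> / l"
      unfolding continuous_at_eps_delta by metis
    have "\<bar>x \<bullet> A j y - x0 (2*j-1) \<bullet> A j (x0 (2*j))\<bar> \<le> \<rho> / l"
      if "dist x (x0 (2*j-1)) \<le> d / 3" "dist y (x0 (2*j)) \<le> d / 3" for x y
    proof -
      have "dist (x, y) ?z \<le> dist x (x0 (2*j-1)) + dist y (x0 (2*j))"
        unfolding dist_Pair_Pair by (rule sqrt_sum_squares_le_sum) auto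
      then have "dist (x, y) ?z < d" using that d(1) by linarith
      then have "dist (?f (x, y)) (?f ?z) < \<rho> / l" by (rule d(2))
      then show ?thesis by (simp add: dist_real_def)
    qed
    then show ?thesis using d(1) by (intro exI[of _ "d / 3"]) auto
  qed
  then obtain r where r: "\<And>j. j \<in> {1..l} \<Longrightarrow> r j > 0"
    "\<And>j x y. j \<in> {1..l} \<Longrightarrow> dist x (x0 (2*j-1)) \<le> r j \<Longrightarrow> dist y (x0 (2*j)) \<le> r j \<Longrightarrow> \<bar>x \<bullet> A j y - x0 (2*j-1) \<bullet> A j (x0 (2*j))\<bar> \<le> \<rho> / l"
    by metis
  define R where "R = Min (r ` {1..l})"
  have R: "R > 0" "\<And>j. j \<in> {1..l} \<Longrightarrow> R \<le> r j" using r(1) assms(3) by (auto simp: R_def)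
  have "\<bar>(\<Sum>j\<in>{1..l}. x (2*j-1) \<bullet> A j (x (2*j))) - (\<Sum>j\<in>{1..l}. x0 (2*j-1) \<bullet> A j (x0 (2*j)))\<bar> \<le> \<rho>"
    if x: "\<And>i. i \<in> {1..2*l} \<Longrightarrow> dist (x i) (x0 i) \<le> R" for x
  proof -
    have "\<bar>(\<Sum>j\<in>{1..l}. x (2*j-1) \<bullet> A j (x (2*j))) - (\<Sum>j\<in>{1..l}. x0 (2*j-1) \<bullet> A j (x0 (2*j)))\<bar>
      \<le> (\<Sum>j\<in>{1..l}. \<bar>x (2*j-1) \<bullet> A j (x (2*j)) - x0 (2*j-1) \<bullet> A j (x0 (2*j))\<bar>)"
      unfolding sum_subtractf[symmetric] by (rule sum_abs)
    also have "\<dots> \<le> (\<Sum>j\<in>{1..l}. \<rho> / l)"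
    proof (rule sum_mono)
      fix j assume j: "j \<in> {1..l}"
      then have "2*j-1 \<in> {1..2*l}" "2*j \<in> {1..2*l}" by auto
      then show "\<bar>x (2*j-1) \<bullet> A j (x (2*j)) - x0 (2*j-1) \<bullet> A j (x0 (2*j))\<bar> \<le> \<rho> / l"
        using x R(2)[OF j] by (intro r(2)[OF j]) (meson order.trans)+
    qed
    also have "\<dots> = \<rho>" using assms(3) by simp
    finally show ?thesis .
  qed
  then show ?thesis using that R(1) by blast
qed

text \<open>Everything is localised near a point of the supports with nonzero sum \<open>u0\<close>.
  There t stays away from 0 and one coordinate of the x-side stays away from 0, as the chart
  requires. Being in the supports keeps the localised sets non-null.\<close>

lemma bilinear_sumset_interior:
  fixes E :: "nat \<Rightarrow> 'a::euclidean_space set" and A :: "nat \<Rightarrow> 'a \<Rightarrow> 'a"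
  assumes l: "l \<ge> 1" and lin: "\<And>j. j \<in> {1..l} \<Longrightarrow> linear (A j)" and inj: "\<And>j. j \<in> {1..l} \<Longrightarrow> inj (A j)"
    and cpt: "\<And>i. i \<in> {1..2*l} \<Longrightarrow> compact (E i)" and not_null: "\<And>i. i \<in> {1..2*l} \<Longrightarrow> \<not> null_content s (E i)"
    and s: "real DIM('a) / 2 + 1 / (2 * real l) < s"
  shows "interior {\<Sum>j\<in>{1..l}. x (2*j-1) \<bullet> A j (x (2*j)) | x. \<forall>i\<in>{1..2*l}. x i \<in> E i} \<noteq> {}"
proof -
  let ?L = "{1..l}" and ?d = "DIM('a)"
  have idx: "2*j-1 \<in> {1..2*l}" "2*j \<in> {1..2*l}" if "j \<in> ?L" for j using that by auto
  have l0: "real l > 0" using l by simp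
  have "0 < 1 / (2 * real l)" "0 \<le> real ?d / 2" using l0 by simp_all
  then have s0: "s > 0" and sd: "real ?d / 2 < s" using s by linarith+
  have 1: "1 \<in> ?L" using l by simp
  obtain x0 where x0: "\<And>i r. i \<in> {1..2*l} \<Longrightarrow> 0 < r \<Longrightarrow> \<not> null_content s (E i \<inter> cball (x0 i) r)"
    "(\<Sum>j\<in>?L. x0 (2*j-1) \<bullet> A j (x0 (2*j))) \<noteq> 0"
    using exists_point_nonzero[where A = A and E = E and l = l and s = s, OF l lin[OF 1] inj[OF 1] compact_imp_bounded[OF cpt] not_null sd] by blast
  define u0 where "u0 = (\<Sum>j\<in>?L. x0 (2*j-1) \<bullet> A j (x0 (2*j)))"
  obtain j0 where j0: "j0 \<in> ?L" "x0 (2*j0-1) \<bullet> A j0 (x0 (2*j0)) \<noteq> 0" using x0(2) by (meson sum.neutral)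
  then have "x0 (2*j0-1) \<noteq> 0" by auto
  then obtain b0 :: 'a where b0: "b0 \<in> Basis" "x0 (2*j0-1) \<bullet> b0 \<noteq> 0" using euclidean_all_zero_iff by blast
  \<comment> \<open>\<bar>t - u0\<bar> \<le> \<rho> then forces \<bar>t\<bar> \<ge> \<rho>, the
    lower bound needed by the chart.\<close>
  define \<rho> where "\<rho> = \<bar>u0\<bar> / 2"
  have \<rho>: "\<rho> > 0" using x0(2) by (simp add: \<rho>_def u0_def)
  \<comment> \<open>Half the distinguished coordinate of the centre; moving by at most c leaves at
    least c.\<close>
  define c where "c = \<bar>x0 (2*j0-1) \<bullet> b0\<bar> / 2"
  have c: "c > 0" using b0 by (simp add: c_def)
  have "\<rho> / 2 > 0" using \<rho> by simp
  from bilinear_sum_perturb[of l A, OF lin this l] obtain r1 where r1: "r1 > 0" "\<And>x. (\<And>i. i \<in> {1..2*l} \<Longrightarrow> dist (x i) (x0 i) \<le> r1) \<Longrightarrow>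
     \<bar>(\<Sum>j\<in>?L. x (2*j-1) \<bullet> A j (x (2*j))) - u0\<bar> \<le> \<rho> / 2"
    unfolding u0_def by blast
  define r where "r = min r1 c"
  have r: "r > 0" "r \<le> r1" "r \<le> c" using r1(1) c by (auto simp: r_def)
  define E' where "E' i = E i \<inter> cball (x0 i) r" for i
  have E': "compact (E' i)" "bounded (E' i)" "\<not> null_content s (E' i)" if "i \<in> {1..2*l}" for i
    using cpt[OF that] x0(1)[OF that r(1)] by (auto simp: E'_def compact_Int_closed intro: compact_imp_bounded)
  have E'_dist: "dist x (x0 i) \<le> r" if "x \<in> E' i" for x i using that by (simp add: E'_def dist_commute)
  define S where "S = {\<Sum>j\<in>?L. x (2*j-1) \<bullet> A j (x (2*j)) | x. \<forall>i\<in>{1..2*l}. x i \<in> E' i}"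
  have S_sub: "S \<subseteq> {\<Sum>j\<in>?L. x (2*j-1) \<bullet> A j (x (2*j)) | x. \<forall>i\<in>{1..2*l}. x i \<in> E i}"
    unfolding S_def by (auto simp: E'_def)
  have "compact S" unfolding S_def by (rule compact_bilinear_sumset[OF E'(1) lin])
  then have S: "closed S" by (rule compact_imp_closed)

  obtain K where K: "K > 0" "\<And>i x. i \<in> {1..2*l} \<Longrightarrow> x \<in> E' i \<Longrightarrow> norm x \<le> K"
    "\<And>j x. j \<in> ?L \<Longrightarrow> x \<in> E' (2*j) \<Longrightarrow> norm (A j x) \<le> K"
  proof -
    have "bounded (\<Union>i\<in>{1..2*l}. E' i)" using E'(2) by (intro bounded_UN) auto
    then obtain K1 where K1: "\<And>i x. i \<in> {1..2*l} \<Longrightarrow> x \<in> E' i \<Longrightarrow> norm x \<le> K1" unfolding bounded_iff by blast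
    have "bounded (\<Union>j\<in>?L. A j ` E' (2*j))"
      using E'(2) lin idx by (intro bounded_UN ballI bounded_linear_image) (auto simp: linear_conv_bounded_linear[symmetric])
    then obtain K2 where K2: "\<And>j x. j \<in> ?L \<Longrightarrow> x \<in> E' (2*j) \<Longrightarrow> norm (A j x) \<le> K2" unfolding bounded_iff by blast
    show ?thesis
    proof (rule that[of "\<bar>K1\<bar> + \<bar>K2\<bar> + 1"])
      show "norm x \<le> \<bar>K1\<bar> + \<bar>K2\<bar> + 1" if "i \<in> {1..2*l}" "x \<in> E' i" for i x using K1[OF that] by linarith
      show "norm (A j x) \<le> \<bar>K1\<bar> + \<bar>K2\<bar> + 1" if "j \<in> ?L" "x \<in> E' (2*j)" for j x using K2[OF that] by linarith
    qed linarith
  qed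
  \<comment> \<open>The y-side of the chart consists of the points A_j y. This lower bound transfers
    their distances back to the weights carried by y itself.\<close>
  obtain \<beta> where \<beta>: "\<beta> > 0" "\<And>j x. j \<in> ?L \<Longrightarrow> \<beta> * norm x \<le> norm (A j x)"
  proof -
    have "\<exists>B>0. \<forall>x. B * norm x \<le> norm (A j x)" if "j \<in> ?L" for j
      using linear_inj_bounded_below_pos[OF lin[OF that] inj[OF that]] by metis
    then obtain B where B: "\<And>j. j \<in> ?L \<Longrightarrow> B j > 0" "\<And>j x. j \<in> ?L \<Longrightarrow> B j * norm x \<le> norm (A j x)" by metis
    have "Min (B ` ?L) > 0" using B(1) l by (subst Min_gr_iff) auto
    moreover have "Min (B ` ?L) * norm x \<le> norm (A j x)" if "j \<in> ?L" for j x
    proof -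
      have "Min (B ` ?L) \<le> B j" using that by simp
      then have "Min (B ` ?L) * norm x \<le> B j * norm x" by (rule mult_right_mono) simp
      then show ?thesis using B(2)[OF that, of x] by linarith
    qed
    ultimately show ?thesis using that by blast
  qed

  \<comment> \<open>Chosen so that the kernel exponent \<open>2 * Suc m\<close> of
    \<open>chart_decay\<close> equals \<open>M * l\<close>, that is, exponent M for each of the l
    factors. The evenness of M makes \<open>M * l\<close> even, and its size meets the condition s +
    1 \<le> 2M.\<close>
  define M0 where "M0 = nat \<lceil>s\<rceil> + 1"
  define M where "M = 2 * M0"
  have "s \<le> real (nat \<lceil>s\<rceil>)" by (rule real_nat_ceiling_ge)
  then have M: "s + 1 \<le> 2 * real M" unfolding M_def M0_def by simp
  have "M0 * l \<noteq> 0" using l by (simp add: M0_def)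
  then obtain m where m: "M0 * l = Suc m" using not0_implies_Suc by blast
  have Ml: "2 * Suc m = M * l" unfolding m[symmetric] M_def by simp

  define k where "k N x y = 1 / (1 + (N * dist x y)\<^sup>2) ^ M" for N :: real and x y :: 'a
  have k_pos: "k N x y \<ge> 0" for N x y by (simp add: k_def)
  define good where "good C i n X \<mu> \<longleftrightarrow> finite X \<and> X \<subseteq> E' i \<and> (\<forall>x. \<mu> x \<ge> 0) \<and> sum \<mu> X = (1::real) \<and>
     (\<forall>N. 1 \<le> N \<and> N \<le> 2 ^ n \<longrightarrow> (\<Sum>x\<in>X. \<Sum>y\<in>X. \<mu> x * \<mu> y * k N x y) \<le> C * N powr (- s))" for C i n X \<mu>
  have "\<exists>C>0. \<forall>n. \<exists>X \<mu>. good C i n X \<mu>" if "i \<in> {1..2*l}" for i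
  proof (rule discrete_energy[OF E'(2,3)[OF that] s0 M])
    fix C :: real assume "0 < C" and C: "\<And>n. \<exists>X \<mu>. finite X \<and> X \<subseteq> E' i \<and> (\<forall>x. \<mu> x \<ge> 0) \<and> sum \<mu> X = (1::real) \<and>
     (\<forall>N. 1 \<le> N \<and> N \<le> 2 ^ n \<longrightarrow> (\<Sum>x\<in>X. \<Sum>y\<in>X. \<mu> x * \<mu> y * (1 / (1 + (N * dist x y)\<^sup>2) ^ M)) \<le> C * N powr (- s))"
    show ?thesis unfolding good_def k_def using \<open>0 < C\<close> C by (intro exI[of _ C] conjI allI)
  qed
  then obtain Cf where Cf: "\<And>i. i \<in> {1..2*l} \<Longrightarrow> Cf i > 0" "\<And>i n. i \<in> {1..2*l} \<Longrightarrow> \<exists>X \<mu>. good (Cf i) i n X \<mu>"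
    by metis
  define CE where "CE = sum Cf {1..2*l}"
  have CE: "Cf i \<le> CE" if "i \<in> {1..2*l}" for i
    unfolding CE_def by (rule member_le_sum[OF that]) (use Cf(1) in \<open>auto intro: less_imp_le\<close>)
  have CE0: "CE > 0" using Cf(1)[of 1] CE[of 1] l by auto
  have "\<forall>n i. \<exists>X \<mu>. i \<in> {1..2*l} \<longrightarrow> good (Cf i) i n X \<mu>"
    using Cf(2) by blast
  then obtain X \<mu> where X\<mu>: "\<And>n i. i \<in> {1..2*l} \<Longrightarrow> good (Cf i) i n (X n i) (\<mu> n i)"
    by metis
  have X: "finite (X n i)" "X n i \<subseteq> E' i" "\<mu> n i x \<ge> 0" "sum (\<mu> n i) (X n i) = 1" if "i \<in> {1..2*l}" for n i x
    using X\<mu>[OF that, of n] unfolding good_def by blast+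
  have energy: "(\<Sum>x\<in>X n i. \<Sum>y\<in>X n i. \<mu> n i x * \<mu> n i y * k N x y) \<le> CE * N powr (- s)"
    if "i \<in> {1..2*l}" "1 \<le> N" "N \<le> 2 ^ n" for n i N
  proof -
    have "(\<Sum>x\<in>X n i. \<Sum>y\<in>X n i. \<mu> n i x * \<mu> n i y * k N x y) \<le> Cf i * N powr (- s)"
      using X\<mu>[OF that(1), of n] that(2,3) unfolding good_def by blast
    also have "\<dots> \<le> CE * N powr (- s)" using CE[OF that(1)] by (intro mult_right_mono) auto
    finally show ?thesis .
  qed

  define P where "P n = PiE ?L (\<lambda>j. X n (2*j-1))" for n
  define R where "R n = PiE ?L (\<lambda>j. X n (2*j))" for n
  define a where "a n p = (\<Prod>j\<in>?L. \<mu> n (2*j-1) (p j))" for n p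
  define b where "b n p = (\<Prod>j\<in>?L. \<mu> n (2*j) (p j))" for n p
  have fin: "finite (P n)" "finite (R n)" for n
    unfolding P_def R_def using X(1) idx by (intro finite_PiE; simp)+
  have a0: "a n p \<ge> 0" and b0': "b n p \<ge> 0" for n p
    unfolding a_def b_def using X(3) idx by (intro prod_nonneg; blast)+
  have mass: "sum (a n) (P n) = 1" "sum (b n) (R n) = 1" for n
  proof -
    have "sum (a n) (P n) = (\<Prod>j\<in>?L. sum (\<mu> n (2*j-1)) (X n (2*j-1)))"
      unfolding a_def P_def by (rule prod_sum_PiE[symmetric]) (use X(1) idx in auto)
    also have "\<dots> = 1" using X(4) idx by (intro prod.neutral) blast
    finally show "sum (a n) (P n) = 1" .
    have "sum (b n) (R n) = (\<Prod>j\<in>?L. sum (\<mu> n (2*j)) (X n (2*j)))"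
      unfolding b_def R_def by (rule prod_sum_PiE[symmetric]) (use X(1) idx in auto)
    also have "\<dots> = 1" using X(4) idx by (intro prod.neutral) blast
    finally show "sum (b n) (R n) = 1" .
  qed
  have PE: "p j \<in> E' (2*j-1)" if "p \<in> P n" "j \<in> ?L" for p j n
    using that X(2) idx unfolding P_def by (blast dest: PiE_mem)
  have RE: "q j \<in> E' (2*j)" if "q \<in> R n" "j \<in> ?L" for q j n
    using that X(2) idx unfolding R_def by (blast dest: PiE_mem)

  \<comment> \<open>Coordinates of the product space of dimension l d: \<open>\<xi>\<close> for the
    x-side, \<open>\<upsilon>\<close> for the points A_j y. The bilinear sum becomes one inner
    product over \<open>I\<close>.\<close>
  define I where "I = ?L \<times> (Basis :: 'a set)"
  define \<xi> where "\<xi> p i = p (fst i) \<bullet> snd i" for p :: "nat \<Rightarrow> 'a" and i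
  define \<upsilon> where "\<upsilon> q i = A (fst i) (q (fst i)) \<bullet> snd i" for q and i :: "nat \<times> 'a"
  define \<tau> where "\<tau> p q = (\<Sum>j\<in>?L. p j \<bullet> A j (q j))" for p q
  have I: "finite I" "(j0, b0) \<in> I" "card I = l * ?d" using j0(1) b0(1) by (auto simp: I_def)
  have \<tau>: "\<tau> p q = (\<Sum>i\<in>I. \<xi> p i * \<upsilon> q i)" for p q
    unfolding \<tau>_def I_def \<xi>_def \<upsilon>_def by (subst euclidean_inner) (simp add: sum.cartesian_product case_prod_beta)
  have sq: "(\<Sum>b\<in>Basis. (x \<bullet> b - y \<bullet> b)\<^sup>2) = (norm (x - y))\<^sup>2" for x y :: 'a
    unfolding power2_norm_eq_inner by (subst euclidean_inner) (simp add: inner_diff_left power2_eq_square)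
  have \<xi>_sq: "sqdist I (\<xi> p) (\<xi> q) = (\<Sum>j\<in>?L. (norm (p j - q j))\<^sup>2)" for p q
    unfolding I_def \<xi>_def sq[symmetric] by (simp add: sum.cartesian_product case_prod_beta)
  have \<upsilon>_sq: "sqdist I (\<upsilon> p) (\<upsilon> q) = (\<Sum>j\<in>?L. (norm (A j (p j) - A j (q j)))\<^sup>2)" for p q
    unfolding I_def \<upsilon>_def sq[symmetric] by (simp add: sum.cartesian_product case_prod_beta)

  from chart_decay[OF I(1,2) c \<rho> K(1), of "Suc m", where 'p = "nat \<Rightarrow> 'a" and 'r = "nat \<Rightarrow> 'a"]
  obtain C \<gamma> where C: "0 < C" "0 < \<gamma>" and decay: "\<forall>(P :: (nat \<Rightarrow> 'a) set) (R :: (nat \<Rightarrow> 'a) set) a b x y t N \<sigma>.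
     1 \<le> N \<longrightarrow> 0 < \<sigma> \<longrightarrow> \<rho> \<le> \<bar>t\<bar> \<longrightarrow>
     (\<forall>p\<in>P. 0 \<le> a p \<and> c \<le> \<bar>x p (j0, b0)\<bar> \<and> (\<forall>i\<in>I. \<bar>x p i\<bar> \<le> K)) \<longrightarrow>
     (\<forall>r\<in>R. 0 \<le> b r \<and> (\<forall>i\<in>I. \<bar>y r i\<bar> \<le> K)) \<longrightarrow>
     \<bar>\<Sum>p\<in>P. \<Sum>r\<in>R. a p * b r * gauss_deriv (2 * Suc m) (N * (1 / x p (j0, b0) * (t - (\<Sum>i\<in>I. x p i * y r i))))\<bar>
     \<le> C * (\<sigma> * N ^ (card I - 1) * (\<Sum>p\<in>P. \<Sum>q\<in>P. a p * a q * exp (- \<gamma> * (N\<^sup>2 * sqdist I (x p) (x q))))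
       + 1 / \<sigma> * (\<Sum>r\<in>R. \<Sum>r'\<in>R. b r * b r' * (1 / (1 + N\<^sup>2 * sqdist I (y r) (y r') / 4) ^ (2 * Suc m))))"
    by (elim exE conjE) (rule that)

  define D1 where "D1 = exp (real M ^ 2 / \<gamma>)"
  have energy_a: "(\<Sum>p\<in>P n. \<Sum>q\<in>P n. a n p * a n q * exp (- \<gamma> * (N\<^sup>2 * sqdist I (\<xi> p) (\<xi> q)))) \<le> (D1 * (CE * N powr (- s))) ^ l"
    if N: "1 \<le> N" "N \<le> 2 ^ n" for n N
  proof -
    have "exp (- \<gamma> * (N\<^sup>2 * sqdist I (\<xi> p) (\<xi> q))) \<le> (\<Prod>j\<in>?L. D1 * k N (p j) (q j))" for p q
    proof -
      have "exp (- \<gamma> * (N\<^sup>2 * sqdist I (\<xi> p) (\<xi> q))) = (\<Prod>j\<in>?L. exp (- \<gamma> * (N * dist (p j) (q j))\<^sup>2))"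
        unfolding \<xi>_sq by (simp add: exp_sum[symmetric] sum_distrib_left sum_negf dist_norm power_mult_distrib)
      also have "\<dots> \<le> (\<Prod>j\<in>?L. D1 * k N (p j) (q j))"
        unfolding D1_def k_def by (intro prod_mono conjI exp_le_kernel C) auto
      finally show ?thesis .
    qed
    then have "(\<Sum>p\<in>P n. \<Sum>q\<in>P n. a n p * a n q * exp (- \<gamma> * (N\<^sup>2 * sqdist I (\<xi> p) (\<xi> q)))) \<le> (D1 * (CE * N powr (- s))) ^ card ?L"
      unfolding P_def a_def using X(1,3) idx N
      by (intro weighted_product_energy_le[where k = "k N"] k_pos energy) (auto simp: D1_def)
    then show ?thesis by simp
  qed
  \<comment> \<open>Small enough for both the constant 1 in the kernel and the coefficient
    \<beta>^2/4 of the squared distance.\<close>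
  define \<gamma>2 where "\<gamma>2 = min 1 (\<beta>\<^sup>2 / 4)"
  have \<gamma>2: "\<gamma>2 > 0" "\<gamma>2 \<le> 1" "\<gamma>2 \<le> \<beta>\<^sup>2 / 4" using \<beta>(1) by (auto simp: \<gamma>2_def)
  define D2 where "D2 = 1 / \<gamma>2 ^ M"
  have D2: "D2 \<ge> 0" using \<gamma>2 by (simp add: D2_def)
  have energy_b: "(\<Sum>p\<in>R n. \<Sum>q\<in>R n. b n p * b n q * (1 / (1 + N\<^sup>2 * sqdist I (\<upsilon> p) (\<upsilon> q) / 4) ^ (2 * Suc m))) \<le> (D2 * (CE * N powr (- s))) ^ l"
    if N: "1 \<le> N" "N \<le> 2 ^ n" for n N
  proof -
    have "1 / (1 + N\<^sup>2 * sqdist I (\<upsilon> p) (\<upsilon> q) / 4) ^ (2 * Suc m) \<le> (\<Prod>j\<in>?L. D2 * k N (p j) (q j))" for p q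
    proof -
      define T where "T = 1 + N\<^sup>2 * sqdist I (\<upsilon> p) (\<upsilon> q) / 4"
      have T: "\<gamma>2 * (1 + (N * dist (p j) (q j))\<^sup>2) \<le> T" if j: "j \<in> ?L" for j
      proof -
        have "(\<beta> * norm (p j - q j))\<^sup>2 \<le> (norm (A j (p j - q j)))\<^sup>2"
          using \<beta> j by (intro power_mono) auto
        also have "A j (p j - q j) = A j (p j) - A j (q j)" by (rule linear_diff[OF lin[OF j]])
        also have "(norm (A j (p j) - A j (q j)))\<^sup>2 \<le> (\<Sum>j\<in>?L. (norm (A j (p j) - A j (q j)))\<^sup>2)"
          by (rule member_le_sum[OF j]) auto
        finally have "\<beta>\<^sup>2 * (dist (p j) (q j))\<^sup>2 \<le> sqdist I (\<upsilon> p) (\<upsilon> q)"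
          unfolding \<upsilon>_sq by (simp add: power_mult_distrib dist_norm)
        then have "N\<^sup>2 / 4 * (\<beta>\<^sup>2 * (dist (p j) (q j))\<^sup>2) \<le> N\<^sup>2 / 4 * sqdist I (\<upsilon> p) (\<upsilon> q)"
          by (rule mult_left_mono) simp
        moreover have "\<gamma>2 * (N * dist (p j) (q j))\<^sup>2 \<le> \<beta>\<^sup>2 / 4 * (N * dist (p j) (q j))\<^sup>2"
          using \<gamma>2(3) by (rule mult_right_mono) simp
        moreover have "\<beta>\<^sup>2 / 4 * (N * dist (p j) (q j))\<^sup>2 = N\<^sup>2 / 4 * (\<beta>\<^sup>2 * (dist (p j) (q j))\<^sup>2)"
          by (simp add: power_mult_distrib)
        moreover have "N\<^sup>2 / 4 * sqdist I (\<upsilon> p) (\<upsilon> q) = N\<^sup>2 * sqdist I (\<upsilon> p) (\<upsilon> q) / 4"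
          by simp
        moreover have "\<gamma>2 * (1 + (N * dist (p j) (q j))\<^sup>2) = \<gamma>2 + \<gamma>2 * (N * dist (p j) (q j))\<^sup>2"
          by (simp add: distrib_left)
        ultimately show ?thesis unfolding T_def using \<gamma>2(2) by linarith
      qed
      have pos: "\<gamma>2 * (1 + (N * dist (p j) (q j))\<^sup>2) > 0" for j using \<gamma>2(1) by (simp add: add_pos_nonneg)
      have T0: "T > 0" using less_le_trans[OF pos T[OF 1]] .
      \<comment> \<open>T dominates \<open>\<gamma>2\<close> times the single-factor expression for
        every j, so of its \<open>M * l\<close> powers M are spent on each j.\<close>
      have "1 / T ^ (2 * Suc m) = (\<Prod>j\<in>?L. 1 / T ^ M)"
        unfolding Ml by (simp add: power_mult power_divide)
      also have "\<dots> \<le> (\<Prod>j\<in>?L. D2 * k N (p j) (q j))"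
      proof (intro prod_mono conjI)
        fix j assume j: "j \<in> ?L"
        have "(\<gamma>2 * (1 + (N * dist (p j) (q j))\<^sup>2)) ^ M \<le> T ^ M"
          using T[OF j] pos[of j] by (intro power_mono) auto
        then have "1 / T ^ M \<le> 1 / (\<gamma>2 * (1 + (N * dist (p j) (q j))\<^sup>2)) ^ M"
          by (rule frac_le[OF zero_le_one order_refl zero_less_power[OF pos]])
        also have "\<dots> = D2 * k N (p j) (q j)" by (simp add: D2_def k_def power_mult_distrib)
        finally show "1 / T ^ M \<le> D2 * k N (p j) (q j)" .
      qed (use T0 in simp)
      finally show ?thesis unfolding T_def .
    qed
    then have "(\<Sum>p\<in>R n. \<Sum>q\<in>R n. b n p * b n q * (1 / (1 + N\<^sup>2 * sqdist I (\<upsilon> p) (\<upsilon> q) / 4) ^ (2 * Suc m))) \<le> (D2 * (CE * N powr (- s))) ^ card ?L"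
      unfolding R_def b_def using X(1,3) idx N
      by (intro weighted_product_energy_le[where k = "k N"] k_pos energy D2) auto
    then show ?thesis by simp
  qed

  \<comment> \<open>The exponent left after balancing the two energies. Its positivity is the
    hypothesis on s multiplied by l.\<close>
  define \<eta> where "\<eta> = s * l - real (l * ?d - 1) / 2 - 1"
  have ld: "real (l * ?d - 1) = real l * ?d - 1" using l by (simp add: of_nat_diff Suc_le_eq)
  have \<eta>: "\<eta> > 0"
  proof -
    have "(real ?d / 2 + 1 / (2 * real l)) * l < s * l" using s l0 by (rule mult_strict_right_mono)
    moreover have "(real ?d / 2 + 1 / (2 * real l)) * l = real l * ?d / 2 + 1 / 2" using l0 by (simp add: field_simps)
    ultimately show ?thesis unfolding \<eta>_def ld by (simp add: diff_divide_distrib)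
  qed
  define CC where "CC = C * ((D1 * CE) ^ l + (D2 * CE) ^ l)"
  have main: "\<bar>\<Sum>p\<in>P n. \<Sum>q\<in>R n. a n p * b n q * gauss_deriv (2 * Suc m) (N * (1 / \<xi> p (j0, b0) * (t - \<tau> p q)))\<bar> \<le> CC * N powr (- 1 - \<eta>)"
    if t: "\<bar>t - u0\<bar> \<le> \<rho>" and N: "1 \<le> N" "N \<le> 2 ^ n" for n N t
  proof -
    have t': "\<rho> \<le> \<bar>t\<bar>" using t unfolding \<rho>_def by linarith
    define e where "e = real (l * ?d - 1)"
    \<comment> \<open>Balances \<sigma> N^(ld-1) against 1/\<sigma>: both terms become N^((ld-1)/2 -
      ls) up to constants.\<close>
    define \<sigma> where "\<sigma> = N powr (- (e / 2))"
    have N0: "N > 0" using N by simp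
    have \<sigma>: "\<sigma> > 0" using N0 by (simp add: \<sigma>_def)
    have "\<bar>\<Sum>p\<in>P n. \<Sum>q\<in>R n. a n p * b n q * gauss_deriv (2 * Suc m) (N * (1 / \<xi> p (j0, b0) * (t - \<tau> p q)))\<bar>
      \<le> C * (\<sigma> * N ^ (card I - 1) * (\<Sum>p\<in>P n. \<Sum>q\<in>P n. a n p * a n q * exp (- \<gamma> * (N\<^sup>2 * sqdist I (\<xi> p) (\<xi> q))))
       + 1 / \<sigma> * (\<Sum>p\<in>R n. \<Sum>q\<in>R n. b n p * b n q * (1 / (1 + N\<^sup>2 * sqdist I (\<upsilon> p) (\<upsilon> q) / 4) ^ (2 * Suc m))))"
      unfolding \<tau>
    proof (rule decay[THEN spec[of _ "P n"], THEN spec[of _ "R n"], THEN spec[of _ "a n"], THEN spec[of _ "b n"],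
          THEN spec[of _ \<xi>], THEN spec[of _ \<upsilon>], THEN spec[of _ t], THEN spec[of _ N], THEN spec[of _ \<sigma>],
          THEN mp[OF _ N(1)], THEN mp[OF _ \<sigma>], THEN mp[OF _ t'], THEN mp, THEN mp])
      show "\<forall>p\<in>P n. 0 \<le> a n p \<and> c \<le> \<bar>\<xi> p (j0, b0)\<bar> \<and> (\<forall>i\<in>I. \<bar>\<xi> p i\<bar> \<le> K)"
      proof (intro ballI conjI a0)
        fix p assume p: "p \<in> P n"
        have "\<bar>(p j0 - x0 (2*j0-1)) \<bullet> b0\<bar> \<le> c"
          using Basis_le_norm[OF b0(1), of "p j0 - x0 (2*j0-1)"] E'_dist[OF PE[OF p j0(1)]] r(3) by (simp add: dist_norm)
        then show "c \<le> \<bar>\<xi> p (j0, b0)\<bar>" unfolding \<xi>_def c_def inner_diff_left fst_conv snd_conv by linarith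
        show "\<bar>\<xi> p i\<bar> \<le> K" if "i \<in> I" for i
        proof -
          have i: "fst i \<in> ?L" "snd i \<in> Basis" using that by (auto simp: I_def)
          show ?thesis unfolding \<xi>_def
            using Basis_le_norm[OF i(2), of "p (fst i)"] K(2)[OF idx(1)[OF i(1)] PE[OF p i(1)]] by linarith
        qed
      qed
      show "\<forall>q\<in>R n. 0 \<le> b n q \<and> (\<forall>i\<in>I. \<bar>\<upsilon> q i\<bar> \<le> K)"
      proof (intro ballI conjI b0')
        fix q i assume q: "q \<in> R n" and "i \<in> I"
        then have i: "fst i \<in> ?L" "snd i \<in> Basis" by (auto simp: I_def)
        show "\<bar>\<upsilon> q i\<bar> \<le> K" unfolding \<upsilon>_def
          using Basis_le_norm[OF i(2), of "A (fst i) (q (fst i))"] K(3)[OF i(1) RE[OF q i(1)]] by linarith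
      qed
    qed
    also have "\<dots> \<le> C * (\<sigma> * N ^ (card I - 1) * (D1 * (CE * N powr (- s))) ^ l + 1 / \<sigma> * (D2 * (CE * N powr (- s))) ^ l)"
      using C(1) \<sigma> N0 by (intro mult_left_mono add_mono energy_a[OF N] energy_b[OF N]) auto
    also have "\<dots> = CC * N powr (- 1 - \<eta>)"
    proof -
      have Npow: "N ^ (card I - 1) = N powr e" unfolding I(3) e_def using N0 by (simp add: powr_realpow)
      have Ns: "(N powr (- s)) ^ l = N powr (- (s * l))" using N0 by (simp add: powr_realpow[symmetric] powr_powr)
      have exps: "- (e / 2) + e + - (s * l) = - 1 - \<eta>" "e / 2 + - (s * l) = - 1 - \<eta>"
        by (simp_all add: \<eta>_def e_def)
      have 1: "\<sigma> * N ^ (card I - 1) * (D1 * (CE * N powr (- s))) ^ l = (D1 * CE) ^ l * N powr (- 1 - \<eta>)"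
        unfolding exps(1)[symmetric] powr_add Npow \<sigma>_def power_mult_distrib Ns by (simp only: mult_ac)
      have 2: "1 / \<sigma> * (D2 * (CE * N powr (- s))) ^ l = (D2 * CE) ^ l * N powr (- 1 - \<eta>)"
      proof -
        have "1 / \<sigma> = N powr (e / 2)" by (simp add: \<sigma>_def powr_minus_divide)
        then show ?thesis unfolding exps(2)[symmetric] powr_add power_mult_distrib Ns by (simp only: mult_ac)
      qed
      show ?thesis unfolding 1 2 CC_def by (simp only: distrib_right mult.assoc)
    qed
    finally show ?thesis .
  qed

  have "interior S \<noteq> {}"
  \<comment> \<open>The dilation v = 1/x_0 is the chart variable u: multiplying t - x \<bullet> y by
    it gives the bilinear phase. The bounds c \<le> \<bar>x_0\<bar> \<le> K become 1/K \<le>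
    \<bar>v\<bar> \<le> 1/c.\<close>
  proof (rule nonempty_interior_of_decay[where Z = "\<lambda>n. P n \<times> R n" and g = "\<lambda>n z. a n (fst z) * b n (snd z)"
        and \<tau> = "\<lambda>n z. \<tau> (fst z) (snd z)" and v = "\<lambda>n z. 1 / \<xi> (fst z) (j0, b0)" and ?u0.0 = u0 and \<rho> = \<rho>
        and c = "1 / K" and K = "1 / c" and \<eta> = \<eta> and C = CC and m = m, OF S \<rho> _ \<eta>])
    show "1 / K > 0" using K(1) by simp
    show "finite (P n \<times> R n)" for n using fin by simp
    show "0 \<le> a n (fst z) * b n (snd z)" for n z using a0 b0' by simp
    show "(\<Sum>z\<in>P n \<times> R n. a n (fst z) * b n (snd z)) = 1" for n
    proof -
      have "(\<Sum>z\<in>P n \<times> R n. a n (fst z) * b n (snd z)) = sum (a n) (P n) * sum (b n) (R n)"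
        by (simp add: sum_product sum.cartesian_product case_prod_beta)
      then show ?thesis by (simp add: mass)
    qed
    fix n z assume z: "z \<in> P n \<times> R n"
    then have pq: "fst z \<in> P n" "snd z \<in> R n" by auto
    define x where "x i = (if odd i then fst z ((i + 1) div 2) else snd z (i div 2))" for i :: nat
    have x: "x (2*j-1) = fst z j" "x (2*j) = snd z j" if "j \<in> ?L" for j
      using that by (auto simp: x_def)
    have xE: "x i \<in> E' i" if i: "i \<in> {1..2*l}" for i
    proof (cases "odd i")
      case True
      then obtain j where j: "i = 2 * j + 1" by (rule oddE)
      then have "j + 1 \<in> ?L" using i by auto
      then have "x (2*(j+1)-1) \<in> E' (2*(j+1)-1)" using x(1) PE[OF pq(1)] by metis
      then show ?thesis by (simp add: j)
    next
      case False
      then have "even i" by simp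
      then obtain j where j: "i = 2 * j" by (rule evenE)
      then have "j \<in> ?L" using i by auto
      then have "x (2*j) \<in> E' (2*j)" using x(2) RE[OF pq(2)] by metis
      then show ?thesis by (simp add: j)
    qed
    have \<tau>x: "\<tau> (fst z) (snd z) = (\<Sum>j\<in>?L. x (2*j-1) \<bullet> A j (x (2*j)))"
      unfolding \<tau>_def by (intro sum.cong refl) (simp only: x)
    show "\<tau> (fst z) (snd z) \<in> S" unfolding S_def \<tau>x using xE by blast
    show "\<bar>\<tau> (fst z) (snd z) - u0\<bar> \<le> \<rho> / 2" unfolding \<tau>x
      by (rule r1(2)) (use E'_dist[OF xE] r(2) in \<open>meson order.trans\<close>)
    have lower: "c \<le> \<bar>\<xi> (fst z) (j0, b0)\<bar>"
    proof -
      have "\<bar>(fst z j0 - x0 (2*j0-1)) \<bullet> b0\<bar> \<le> c"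
        using Basis_le_norm[OF b0(1), of "fst z j0 - x0 (2*j0-1)"] E'_dist[OF PE[OF pq(1) j0(1)]] r(3) by (simp add: dist_norm)
      then show ?thesis unfolding \<xi>_def c_def inner_diff_left fst_conv snd_conv by linarith
    qed
    have upper: "\<bar>\<xi> (fst z) (j0, b0)\<bar> \<le> K"
      unfolding \<xi>_def using Basis_le_norm[OF b0(1), of "fst z j0"] K(2)[OF idx(1)[OF j0(1)] PE[OF pq(1) j0(1)]] by simp
    show "1 / K \<le> \<bar>1 / \<xi> (fst z) (j0, b0)\<bar>" "\<bar>1 / \<xi> (fst z) (j0, b0)\<bar> \<le> 1 / c"
      unfolding abs_divide abs_one using lower upper c
      by (intro frac_le[OF zero_le_one order_refl]; linarith)+
  next
    fix n and N t :: real assume "\<bar>t - u0\<bar> \<le> \<rho>" "1 \<le> N" "N \<le> 2 ^ n"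
    from main[OF this]
    show "\<bar>\<Sum>z\<in>P n \<times> R n. a n (fst z) * b n (snd z) * gauss_deriv (2 * Suc m) (N * (1 / \<xi> (fst z) (j0, b0) * (t - \<tau> (fst z) (snd z))))\<bar>
        \<le> CC * N powr (- 1 - \<eta>)"
      by (simp add: sum.cartesian_product case_prod_beta)
  qed
  then show ?thesis using interior_mono[OF S_sub] by blast
qed

theorem theorem1p7:
  fixes l :: nat
    and Q :: "nat \<Rightarrow> 'a::euclidean_space \<Rightarrow> 'a \<Rightarrow> real"
    and E :: "nat \<Rightarrow> 'a set"
  assumes "l \<ge> 1"
    and "\<forall>j\<in>{1..l}. bilinear (Q j)"
    and "\<forall>j\<in>{1..l}. \<forall>x y. Q j x y = Q j y x"
    and "\<forall>j\<in>{1..l}. \<forall>x. (\<forall>y. Q j x y = 0) \<longrightarrow> x = 0"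
    and "\<forall>i\<in>{1..2*l}. compact (E i)"
    and "\<forall>i\<in>{1..2*l}. hausdorff_dim (E i) > real DIM('a) / 2 + 1 / (2 * real l)"
  shows "interior {\<Sum>j\<in>{1..l}. Q j (x (2*j-1)) (x (2*j)) | x. \<forall>i\<in>{1..2*l}. x i \<in> E i} \<noteq> {}
       \<and> interior {\<Sum>j\<in>{1..l}. x (2*j-1) \<bullet> x (2*j) | x. \<forall>i\<in>{1..2*l}. x i \<in> E i} \<noteq> {}"
proof -
  define s0 where "s0 = real DIM('a) / 2 + 1 / (2 * real l)"
  \<comment> \<open>The least of the finitely many dimensions, so that one exponent s strictly
    between the threshold and h serves all the sets.\<close>
  define h where "h = Min ((\<lambda>i. hausdorff_dim (E i)) ` {1..2*l})"
  have s0: "s0 \<ge> 0" by (simp add: s0_def)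
  have "h > s0" unfolding h_def s0_def using assms(1,6) by (subst Min_gr_iff) auto
  then obtain s where s: "s0 < s" "s < h" using dense by blast
  have null: "\<not> null_content s (E i)" if "i \<in> {1..2*l}" for i
  proof (rule not_null_content_less_dim)
    show "0 < s" using s s0 by linarith
    have "h \<le> hausdorff_dim (E i)" unfolding h_def using that by simp
    then show "s < hausdorff_dim (E i)" using s by linarith
  qed
  \<comment> \<open>The operator representing the form: its coordinate along b is the value of the
    form at b and y.\<close>
  define A where "A j y = (\<Sum>b\<in>Basis. Q j b y *\<^sub>R b)" for j and y :: 'a
  have A: "x \<bullet> A j y = Q j x y" if "j \<in> {1..l}" for j x y
  proof -
    have bil: "bilinear (Q j)" using assms(2) that by blast
    have lin1: "linear (\<lambda>x. Q j x y)" using bil by (simp add: bilinear_def)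
    have "Q j x y = Q j (\<Sum>b\<in>Basis. (x \<bullet> b) *\<^sub>R b) y" by (simp add: euclidean_representation)
    also have "\<dots> = (\<Sum>b\<in>Basis. (x \<bullet> b) * Q j b y)" by (simp add: linear_sum[OF lin1] linear_scale[OF lin1])
    finally show ?thesis by (simp add: A_def inner_sum_right mult.commute)
  qed
  have lin: "linear (A j)" if "j \<in> {1..l}" for j
  proof -
    have lin2: "linear (Q j x)" for x using assms(2) that by (simp add: bilinear_def)
    show ?thesis
      by (rule linearI) (simp_all add: A_def linear_add[OF lin2] linear_scale[OF lin2] scaleR_add_left sum.distrib scaleR_sum_right)
  qed
  have inj: "inj (A j)" if j: "j \<in> {1..l}" for j
    unfolding linear_injective_0[OF lin[OF j]]
  proof (intro allI impI)
    fix y assume "A j y = 0"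
    then have "Q j x y = 0" for x using A[OF j, of x y] by simp
    \<comment> \<open>Nondegeneracy is assumed in the first argument, whereas the kernel of A_j
      concerns the second; symmetry exchanges them.\<close>
    then show "y = 0" using assms(3,4) j by metis
  qed
  have "interior {\<Sum>j\<in>{1..l}. x (2*j-1) \<bullet> A j (x (2*j)) | x. \<forall>i\<in>{1..2*l}. x i \<in> E i} \<noteq> {}"
    using assms(5) by (intro bilinear_sumset_interior[OF assms(1) lin inj _ null s(1)[unfolded s0_def]]) auto
  moreover have "(\<Sum>j\<in>{1..l}. x (2*j-1) \<bullet> A j (x (2*j))) = (\<Sum>j\<in>{1..l}. Q j (x (2*j-1)) (x (2*j)))" for x
    by (intro sum.cong refl A)
  \<comment> \<open>For the Euclidean inner product the representing operator is the identity, so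
    the bilinear result applies with every A_j equal to \<open>id\<close>.\<close>
  moreover have "interior {\<Sum>j\<in>{1..l}. x (2*j-1) \<bullet> id (x (2*j)) | x. \<forall>i\<in>{1..2*l}. x i \<in> E i} \<noteq> {}"
    using assms(5) by (intro bilinear_sumset_interior[OF assms(1) linear_id inj_on_id _ null s(1)[unfolded s0_def]]) auto
  ultimately show ?thesis by simp
qed

end
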